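(* Let $\overline{\boldsymbol f}=((f_i,\varphi_i))_{i=1}^\infty\in\overline{\mathcal B}$, where $\overline{\mathcal B}$ is defined in the context for $X=\mathbb P^N$ over $\mathbb C$ and $(L,\|\cdot\|)=(\mathcal O_{\mathbb P^N}(1),\|\cdot\|_{FS})$, with $\|\cdot\|_{FS}$ the Fubini–Study metric. Let $\widehat{\|\cdot\|}_{\mathcal O_{\mathbb P^N}(1),\overline{\boldsymbol f}}$ be the admissible metric for $\overline{\boldsymbol f}$ on $\mathcal O_{\mathbb P^N}(1)$ and $T_{\overline{\boldsymbol f}}$ the Green current for $\overline{\boldsymbol f}$ on $\mathbb P^N(\mathbb C)$. Then $$c_1\big(\mathcal O_{\mathbb P^N}(1),\widehat{\|\cdot\|}_{\mathcal O_{\mathbb P^N}(1),\overline{\boldsymbol f}}\big)=T_{\overline{\boldsymbol f}}.$$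
   Context: $\overline{\mathcal H}$ is the set of pairs $\overline f=(f,\varphi)$ with $f:\mathbb P^N\to\mathbb P^N$ a morphism over $\mathbb C$ and $\varphi:\mathcal O_{\mathbb P^N}(d_f)\xrightarrow{\sim}f^*\mathcal O_{\mathbb P^N}(1)$ an isomorphism, $d_f\ge2$ an integer. Put $\overline c(\overline f)=\sup_{x\in\mathbb P^N(\mathbb C)}\left|\log\frac{(\varphi^*f^*\|\cdot\|_{FS})^{1/d_f}}{\|\cdot\|_{FS}}(x)\right|$; for a sequence $\overline{\boldsymbol f}=(\overline f_i)_{i\ge1}$ put $\overline c(\overline{\boldsymbol f})=\sup_i\overline c(\overline f_i)$, and let $\overline{\mathcal B}$ be the set of sequences in $\overline{\mathcal H}$ with $\overline c(\overline{\boldsymbol f})<+\infty$. Let $S$ be the shift $S((\overline f_i)_{i\ge1})=(\overline f_{i+1})_{i\ge1}$. Admissible metrics: the unique family of continuous metrics $\widehat{\|\cdot\|}_{\mathcal O_{\mathbb P^N}(1),\overline{\boldsymbol f}}$ on $\mathcal O_{\mathbb P^N}(1)$, $\overline{\boldsymbol f}\in\overline{\mathcal B}$, such that $\sup_{x}\left|\log\frac{\widehat{\|\cdot\|}_{\mathcal O_{\mathbb P^N}(1),\overline{\boldsymbol f}}}{\|\cdot\|_{FS}}(x)\right|\le2\overline c(\overline{\boldsymbol f})$ and $\varphi_1^*f_1^*\widehat{\|\cdot\|}_{\mathcal O_{\mathbb P^N}(1),S(\overline{\boldsymbol f})}=\widehat{\|\cdot\|}^{\,d_{f_1}}_{\mathcal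 O_{\mathbb P^N}(1),\overline{\boldsymbol f}}$. Equivalently it is the uniform limit, as $i\to\infty$, of the metrics $\big(\varphi_1^*f_1^*\cdots(\varphi_i^*f_i^*\|\cdot\|_{FS})^{1/d_{f_i}}\cdots\big)^{1/d_{f_1}}$. First Chern current: for any non-zero section $s$ of $\mathcal O_{\mathbb P^N}(1)$, $$c_1\big(\mathcal O_{\mathbb P^N}(1),\widehat{\|\cdot\|}_{\mathcal O_{\mathbb P^N}(1),\overline{\boldsymbol f}}\big):=dd^c\big[-\log\widehat{\|s\|}^2_{\mathcal O_{\mathbb P^N}(1),\overline{\boldsymbol f}}\big]+\delta_{\mathrm{div}(s)},\qquad dd^c=\tfrac{i}{2\pi}\partial\overline\partial.$$ Green current: let $F^i=(F^i_0,\dots,F^i_N):\mathbb C^{N+1}\to\mathbb C^{N+1}$ with $F^i_k=\varphi_i^*f_i^*(X_k)$, homogeneous polynomials of degree $d_{f_i}$ with $f_i=(F^i_0:\cdots:F^i_N)$. Put $G_0(x)=\log|x|^2$ and $G_i(x)=\frac1{\prod_{\alpha=1}^i d_{f_\alpha}}\log|F^i\circ\cdots\circ F^1(x)|^2$ on $\mathbb C^{N+1}\setminus\{0\}$, with $|\cdot|$ the Euclidean norm. The $G_i$ converge uniformly to a continuous plurisubharmonic function $G_{\overline{\boldsymbol f}}$ on $\mathbb C^{N+1}\setminus\{0\}$, and $T_{\overline{\boldsymbol f}}$ is the positive closed $(1,1)$ current on $\mathbb P^N(\mathbb C)$ with $\pi^*T_{\overline{\boldsymbol f}}=dd^c(G_{\overline{\boldsymbol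 f}})$, where $\pi:\mathbb C^{N+1}\setminus\{0\}\to\mathbb P^N(\mathbb C)$ is the natural projection. *)

theory Defs
  imports "HOL-Analysis.Analysis"
begin

section \<open>Complex projective space\<close>

text \<open>
  The homogeneous coordinates of \<open>\<P>\<^sup>N\<close> are indexed by a finite type \<open>'n\<close>, so \<open>N = CARD('n) - 1\<close>.
  A point is represented by its preimage under the projection from \<open>\<complex>\<^sup>N\<^sup>+\<^sup>1 - {0}\<close>, that is, by a
  complex line without the origin; \<open>cone p\<close> is this preimage.
\<close>

typedef ('n::finite) proj =
  "{L :: (complex^'n) set. \<exists>x. x \<noteq> 0 \<and> L = {c *s x | c. c \<noteq> 0}}"
  morphisms cone Abs_proj
proof -
  have "{c *s (1 :: complex^'n) | c. c \<noteq> 0} \<in>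
      {L :: (complex^'n) set. \<exists>x. x \<noteq> 0 \<and> L = {c *s x | c. c \<noteq> 0}}"
    by (auto intro!: exI[of _ 1])
  then show ?thesis by blast
qed

text \<open>The projection \<open>\<pi>\<close>; its value at \<open>0\<close> is irrelevant.\<close>

definition proj :: "complex^'n \<Rightarrow> 'n::finite proj" where
  "proj x = Abs_proj {c *s x | c. c \<noteq> 0}"

definition rep :: "'n::finite proj \<Rightarrow> complex^'n" where
  "rep p = (SOME x. x \<in> cone p)"

text \<open>The quotient topology.\<close>

instantiation proj :: (finite) topological_space
begin

definition open_proj :: "'a proj set \<Rightarrow> bool" where
  "open_proj U \<longleftrightarrow> open {x. x \<noteq> 0 \<and> proj x \<in> U}"

instance
proof
  have eq: "{x. x \<noteq> 0 \<and> proj x \<in> (UNIV :: 'a proj set)} = - {0}" by auto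
  show "open (UNIV :: 'a proj set)"
    unfolding open_proj_def eq by (simp add: open_Compl)
next
  fix S T :: "'a proj set"
  assume "open S" "open T"
  then have "open ({x. x \<noteq> 0 \<and> proj x \<in> S} \<inter> {x. x \<noteq> 0 \<and> proj x \<in> T})"
    unfolding open_proj_def by (rule open_Int)
  moreover have "{x. x \<noteq> 0 \<and> proj x \<in> S} \<inter> {x. x \<noteq> 0 \<and> proj x \<in> T}
      = {x. x \<noteq> 0 \<and> proj x \<in> S \<inter> T}" by auto
  ultimately show "open (S \<inter> T)" unfolding open_proj_def by simp
next
  fix K :: "'a proj set set"
  assume "\<forall>S\<in>K. open S"
  then have "open (\<Union>S\<in>K. {x. x \<noteq> 0 \<and> proj x \<in> S})"
    unfolding open_proj_def by blast
  moreover have "(\<Union>S\<in>K. {x. x \<noteq> 0 \<and> proj x \<in> S}) = {x. x \<noteq> 0 \<and> proj x \<in> \<Union>K}" by auto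
  ultimately show "open (\<Union>K)" unfolding open_proj_def by simp
qed

end

definition hom_poly :: "nat \<Rightarrow> (complex^'n \<Rightarrow> complex) \<Rightarrow> bool" where
  "hom_poly d P \<longleftrightarrow>
     (\<exists>a :: ('n \<Rightarrow> nat) \<Rightarrow> complex.
        \<forall>x. P x = (\<Sum>m | sum m UNIV = d. a m * (\<Prod>i\<in>UNIV. (x $ i) ^ m i)))"

text \<open>Morphisms of the variety \<open>\<P>\<^sup>N\<close>: locally given by homogeneous polynomials of equal degree.\<close>

definition is_morphism :: "('n::finite proj \<Rightarrow> 'n proj) \<Rightarrow> bool" where
  "is_morphism f \<longleftrightarrow>
     (\<forall>p. \<exists>m (P :: complex^'n \<Rightarrow> complex^'n).
        (\<forall>k. hom_poly m (\<lambda>x. P x $ k)) \<and> (\<exists>x\<in>cone p. P x \<noteq> 0) \<and>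
        (\<forall>x. x \<noteq> 0 \<longrightarrow> P x \<noteq> 0 \<longrightarrow> f (proj x) = proj (P x)))"


section \<open>The line bundles \<open>\<O>(d)\<close> and their metrics\<close>

text \<open>
  The fibre of \<open>\<O>(d)\<close> at \<open>p\<close> is the space of functions on the punctured line \<open>cone p\<close> that are
  homogeneous of degree \<open>d\<close> (extended by \<open>0\<close>). Thus \<open>v \<mapsto> v\<^sup>d\<close> (pointwise power) is the map
  \<open>\<O>(1) \<rightarrow> \<O>(1)\<^sup>\<otimes>\<^sup>d = \<O>(d)\<close>, and the global sections of \<open>\<O>(d)\<close> are the homogeneous polynomials of
  degree \<open>d\<close>; \<open>value_at s p\<close> is the value of such a section in the fibre at \<open>p\<close>.
\<close>

definition fibre :: "nat \<Rightarrow> 'n::finite proj \<Rightarrow> (complex^'n \<Rightarrow> complex) set" where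
  "fibre d p = {v. (\<forall>x\<in>cone p. \<forall>c. c \<noteq> 0 \<longrightarrow> v (c *s x) = c ^ d * v x) \<and> (\<forall>x. x \<notin> cone p \<longrightarrow> v x = 0)}"

definition value_at :: "(complex^'n \<Rightarrow> complex) \<Rightarrow> 'n::finite proj \<Rightarrow> complex^'n \<Rightarrow> complex" where
  "value_at s p = (\<lambda>x. if x \<in> cone p then s x else 0)"

type_synonym 'n metric = "'n proj \<Rightarrow> (complex^'n \<Rightarrow> complex) \<Rightarrow> real"

definition is_metric :: "'n::finite metric \<Rightarrow> bool" where
  "is_metric h \<longleftrightarrow>
     (\<forall>p. \<forall>v\<in>fibre 1 p. 0 \<le> h p v \<and> (h p v = 0 \<longleftrightarrow> v = (\<lambda>x. 0)) \<and>
        (\<forall>a. h p (\<lambda>x. a * v x) = norm a * h p v))"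

text \<open>A local section \<open>s\<close> over \<open>U\<close> is continuous iff the homogeneous function on \<open>\<pi>\<^sup>-\<^sup>1(U)\<close> that it
  defines is continuous.\<close>

definition continuous_metric :: "'n::finite metric \<Rightarrow> bool" where
  "continuous_metric h \<longleftrightarrow> is_metric h \<and>
     (\<forall>U s. open U \<longrightarrow> (\<forall>p\<in>U. s p \<in> fibre 1 p) \<longrightarrow>
        continuous_on {x. x \<noteq> 0 \<and> proj x \<in> U} (\<lambda>x. s (proj x) x) \<longrightarrow>
        continuous_on U (\<lambda>p. h p (s p)))"

definition fubini_study :: "'n::finite metric" where
  "fubini_study p v = norm (v (rep p)) / norm (rep p)"

definition metric_ratio :: "'n::finite metric \<Rightarrow> 'n metric \<Rightarrow> 'n proj \<Rightarrow> real" where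
  "metric_ratio h h' p = (THE r. \<forall>v\<in>fibre 1 p. v \<noteq> (\<lambda>x. 0) \<longrightarrow> h p v / h' p v = r)"

text \<open>The metric on \<open>\<O>(1)\<close> induced by a metric on \<open>\<O>(d)\<close>.\<close>

definition metric_root :: "nat \<Rightarrow> 'n::finite metric \<Rightarrow> 'n metric" where
  "metric_root d h p v = root d (h p (\<lambda>x. v x ^ d))"


section \<open>Polarised morphisms and admissible metrics\<close>

record ('n::finite) pol_morphism =
  mor :: "'n proj \<Rightarrow> 'n proj"
  deg :: nat
  iso :: "'n proj \<Rightarrow> (complex^'n \<Rightarrow> complex) \<Rightarrow> (complex^'n \<Rightarrow> complex)"

text \<open>
  \<open>iso f p\<close> is the map \<open>\<phi>\<^sub>p : \<O>(d)\<^sub>p \<rightarrow> \<O>(1)\<^bsub>f(p)\<^esub>\<close> on fibres, and \<open>lift f\<close> is the map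
  \<open>F = (F\<^sub>0, \<dots>, F\<^sub>N)\<close> with \<open>F\<^sub>k = \<phi>\<^sup>*f\<^sup>*(X\<^sub>k) = \<phi>\<^sup>-\<^sup>1(f\<^sup>*X\<^sub>k)\<close>.
\<close>

definition lift :: "'n::finite pol_morphism \<Rightarrow> complex^'n \<Rightarrow> complex^'n" where
  "lift f x = (\<chi> k. inv_into (fibre (deg f) (proj x)) (iso f (proj x))
                      (value_at (\<lambda>y. y $ k) (mor f (proj x))) x)"

text \<open>
  Regularity at \<open>p\<close> of a section of \<open>\<O>(d)\<close>, and of a section of \<open>f\<^sup>*\<O>(1)\<close>. The sheaf \<open>f\<^sup>*\<O>(1)\<close> is
  generated over the regular functions by the sections \<open>f\<^sup>*X\<^sub>k\<close>, whose value at \<open>q\<close> is the value of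
  the coordinate \<open>X\<^sub>k\<close> at \<open>f(q)\<close>. The sets \<open>Q \<noteq> 0\<close> are a basis of the Zariski topology.
\<close>

definition regular_at ::
    "nat \<Rightarrow> ('n::finite proj \<Rightarrow> complex^'n \<Rightarrow> complex) \<Rightarrow> 'n proj \<Rightarrow> bool" where
  "regular_at d \<sigma> p \<longleftrightarrow>
     (\<exists>m P Q. hom_poly (m + d) P \<and> hom_poly m Q \<and> (\<forall>x\<in>cone p. Q x \<noteq> 0) \<and>
        (\<forall>q. \<forall>x\<in>cone q. Q x \<noteq> 0 \<longrightarrow> \<sigma> q x = P x / Q x))"

definition regular_pullback_at ::
    "('n::finite proj \<Rightarrow> 'n proj) \<Rightarrow> ('n proj \<Rightarrow> complex^'n \<Rightarrow> complex) \<Rightarrow> 'n proj \<Rightarrow> bool" where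
  "regular_pullback_at f \<tau> p \<longleftrightarrow>
     (\<exists>m (P :: 'n \<Rightarrow> complex^'n \<Rightarrow> complex) Q.
        (\<forall>k. hom_poly m (P k)) \<and> hom_poly m Q \<and> (\<forall>x\<in>cone p. Q x \<noteq> 0) \<and>
        (\<forall>q. \<forall>x\<in>cone q. Q x \<noteq> 0 \<longrightarrow>
           \<tau> q = (\<lambda>y. \<Sum>k\<in>UNIV. (P k x / Q x) * value_at (\<lambda>z. z $ k) (f q) y)))"

text \<open>Isomorphisms \<open>\<O>(d) \<rightarrow> f\<^sup>*\<O>(1)\<close> of algebraic line bundles.\<close>

definition bundle_iso ::
    "nat \<Rightarrow> ('n::finite proj \<Rightarrow> 'n proj) \<Rightarrow>
      ('n proj \<Rightarrow> (complex^'n \<Rightarrow> complex) \<Rightarrow> (complex^'n \<Rightarrow> complex)) \<Rightarrow> bool" where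
  "bundle_iso d f \<phi> \<longleftrightarrow>
     (\<forall>p. bij_betw (\<phi> p) (fibre d p) (fibre 1 (f p)) \<and>
        (\<forall>v\<in>fibre d p. \<forall>w\<in>fibre d p. \<forall>a.
           \<phi> p (\<lambda>x. a * v x + w x) = (\<lambda>x. a * \<phi> p v x + \<phi> p w x))) \<and>
     (\<forall>\<sigma>. (\<forall>q. \<sigma> q \<in> fibre d q) \<longrightarrow>
        (\<forall>p. regular_at d \<sigma> p \<longleftrightarrow> regular_pullback_at f (\<lambda>q. \<phi> q (\<sigma> q)) p))"

definition Hbar :: "'n::finite pol_morphism set" where
  "Hbar = {f. 2 \<le> deg f \<and> is_morphism (mor f) \<and> bundle_iso (deg f) (mor f) (iso f)}"

text \<open>The metric \<open>\<phi>\<^sup>*f\<^sup>*h\<close> on \<open>\<O>(d)\<close>.\<close>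

definition pullback_metric :: "'n::finite pol_morphism \<Rightarrow> 'n metric \<Rightarrow> 'n metric" where
  "pullback_metric f h p v = h (mor f p) (iso f p v)"

definition cbar :: "'n::finite pol_morphism \<Rightarrow> ereal" where
  "cbar f = (SUP p. ereal \<bar>ln (metric_ratio
      (metric_root (deg f) (pullback_metric f fubini_study)) fubini_study p)\<bar>)"

text \<open>Sequences are indexed from \<open>0\<close>: \<open>fs i\<close> is the \<open>(i+1)\<close>-st term.\<close>

definition cbar_seq :: "(nat \<Rightarrow> 'n::finite pol_morphism) \<Rightarrow> ereal" where
  "cbar_seq fs = (SUP i. cbar (fs i))"

definition Bbar :: "(nat \<Rightarrow> 'n::finite pol_morphism) set" where
  "Bbar = {fs. (\<forall>i. fs i \<in> Hbar) \<and> cbar_seq fs < \<infinity>}"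

definition shift :: "(nat \<Rightarrow> 'n::finite pol_morphism) \<Rightarrow> nat \<Rightarrow> 'n pol_morphism" where
  "shift fs = (\<lambda>i. fs (Suc i))"

text \<open>The defining properties of the family of admissible metrics. The last condition is
  \<open>\<phi>\<^sub>1\<^sup>*f\<^sub>1\<^sup>*h\<^bsub>S(f)\<^esub> = h\<^sub>f\<^sup>d\<close>, tested on the vectors \<open>v\<^sup>d\<close>, which exhaust the fibres of \<open>\<O>(d)\<close>.\<close>

definition admissible_metrics ::
    "((nat \<Rightarrow> 'n::finite pol_morphism) \<Rightarrow> 'n metric) \<Rightarrow> bool" where
  "admissible_metrics h \<longleftrightarrow>
     (\<forall>fs\<in>Bbar.
        continuous_metric (h fs) \<and>
        (SUP p. ereal \<bar>ln (metric_ratio (h fs) fubini_study p)\<bar>) \<le> 2 * cbar_seq fs \<and>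
        (\<forall>p. \<forall>v\<in>fibre 1 p.
           pullback_metric (fs 0) (h (shift fs)) p (\<lambda>x. v x ^ deg (fs 0)) = h fs p v ^ deg (fs 0)))"


section \<open>Differential forms\<close>

fun Ck_on :: "nat \<Rightarrow> 'a::real_normed_vector set \<Rightarrow> ('a \<Rightarrow> 'b::real_normed_vector) \<Rightarrow> bool" where
  "Ck_on 0 S f \<longleftrightarrow> continuous_on S f"
| "Ck_on (Suc k) S f \<longleftrightarrow>
     (\<forall>x\<in>S. f differentiable (at x)) \<and> (\<forall>v. Ck_on k S (\<lambda>x. frechet_derivative f (at x) v))"

definition smooth_on :: "'a::real_normed_vector set \<Rightarrow> ('a \<Rightarrow> 'b::real_normed_vector) \<Rightarrow> bool" where
  "smooth_on S f \<longleftrightarrow> (\<forall>k. Ck_on k S f)"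

text \<open>
  A complex-valued form of degree \<open>k\<close> on \<open>\<complex>\<^sup>N\<^sup>+\<^sup>1 - {0}\<close> is a function of a point and a list of
  tangent vectors, alternating and real multilinear on lists of length \<open>k\<close>. By convention it
  is \<open>0\<close> on lists of other lengths and at the origin, so that equality of forms is equality of
  functions.
\<close>

type_synonym 'n form = "complex^'n \<Rightarrow> (complex^'n) list \<Rightarrow> complex"

definition alternating :: "nat \<Rightarrow> ((complex^'n) list \<Rightarrow> complex) \<Rightarrow> bool" where
  "alternating k \<alpha> \<longleftrightarrow>
     (\<forall>vs. length vs \<noteq> k \<longrightarrow> \<alpha> vs = 0) \<and>
     (\<forall>vs. length vs = k \<longrightarrow> \<not> distinct vs \<longrightarrow> \<alpha> vs = 0) \<and>
     (\<forall>us ws v w r. length us + length ws + 1 = k \<longrightarrow>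
        \<alpha> (us @ (r *\<^sub>R v + w) # ws) = of_real r * \<alpha> (us @ v # ws) + \<alpha> (us @ w # ws))"

text \<open>Smooth forms of bidegree \<open>(p,q)\<close>. A form of degree \<open>p + q\<close> has this bidegree iff scaling all
  arguments by \<open>c\<close> multiplies it by \<open>c\<^sup>p\<close> times the \<open>q\<close>-th power of the conjugate of \<open>c\<close>.\<close>

definition forms :: "nat \<Rightarrow> nat \<Rightarrow> ('n::finite) form set" where
  "forms p q = {\<omega>.
     (\<forall>x. alternating (p + q) (\<omega> x)) \<and>
     (\<forall>x vs c. \<omega> x (map ((*s) c) vs) = c ^ p * cnj c ^ q * \<omega> x vs) \<and>
     (\<forall>vs. smooth_on (- {0}) (\<lambda>x. \<omega> x vs)) \<and>
     \<omega> 0 = (\<lambda>vs. 0)}"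

definition test_forms :: "nat \<Rightarrow> nat \<Rightarrow> ('n::finite) form set" where
  "test_forms p q = {\<omega> \<in> forms p q.
     \<exists>K. compact K \<and> 0 \<notin> K \<and> (\<forall>x. x \<notin> K \<longrightarrow> \<omega> x = (\<lambda>vs. 0))}"

text \<open>
  Smooth forms on \<open>\<P>\<^sup>N\<close>. A form \<open>\<omega>\<close> on \<open>\<P>\<^sup>N\<close> is represented by \<open>\<pi>\<^sup>*\<omega>\<close>, that is, \<open>\<omega> x vs\<close> is its
  value at the point \<open>proj x\<close> on the tangent vectors \<open>d\<pi>\<^sub>x(v)\<close>. As \<open>d\<pi>\<^sub>x\<close> is surjective with kernel
  \<open>\<complex>x\<close> and \<open>d\<pi>\<^bsub>cx\<^esub>(cv) = d\<pi>\<^sub>x(v)\<close>, the forms obtained in this way are exactly the following ones.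
  This identification commutes with \<open>\<partial>\<close>, its conjugate, and wedge products.
\<close>

definition proj_forms :: "nat \<Rightarrow> nat \<Rightarrow> ('n::finite) form set" where
  "proj_forms p q = {\<omega> \<in> forms p q.
     (\<forall>x vs c. c \<noteq> 0 \<longrightarrow> \<omega> (c *s x) (map ((*s) c) vs) = \<omega> x vs) \<and>
     (\<forall>x vs a. a *s x \<in> set vs \<longrightarrow> \<omega> x vs = 0)}"

text \<open>The complex linear and the conjugate linear part of the real differential of \<open>g\<close> at \<open>x\<close>.\<close>

definition deriv10 :: "(complex^'n::finite \<Rightarrow> complex) \<Rightarrow> complex^'n \<Rightarrow> complex^'n \<Rightarrow> complex" where
  "deriv10 g x v =
     (frechet_derivative g (at x) v - \<i> * frechet_derivative g (at x) (\<i> *s v)) / 2"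

definition deriv01 :: "(complex^'n::finite \<Rightarrow> complex) \<Rightarrow> complex^'n \<Rightarrow> complex^'n \<Rightarrow> complex" where
  "deriv01 g x v =
     (frechet_derivative g (at x) v + \<i> * frechet_derivative g (at x) (\<i> *s v)) / 2"

definition remove_nth :: "nat \<Rightarrow> 'a list \<Rightarrow> 'a list" where
  "remove_nth i xs = take i xs @ drop (Suc i) xs"

definition del :: "('n::finite) form \<Rightarrow> 'n form" where
  "del \<omega> x vs = (if x = 0 then 0 else
     \<Sum>i<length vs. (- 1) ^ i * deriv10 (\<lambda>y. \<omega> y (remove_nth i vs)) x (vs ! i))"

definition delbar :: "('n::finite) form \<Rightarrow> 'n form" where
  "delbar \<omega> x vs = (if x = 0 then 0 else
     \<Sum>i<length vs. (- 1) ^ i * deriv01 (\<lambda>y. \<omega> y (remove_nth i vs)) x (vs ! i))"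

definition ddc :: "('n::finite) form \<Rightarrow> 'n form" where
  "ddc \<omega> x vs = \<i> / (2 * of_real pi) * del (delbar \<omega>) x vs"


section \<open>Integration\<close>

text \<open>For complex vectors \<open>b\<^sub>1, \<dots>, b\<^sub>m\<close>, the positively oriented list \<open>b\<^sub>1, ib\<^sub>1, \<dots>, b\<^sub>m, ib\<^sub>m\<close>. A form
  of degree \<open>2m\<close> takes the same value on it for any order of the \<open>b\<^sub>j\<close>.\<close>

definition frame :: "(complex^'n) list \<Rightarrow> (complex^'n) list" where
  "frame bs = concat (map (\<lambda>b. [b, \<i> *s b]) bs)"

definition standard_basis :: "(complex^'n::finite) list" where
  "standard_basis = map (\<lambda>k. axis k 1) (SOME ks. distinct ks \<and> set ks = UNIV)"

definition integral_affine :: "('n::finite) form \<Rightarrow> complex" where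
  "integral_affine \<omega> = (LINT x|lborel. \<omega> x (frame standard_basis))"

text \<open>
  The integral of a form of top degree over the projective subspace \<open>\<P>(W)\<close>, where \<open>W\<close> is a linear
  subspace with basis \<open>b, b\<^sub>0, \<dots>, b\<^bsub>m-1\<^esub>\<close>, is computed in the affine chart
  \<open>(z\<^sub>0, \<dots>, z\<^bsub>m-1\<^esub>) \<mapsto> \<pi>(b + \<Sum> z\<^sub>i b\<^sub>i)\<close>, whose complement in \<open>\<P>(W)\<close> is a hyperplane and hence null. The
  integral does not depend on the basis.
\<close>

definition is_basis :: "(complex^'n) set \<Rightarrow> (complex^'n) list \<Rightarrow> bool" where
  "is_basis W bs \<longleftrightarrow> distinct bs \<and> vec.independent (set bs) \<and> vec.span (set bs) = W"

definition integral_proj :: "(complex^'n) set \<Rightarrow> ('n::finite) form \<Rightarrow> complex" where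
  "integral_proj W \<omega> =
     (let bs = (SOME bs. is_basis W bs); b = hd bs; cs = tl bs in
      LINT z|Pi\<^sub>M {..<length cs} (\<lambda>_. lborel).
        \<omega> (b + (\<Sum>i<length cs. z i *s (cs ! i))) (frame cs))"

text \<open>
  Integration of compactly supported forms over the fibres of \<open>\<pi>\<close>. The fibre through \<open>x\<close> is
  parametrised by \<open>c \<mapsto> cx\<close>, whose partial derivatives are \<open>x\<close> and \<open>ix\<close>, and \<open>cv\<close> is a lift of
  \<open>d\<pi>\<^sub>x(v)\<close> to \<open>cx\<close>.
\<close>

definition fibre_integral :: "('n::finite) form \<Rightarrow> 'n form" where
  "fibre_integral \<eta> x vs = (if x = 0 then 0 else
     LINT c|lborel. \<eta> (c *s x) (x # (\<i> *s x) # map ((*s) c) vs))"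


section \<open>Currents\<close>

fun iterated_deriv :: "'a::real_normed_vector list \<Rightarrow> ('a \<Rightarrow> complex) \<Rightarrow> 'a \<Rightarrow> complex" where
  "iterated_deriv [] g = g"
| "iterated_deriv (u # us) g = (\<lambda>x. frechet_derivative (iterated_deriv us g) (at x) u)"

text \<open>
  Currents of bidegree \<open>(1,1)\<close> on \<open>\<P>\<^sup>N\<close>: continuous linear forms on the space of smooth forms of
  bidegree \<open>(N-1,N-1)\<close>. The topology of this space is defined by the suprema of the derivatives
  of order at most \<open>r\<close> of the coefficients on the unit sphere.
\<close>

definition currents :: "(('n::finite) form \<Rightarrow> complex) set" where
  "currents = {T \<in> extensional (proj_forms (CARD('n) - 2) (CARD('n) - 2)).
     (\<forall>\<omega>\<in>proj_forms (CARD('n) - 2) (CARD('n) - 2). \<forall>\<eta>\<in>proj_forms (CARD('n) - 2) (CARD('n) - 2). \<forall>a.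
        T (\<lambda>x vs. a * \<omega> x vs + \<eta> x vs) = a * T \<omega> + T \<eta>) \<and>
     (\<exists>C r. \<forall>\<omega>\<in>proj_forms (CARD('n) - 2) (CARD('n) - 2). \<forall>M.
        (\<forall>us vs x. length us \<le> r \<longrightarrow> set us \<subseteq> Basis \<longrightarrow> set vs \<subseteq> Basis \<longrightarrow> norm x = 1 \<longrightarrow>
           norm (iterated_deriv us (\<lambda>y. \<omega> y vs) x) \<le> M) \<longrightarrow>
        norm (T \<omega>) \<le> C * M)}"

definition closed_current :: "(('n::finite) form \<Rightarrow> complex) \<Rightarrow> bool" where
  "closed_current T \<longleftrightarrow>
     (\<forall>p q. \<forall>\<beta>\<in>proj_forms p q.
        (p + 1 = CARD('n) - 2 \<and> q = CARD('n) - 2 \<longrightarrow> T (del \<beta>) = 0) \<and>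
        (p = CARD('n) - 2 \<and> q + 1 = CARD('n) - 2 \<longrightarrow> T (delbar \<beta>) = 0))"

text \<open>Positivity of a form of bidegree \<open>(p,p)\<close> is positivity of its restrictions to complex
  \<open>p\<close>-planes. In bidegree \<open>(N-1,N-1)\<close> this weak notion agrees with strong positivity.\<close>

definition positive_form :: "nat \<Rightarrow> ('n::finite) form \<Rightarrow> bool" where
  "positive_form p \<omega> \<longleftrightarrow> (\<forall>x bs. length bs = p \<longrightarrow> \<omega> x (frame bs) \<in> \<real>\<^sub>\<ge>\<^sub>0)"

definition positive_current :: "(('n::finite) form \<Rightarrow> complex) \<Rightarrow> bool" where
  "positive_current T \<longleftrightarrow>
     (\<forall>\<omega>\<in>proj_forms (CARD('n) - 2) (CARD('n) - 2).
        positive_form (CARD('n) - 2) \<omega> \<longrightarrow> T \<omega> \<in> \<real>\<^sub>\<ge>\<^sub>0)"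

text \<open>Currents of bidegree \<open>(1,1)\<close> on \<open>\<complex>\<^sup>N\<^sup>+\<^sup>1 - {0}\<close> act on test forms of bidegree \<open>(N,N)\<close>. The
  pullback by the submersion \<open>\<pi>\<close> is dual to integration over the fibres.\<close>

definition pullback_current ::
    "(('n::finite) form \<Rightarrow> complex) \<Rightarrow> 'n form \<Rightarrow> complex" where
  "pullback_current T =
     (\<lambda>\<eta>\<in>test_forms (CARD('n) - 1) (CARD('n) - 1). T (fibre_integral \<eta>))"

definition ddc_affine :: "(complex^'n \<Rightarrow> real) \<Rightarrow> ('n::finite) form \<Rightarrow> complex" where
  "ddc_affine G =
     (\<lambda>\<eta>\<in>test_forms (CARD('n) - 1) (CARD('n) - 1).
        integral_affine (\<lambda>x vs. of_real (G x) * ddc \<eta> x vs))"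

definition ddc_proj :: "('n::finite proj \<Rightarrow> real) \<Rightarrow> 'n form \<Rightarrow> complex" where
  "ddc_proj u =
     (\<lambda>\<omega>\<in>proj_forms (CARD('n) - 2) (CARD('n) - 2).
        integral_proj UNIV (\<lambda>x vs. of_real (u (proj x)) * ddc \<omega> x vs))"

text \<open>The divisor of a non-zero section of \<open>\<O>(1)\<close>, i.e. of a non-zero linear form \<open>s\<close>, is the
  hyperplane \<open>s = 0\<close> with multiplicity one.\<close>

definition delta_div :: "(complex^'n \<Rightarrow> complex) \<Rightarrow> ('n::finite) form \<Rightarrow> complex" where
  "delta_div s =
     (\<lambda>\<omega>\<in>proj_forms (CARD('n) - 2) (CARD('n) - 2). integral_proj {x. s x = 0} \<omega>)"

text \<open>\<open>c\<^sub>1(\<O>(1), h)\<close>, computed with the section \<open>s\<close>.\<close>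

definition chern_current ::
    "(complex^'n \<Rightarrow> complex) \<Rightarrow> 'n metric \<Rightarrow> ('n::finite) form \<Rightarrow> complex" where
  "chern_current s h =
     (\<lambda>\<omega>\<in>proj_forms (CARD('n) - 2) (CARD('n) - 2).
        ddc_proj (\<lambda>p. - ln ((h p (value_at s p))\<^sup>2)) \<omega> + delta_div s \<omega>)"


section \<open>Green currents\<close>

primrec iterate :: "(nat \<Rightarrow> 'n::finite pol_morphism) \<Rightarrow> nat \<Rightarrow> complex^'n \<Rightarrow> complex^'n" where
  "iterate fs 0 x = x"
| "iterate fs (Suc i) x = lift (fs i) (iterate fs i x)"

definition green_approx :: "(nat \<Rightarrow> 'n::finite pol_morphism) \<Rightarrow> nat \<Rightarrow> complex^'n \<Rightarrow> real" where
  "green_approx fs i x = ln ((norm (iterate fs i x))\<^sup>2) / (\<Prod>\<alpha><i. real (deg (fs \<alpha>)))"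

definition green_function :: "(nat \<Rightarrow> 'n::finite pol_morphism) \<Rightarrow> complex^'n \<Rightarrow> real" where
  "green_function fs x = lim (\<lambda>i. green_approx fs i x)"

definition is_green_current ::
    "(nat \<Rightarrow> 'n::finite pol_morphism) \<Rightarrow> ('n form \<Rightarrow> complex) \<Rightarrow> bool" where
  "is_green_current fs T \<longleftrightarrow>
     T \<in> currents \<and> positive_current T \<and> closed_current T \<and>
     pullback_current T = ddc_affine (green_function fs)"

end

theory Submission
  imports Defs "HOL-Real_Asymp.Real_Asymp"
begin

text \<open>
  Let \<open>e\<^sub>x\<close> be the element of the fibre of \<open>\<O>(1)\<close> over \<open>\<pi>(x)\<close> with \<open>e\<^sub>x(x) = 1\<close>. The functional equation of
  the admissible metrics and their distance from the Fubini--Study metric show that the Green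
  function is \<open>G(x) = - log h(e\<^sub>x)\<^sup>2\<close>, so that \<open>- log h(s)\<^sup>2\<close> lifts to \<open>G - log \<bar>s\<bar>\<^sup>2\<close>.

  By a partition of unity it suffices to evaluate \<open>T\<close> on a form \<open>\<omega>\<close> whose support does not meet a
  hyperplane \<open>l = 0\<close>. Such an \<open>\<omega>\<close> is the fibre integral of \<open>\<eta> = \<rho>(l) (i/2 dl \<and> d\<bar>l) \<and> \<omega>\<close> for a bump
  function \<open>\<rho>\<close> of integral one, and \<open>dd\<^sup>c \<omega>\<close> is the fibre integral of \<open>dd\<^sup>c \<eta>\<close>. Hence
  \<open>T(\<omega>) = \<integral> G dd\<^sup>c \<eta> = \<integral> (G - log \<bar>s\<bar>\<^sup>2) dd\<^sup>c \<eta> + \<integral> log \<bar>s\<bar>\<^sup>2 dd\<^sup>c \<eta>\<close>. Integrating over the fibres of \<open>\<pi>\<close> first,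
  the first integral becomes \<open>\<integral> - log h(s)\<^sup>2 dd\<^sup>c \<omega>\<close>; the Poincare--Lelong formula turns the second one
  into \<open>\<integral> \<eta>\<close> over the cone \<open>s = 0\<close>, that is, into \<open>\<integral> \<omega>\<close> over \<open>div(s)\<close>.
\<close>

section \<open>Alternating functions on lists of vectors\<close>

text \<open>\<open>T\<close> is known only through its pullback, so a form on the projective space
  can be tested only after it has been written as a fibre integral of a form with compact support.
  This explains the hyperplane \<open>l = 0\<close>: off it, \<open>l\<close> is a coordinate on
  every fibre, and a support at positive distance from it makes the cut-off by \<rho>(l) compact in
  the complement of the origin. The obstacle is the singularity of log |s|^2. It is replaced by log
  (|s|^2 + \<epsilon>), which can be integrated by parts twice; the kernel \<epsilon> / (|s|^2 +
  \<epsilon>)^2 that appears has mass \<pi> over a complex line for every \<epsilon>, and together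
  with the factor i / (2 \<pi>) of \<open>ddc\<close> this gives the hyperplane multiplicity exactly
  one. Integrals of forms are Lebesgue integrals of values on frames, and on the projective space
  the frame comes from a basis selected by choice. Hence values of alternating forms and Lebesgue
  measure must be compared for arbitrary bases. Both are followed through the same elementary
  operations, so the same constant appears on both sides and cancels.\<close>

lemma alternating_length: "alternating k \<alpha> \<Longrightarrow> length vs \<noteq> k \<Longrightarrow> \<alpha> vs = 0"
  unfolding alternating_def by blast

lemma alternating_not_distinct: "alternating k \<alpha> \<Longrightarrow> \<not> distinct vs \<Longrightarrow> \<alpha> vs = 0"
  unfolding alternating_def by blast

lemma alternating_lincomb:
  assumes "alternating k \<alpha>"
  shows "\<alpha> (us @ (r *\<^sub>R v + w) # ws) = of_real r * \<alpha> (us @ v # ws) + \<alpha> (us @ w # ws)"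
proof (cases "length us + length ws + 1 = k")
  case True
  then show ?thesis using assms unfolding alternating_def by blast
next
  case False
  then have "\<alpha> (us @ x # ws) = 0" for x
    using alternating_length[OF assms, of "us @ x # ws"] by simp
  then show ?thesis by simp
qed

lemma alternating_add:
  assumes "alternating k \<alpha>"
  shows "\<alpha> (us @ (v + w) # ws) = \<alpha> (us @ v # ws) + \<alpha> (us @ w # ws)"
  using alternating_lincomb[OF assms, of us 1 v w ws] by simp

lemma alternating_zero:
  assumes "alternating k \<alpha>"
  shows "\<alpha> (us @ 0 # ws) = 0"
  using alternating_add[OF assms, of us 0 0 ws] by simp

lemma alternating_scaleR:
  assumes "alternating k \<alpha>"
  shows "\<alpha> (us @ (r *\<^sub>R v) # ws) = of_real r * \<alpha> (us @ v # ws)"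
  using alternating_lincomb[OF assms, of us r v 0 ws] alternating_zero[OF assms] by simp

lemma alternating_swap:
  assumes "alternating k \<alpha>"
  shows "\<alpha> (us @ v # w # ws) = - \<alpha> (us @ w # v # ws)"
proof -
  have z: "\<alpha> (us @ x # x # ws) = 0" for x
    by (rule alternating_not_distinct[OF assms]) simp
  have "0 = \<alpha> (us @ (v + w) # (v + w) # ws)" using z by simp
  also have "\<dots> = \<alpha> (us @ v # (v + w) # ws) + \<alpha> (us @ w # (v + w) # ws)"
    by (rule alternating_add[OF assms])
  also have "\<alpha> (us @ v # (v + w) # ws) = \<alpha> (us @ v # v # ws) + \<alpha> (us @ v # w # ws)"
    using alternating_add[OF assms, of "us @ [v]"] by simp
  also have "\<alpha> (us @ w # (v + w) # ws) = \<alpha> (us @ w # v # ws) + \<alpha> (us @ w # w # ws)"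
    using alternating_add[OF assms, of "us @ [w]"] by simp
  finally show ?thesis using z by (simp add: add_eq_0_iff)
qed

lemma alternating_move:
  assumes "alternating k \<alpha>"
  shows "\<alpha> (us @ ps @ v # ws) = (- 1) ^ length ps * \<alpha> (us @ v # ps @ ws)"
proof (induction ps arbitrary: us)
  case (Cons p ps)
  show ?case
    using Cons[of "us @ [p]"] alternating_swap[OF assms, of us p v "ps @ ws"] by simp
qed simp

text \<open>An unnormalised antisymmetrisation over the first slot. If \<open>B v ws\<close> is the
  product of a covector at \<open>v\<close> and a form at \<open>ws\<close>, this is their wedge
  product; if \<open>B\<close> is the derivative of a form in direction \<open>v\<close>, it is the
  exterior derivative on constant vector fields.\<close>

definition alt_sum ::
    "(complex^'n \<Rightarrow> (complex^'n) list \<Rightarrow> complex) \<Rightarrow> (complex^'n) list \<Rightarrow> complex" where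
  "alt_sum B vs = (\<Sum>i<length vs. (- 1) ^ i * B (vs ! i) (remove_nth i vs))"

lemma length_remove_nth: "i < length vs \<Longrightarrow> length (remove_nth i vs) = length vs - 1"
  by (simp add: remove_nth_def)

lemma remove_nth_simps [simp]:
  "remove_nth 0 (v # vs) = vs" "remove_nth (Suc i) (v # vs) = v # remove_nth i vs"
  by (simp_all add: remove_nth_def)

lemma remove_nth_map: "remove_nth i (map f vs) = map f (remove_nth i vs)"
  by (simp add: remove_nth_def take_map drop_map)

lemma set_remove_nth: "set (remove_nth i vs) \<subseteq> set vs"
  unfolding remove_nth_def using set_take_subset set_drop_subset by fastforce

lemma alt_sum_Nil [simp]: "alt_sum B [] = 0"
  by (simp add: alt_sum_def)

lemma alt_sum_Cons: "alt_sum B (v # ws) = B v ws - alt_sum (\<lambda>w us. B w (v # us)) ws"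
  by (simp add: alt_sum_def sum.lessThan_Suc_shift sum_negf del: sum.lessThan_Suc)

lemma alt_sum_append:
  "alt_sum B (us @ ws) =
     (\<Sum>i<length us. (- 1) ^ i * B (us ! i) (remove_nth i us @ ws)) +
     (- 1) ^ length us * alt_sum (\<lambda>w vs. B w (us @ vs)) ws"
proof (induction us arbitrary: B)
  case (Cons u us)
  show ?case
    by (simp add: alt_sum_Cons Cons sum.lessThan_Suc_shift sum_negf algebra_simps
        del: sum.lessThan_Suc)
qed simp

lemma alt_sum_middle:
  "alt_sum B (us @ v # ws) =
     (\<Sum>i<length us. (- 1) ^ i * B (us ! i) (remove_nth i us @ v # ws)) +
     (- 1) ^ length us * (B v (us @ ws) - alt_sum (\<lambda>w vs. B w (us @ v # vs)) ws)"
  by (simp add: alt_sum_append alt_sum_Cons)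

lemma alt_sum_eq_0:
  assumes "\<And>i. i < length vs \<Longrightarrow> B (vs ! i) (remove_nth i vs) = 0"
  shows "alt_sum B vs = 0"
  using assms by (simp add: alt_sum_def)

lemma alt_sum_cong:
  assumes "\<And>i. i < length vs \<Longrightarrow> B (vs ! i) (remove_nth i vs) = B' (vs ! i) (remove_nth i vs)"
  shows "alt_sum B vs = alt_sum B' vs"
  using assms by (simp add: alt_sum_def)

lemma alt_sum_cmult: "alt_sum (\<lambda>v ws. c * B v ws) vs = c * alt_sum B vs"
  by (simp add: alt_sum_def sum_distrib_left algebra_simps)

lemma alt_sum_add: "alt_sum (\<lambda>v ws. B v ws + B' v ws) vs = alt_sum B vs + alt_sum B' vs"
  by (simp add: alt_sum_def sum.distrib algebra_simps)

text \<open>If \<open>v\<close> occurs twice, deleting any other entry leaves a repetition, and the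
  two terms that delete one copy of \<open>v\<close> cancel: moving the remaining copy from one
  place to the other produces the opposite sign.\<close>

lemma alternating_alt_sum:
  fixes B :: "complex^'n \<Rightarrow> (complex^'n) list \<Rightarrow> complex"
  assumes lin: "\<And>v w r ws. B (r *\<^sub>R v + w) ws = of_real r * B v ws + B w ws"
    and alt: "\<And>v. alternating k (B v)"
  shows "alternating (Suc k) (alt_sum B)"
  unfolding alternating_def
proof (intro conjI allI impI)
  fix vs :: "(complex^'n) list"
  assume len: "length vs \<noteq> Suc k"
  show "alt_sum B vs = 0"
    by (rule alt_sum_eq_0, rule alternating_length[OF alt]) (use len in \<open>auto simp: length_remove_nth\<close>)
next
  fix vs :: "(complex^'n) list"
  assume "\<not> distinct vs"
  then obtain us v ps ws where vs: "vs = us @ [v] @ ps @ [v] @ ws"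
    using not_distinct_decomp by blast
  have "(\<Sum>i<length us. (- 1) ^ i * B (us ! i) (remove_nth i us @ v # ps @ v # ws)) = 0"
    by (intro sum.neutral ballI) (simp add: alternating_not_distinct[OF alt])
  moreover have "alt_sum (\<lambda>w vs. B w (us @ v # vs)) (ps @ v # ws) =
      (- 1) ^ length ps * B v (us @ v # ps @ ws)"
  proof -
    have "(\<Sum>i<length ps. (- 1) ^ i * B (ps ! i) (us @ v # remove_nth i ps @ v # ws)) = 0"
      by (intro sum.neutral ballI) (simp add: alternating_not_distinct[OF alt])
    moreover have "alt_sum (\<lambda>w vs. B w (us @ v # ps @ v # vs)) ws = 0"
      by (rule alt_sum_eq_0) (simp add: alternating_not_distinct[OF alt])
    ultimately show ?thesis by (simp add: alt_sum_middle)
  qed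
  ultimately show "alt_sum B vs = 0"
    unfolding vs using alternating_move[OF alt, of v us ps v ws] by (simp add: alt_sum_middle)
next
  fix us ws :: "(complex^'n) list" and v w r
  have 1: "B u (xs @ (r *\<^sub>R v + w) # ys) = of_real r * B u (xs @ v # ys) + B u (xs @ w # ys)" for u xs ys
    by (rule alternating_lincomb[OF alt])
  show "alt_sum B (us @ (r *\<^sub>R v + w) # ws) =
      of_real r * alt_sum B (us @ v # ws) + alt_sum B (us @ w # ws)"
    unfolding alt_sum_middle lin 1 alt_sum_add alt_sum_cmult distrib_left sum.distrib sum_distrib_left
    by (simp add: ring_distribs mult.left_commute[of "of_real r"] sum_negf)
qed

lemma complex_smult_eq: "a *s (v :: complex^'n) = Re a *\<^sub>R v + Im a *\<^sub>R (\<i> *s v)"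
  by (vector complex_eq_iff)

text \<open>The entries are changed one at a time, each difference being a value with an argument in
  \<open>Z\<close>. With \<open>Z\<close> the complex line through a point, this moves tangent
  vectors along the fibre into the kernel of a linear form.\<close>

lemma alternating_shift:
  assumes alt: "alternating k D"
    and zero: "\<And>us. length us = length vs \<Longrightarrow> set us \<inter> Z \<noteq> {} \<Longrightarrow> D (pre @ us) = 0"
    and z: "\<And>v. v \<in> set vs \<Longrightarrow> z v \<in> Z"
  shows "D (pre @ map (\<lambda>v. v + z v) vs) = D (pre @ vs)"
  using zero z
proof (induction vs arbitrary: pre)
  case (Cons v vs)
  have "D (pre @ map (\<lambda>v. v + z v) (v # vs)) = D (pre @ v # map (\<lambda>v. v + z v) vs) +
      D (pre @ z v # map (\<lambda>v. v + z v) vs)"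
    using alternating_add[OF alt, of pre v "z v"] by simp
  also have "D (pre @ z v # map (\<lambda>v. v + z v) vs) = 0"
    by (rule Cons.prems(1)) (use Cons.prems(2)[of v] in auto)
  also have "D (pre @ v # map (\<lambda>v. v + z v) vs) = D ((pre @ [v]) @ vs)"
    using Cons.IH[of "pre @ [v]"] Cons.prems by simp
  finally show ?case by simp
qed simp

section \<open>Frames of complex vectors and their real determinants\<close>

lemma frame_simps [simp]:
  "frame [] = []" "frame (b # bs) = b # (\<i> *s b) # frame bs"
  "frame (bs @ cs) = frame bs @ frame cs" "length (frame bs) = 2 * length bs"
  by (induction bs) (auto simp: frame_def)

lemma mem_frame: "b \<in> set bs \<Longrightarrow> b \<in> set (frame bs) \<and> \<i> *s b \<in> set (frame bs)"
  by (auto simp: frame_def)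

lemma alternating_mem:
  assumes alt: "alternating k D" and c: "c \<in> set (us @ ws)" "\<i> *s c \<in> set (us @ ws)"
  shows "D (us @ (a *s c) # ws) = 0"
proof -
  have "D (us @ c # ws) = 0" "D (us @ (\<i> *s c) # ws) = 0"
    using c by (auto intro!: alternating_not_distinct[OF alt])
  then show ?thesis
    by (simp add: complex_smult_eq[of a] alternating_lincomb[OF alt] alternating_scaleR[OF alt])
qed

text \<open>Multiplication by \<open>a\<close> has real determinant \<open>(norm a)\<^sup>2\<close>
  on the plane of \<open>b\<close> and \<open>\<i> *s b\<close>; the two surviving terms of the
  expansion contribute the squares of \<open>Re a\<close> and \<open>Im a\<close>.\<close>

lemma alternating_frame_scale:
  assumes alt: "alternating k D"
  shows "D (us @ (a *s b) # (\<i> *s (a *s b)) # ws) = of_real ((norm a)\<^sup>2) * D (us @ b # (\<i> *s b) # ws)"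
proof -
  have e: "\<i> *s (a *s b) = (- Im a) *\<^sub>R b + Re a *\<^sub>R (\<i> *s b)"
    by (vector complex_eq_iff)
  have 0: "D (us @ c # c # ws) = 0" for c
    by (rule alternating_not_distinct[OF alt]) simp
  have r: "D (us @ v # (r *\<^sub>R x + s *\<^sub>R y) # ws) =
      of_real r * D (us @ v # x # ws) + of_real s * D (us @ v # y # ws)" for v x y r s
    using alternating_lincomb[OF alt, of "us @ [v]" r x "s *\<^sub>R y" ws]
      alternating_scaleR[OF alt, of "us @ [v]"] by simp
  have "D (us @ (a *s b) # (\<i> *s (a *s b)) # ws) =
     of_real (Re a) * D (us @ b # (\<i> *s (a *s b)) # ws) +
     of_real (Im a) * D (us @ (\<i> *s b) # (\<i> *s (a *s b)) # ws)"
    by (simp add: complex_smult_eq[of a b] alternating_lincomb[OF alt] alternating_scaleR[OF alt])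
  also have "\<dots> = of_real (Re a) * (of_real (Re a) * D (us @ b # (\<i> *s b) # ws)) +
     of_real (Im a) * (of_real (- Im a) * D (us @ (\<i> *s b) # b # ws))"
    unfolding e r by (simp add: 0)
  also have "D (us @ (\<i> *s b) # b # ws) = - D (us @ b # (\<i> *s b) # ws)"
    by (rule alternating_swap[OF alt])
  finally show ?thesis
    unfolding cmod_power2 by (simp add: power2_eq_square algebra_simps)
qed

lemma alternating_frame_scale_all:
  assumes alt: "alternating k D"
  shows "D (us @ map ((*s) a) (frame bs)) = of_real (norm a ^ (2 * length bs)) * D (us @ frame bs)"
proof (induction bs arbitrary: us)
  case (Cons b bs)
  have "\<i> *s (a *s b) = a *s (\<i> *s b)" by (simp add: vec_eq_iff)
  then show ?case
    using Cons[of "us @ [a *s b, a *s (\<i> *s b)]"] alternating_frame_scale[OF alt, of us a b "frame bs"]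
    by (simp add: power2_eq_square algebra_simps)
qed simp

text \<open>A complex multiple of \<open>c\<close> is a real combination of \<open>c\<close> and
  \<open>\<i> *s c\<close>, which already occur in the list, so the added terms vanish.\<close>

lemma alternating_frame_shear:
  assumes alt: "alternating k D" and c: "c \<in> set (us @ ws)" "\<i> *s c \<in> set (us @ ws)"
  shows "D (us @ (b + a *s c) # (\<i> *s (b + a *s c)) # ws) = D (us @ b # (\<i> *s b) # ws)"
proof -
  have e: "\<i> *s (b + a *s c) = \<i> *s b + (\<i> * a) *s c"
    by (simp add: vec_eq_iff algebra_simps)
  have 1: "D (us @ (a *s c) # z # ws) = 0" for z
    by (rule alternating_mem[OF alt]) (use c in auto)
  have 2: "D (us @ b # ((\<i> * a) *s c) # ws) = 0"
    using alternating_mem[OF alt, of c "us @ [b]" ws "\<i> * a"] c by auto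
  show ?thesis
    unfolding e using 1 2 alternating_add[OF alt, of us b "a *s c"]
      alternating_add[OF alt, of "us @ [b]" "\<i> *s b" "(\<i> * a) *s c" ws] by simp
qed

text \<open>Both \<open>b\<close> and \<open>\<i> *s b\<close> pass the even number of vectors of
  \<open>frame bs\<close>, so no sign appears.\<close>

lemma alternating_frame_rotate:
  assumes alt: "alternating k D"
  shows "D (us @ frame (bs @ [b])) = D (us @ frame (b # bs))"
proof -
  have "D (us @ frame bs @ b # [\<i> *s b]) = D (us @ b # frame bs @ [\<i> *s b])"
    using alternating_move[OF alt, of us "frame bs" b "[\<i> *s b]"] by simp
  also have "\<dots> = D (us @ b # (\<i> *s b) # frame bs)"
    using alternating_move[OF alt, of "us @ [b]" "frame bs" "\<i> *s b" "[]"] by simp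
  finally show ?thesis by simp
qed

section \<open>Smooth functions\<close>

lemma frechet_eq: "(f has_derivative f') (at x) \<Longrightarrow> frechet_derivative f (at x) = f'"
  using frechet_derivative_at by metis

text \<open>Openness of \<open>S\<close> matters because \<open>frechet_derivative\<close> at a
  point of \<open>S\<close> is taken in the whole space.\<close>

lemma Ck_on_cong:
  assumes "open S" "\<And>x. x \<in> S \<Longrightarrow> f x = g x" "Ck_on k S f"
  shows "Ck_on k S g"
  using assms(2,3)
proof (induction k arbitrary: f g)
  case 0
  then show ?case using continuous_on_cong[of S S f g] by simp
next
  case (Suc k)
  have der: "(g has_derivative frechet_derivative f (at x)) (at x)" if "x \<in> S" for x
  proof (rule has_derivative_transform_within_open[OF _ assms(1) that])
    show "(f has_derivative frechet_derivative f (at x)) (at x)"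
      using Suc.prems(2) that by (simp add: frechet_derivative_works)
  qed (use Suc.prems in auto)
  have "Ck_on k S (\<lambda>x. frechet_derivative g (at x) v)" for v
  proof (rule Suc.IH)
    show "Ck_on k S (\<lambda>x. frechet_derivative f (at x) v)" using Suc.prems by simp
  qed (use frechet_eq[OF der] in simp)
  then show ?case using der by (auto simp: differentiable_def)
qed

text \<open>Derivatives may be supplied by an explicit formula \<open>D\<close>, so that later
  proofs do not handle the chosen \<open>frechet_derivative\<close>.\<close>

lemma Ck_on_SucI:
  assumes "open S" "\<And>x. x \<in> S \<Longrightarrow> (f has_derivative D x) (at x)"
    and "\<And>v. Ck_on k S (\<lambda>x. D x v)"
  shows "Ck_on (Suc k) S f"
proof -
  have "Ck_on k S (\<lambda>x. frechet_derivative f (at x) v)" for v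
    by (rule Ck_on_cong[OF assms(1) _ assms(3)[of v]]) (use frechet_eq[OF assms(2)] in simp)
  then show ?thesis using assms(2) by (auto simp: differentiable_def)
qed

lemma Ck_on_SucE:
  assumes "Ck_on (Suc k) S f"
  obtains D where "\<And>x. x \<in> S \<Longrightarrow> (f has_derivative D x) (at x)"
    and "\<And>v. Ck_on k S (\<lambda>x. D x v)"
  by (rule that[of "\<lambda>x. frechet_derivative f (at x)"])
     (use assms in \<open>auto simp: frechet_derivative_works\<close>)

lemma Ck_on_lower: "Ck_on (Suc k) S f \<Longrightarrow> Ck_on k S f"
proof (induction k arbitrary: f)
  case 0
  then have "isCont f x" if "x \<in> S" for x
    using that differentiable_imp_continuous_within[of f x UNIV] by simp
  then show ?case by (simp add: continuous_at_imp_continuous_on)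
next
  case (Suc k)
  have "Ck_on k S (\<lambda>x. frechet_derivative f (at x) v)" for v
    by (rule Suc.IH) (use Suc.prems in simp)
  then show ?case using Suc.prems by simp
qed

lemma Ck_on_const: "open S \<Longrightarrow> Ck_on k S (\<lambda>x. c)"
proof (induction k arbitrary: c)
  case (Suc k)
  show ?case by (rule Ck_on_SucI[OF Suc.prems has_derivative_const]) (rule Suc.IH[OF Suc.prems])
qed simp

lemma Ck_on_add:
  "open S \<Longrightarrow> Ck_on k S f \<Longrightarrow> Ck_on k S g \<Longrightarrow> Ck_on k S (\<lambda>x. f x + g x)"
proof (induction k arbitrary: f g)
  case 0
  then show ?case by (auto intro: continuous_on_add)
next
  case (Suc k)
  obtain Df where f: "\<And>x. x \<in> S \<Longrightarrow> (f has_derivative Df x) (at x)" "\<And>v. Ck_on k S (\<lambda>x. Df x v)"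
    using Ck_on_SucE[OF Suc.prems(2)] by blast
  obtain Dg where g: "\<And>x. x \<in> S \<Longrightarrow> (g has_derivative Dg x) (at x)" "\<And>v. Ck_on k S (\<lambda>x. Dg x v)"
    using Ck_on_SucE[OF Suc.prems(3)] by blast
  show ?case
    by (rule Ck_on_SucI[OF Suc.prems(1) has_derivative_add[OF f(1) g(1)]])
       (simp_all add: Suc.IH Suc.prems(1) f g)
qed

lemma Ck_on_bilinear:
  assumes "bounded_bilinear p" "open S"
  shows "Ck_on k S f \<Longrightarrow> Ck_on k S g \<Longrightarrow> Ck_on k S (\<lambda>x. p (f x) (g x))"
proof (induction k arbitrary: f g)
  case 0
  then show ?case using bounded_bilinear.continuous_on[OF assms(1)] by simp
next
  case (Suc k)
  obtain Df where f: "\<And>x. x \<in> S \<Longrightarrow> (f has_derivative Df x) (at x)" "\<And>v. Ck_on k S (\<lambda>x. Df x v)"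
    using Ck_on_SucE[OF Suc.prems(1)] by blast
  obtain Dg where g: "\<And>x. x \<in> S \<Longrightarrow> (g has_derivative Dg x) (at x)" "\<And>v. Ck_on k S (\<lambda>x. Dg x v)"
    using Ck_on_SucE[OF Suc.prems(2)] by blast
  show ?case
    by (rule Ck_on_SucI[OF assms(2) bounded_bilinear.FDERIV[OF assms(1) f(1) g(1)]])
       (auto intro!: Ck_on_add assms(2) Suc.IH f g Ck_on_lower[OF Suc.prems(1)] Ck_on_lower[OF Suc.prems(2)])
qed

lemma Ck_on_linear:
  assumes "bounded_linear L" "open S"
  shows "Ck_on k S f \<Longrightarrow> Ck_on k S (\<lambda>x. L (f x))"
proof (induction k arbitrary: f)
  case 0
  then show ?case using bounded_linear.continuous_on[OF assms(1)] by simp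
next
  case (Suc k)
  obtain Df where f: "\<And>x. x \<in> S \<Longrightarrow> (f has_derivative Df x) (at x)" "\<And>v. Ck_on k S (\<lambda>x. Df x v)"
    using Ck_on_SucE[OF Suc.prems(1)] by blast
  show ?case
    by (rule Ck_on_SucI[OF assms(2) bounded_linear.has_derivative[OF assms(1) f(1)]])
       (auto intro!: assms(2) Suc.IH f)
qed

lemma Ck_on_id:
  assumes "open S"
  shows "Ck_on k S (\<lambda>x. x)"
proof (cases k)
  case (Suc m)
  then show ?thesis using Ck_on_SucI[OF assms has_derivative_ident Ck_on_const[OF assms]] by simp
qed simp

lemma Ck_on_compose_real:
  fixes \<phi> :: "real \<Rightarrow> real"
  assumes "open S"
  shows "Ck_on k UNIV \<phi> \<Longrightarrow> Ck_on k S q \<Longrightarrow> Ck_on k S (\<lambda>x. \<phi> (q x))"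
proof (induction k arbitrary: \<phi>)
  case 0
  then show ?case by (auto intro: continuous_on_compose2)
next
  case (Suc k)
  obtain Dq where q: "\<And>x. x \<in> S \<Longrightarrow> (q has_derivative Dq x) (at x)" "\<And>v. Ck_on k S (\<lambda>x. Dq x v)"
    using Ck_on_SucE[OF Suc.prems(2)] by blast
  obtain D where D: "\<And>x. (\<phi> has_derivative D x) (at x)" "\<And>v. Ck_on k UNIV (\<lambda>x. D x v)"
    using Ck_on_SucE[OF Suc.prems(1)] by (metis UNIV_I)
  \<comment> \<open>Linearity reduces the derivative of \<open>\<phi>\<close> to the function
    \<open>D x 1\<close> of one real variable, to which the induction hypothesis, stated for all
    \<open>\<phi>\<close>, applies.\<close>
  have lin: "D x v = v * D x 1" for x v
    using has_derivative_linear[OF D(1), THEN linear_cmul, of x v 1] by simp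
  have der: "((\<lambda>x. \<phi> (q x)) has_derivative (\<lambda>v. Dq x v * D (q x) 1)) (at x)" if "x \<in> S" for x
  proof -
    have "(\<lambda>v. D (q x) (Dq x v)) = (\<lambda>v. Dq x v * D (q x) 1)" by (rule ext) (rule lin)
    with has_derivative_compose[OF q(1)[OF that] D(1)] show ?thesis by simp
  qed
  show ?case
    by (rule Ck_on_SucI[OF assms(1) der])
       (auto intro!: Ck_on_bilinear[OF bounded_bilinear_mult assms] Suc.IH q D Ck_on_lower[OF Suc.prems(2)])
qed

lemma Ck_on_inverse:
  fixes f :: "'a::real_normed_vector \<Rightarrow> 'b::real_normed_field"
  assumes "open S" "\<And>x. x \<in> S \<Longrightarrow> f x \<noteq> 0"
  shows "Ck_on k S f \<Longrightarrow> Ck_on k S (\<lambda>x. inverse (f x))"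
proof (induction k)
  case 0
  then show ?case using assms(2) by (auto intro: continuous_on_inverse)
next
  case (Suc k)
  obtain Df where f: "\<And>x. x \<in> S \<Longrightarrow> (f has_derivative Df x) (at x)" "\<And>v. Ck_on k S (\<lambda>x. Df x v)"
    using Ck_on_SucE[OF Suc.prems(1)] by blast
  have I: "Ck_on k S (\<lambda>x. inverse (f x))" by (rule Suc.IH[OF Ck_on_lower[OF Suc.prems]])
  have m: "bounded_linear (\<lambda>x::'b. - x)" by (rule bounded_linear_minus[OF bounded_linear_ident])
  show ?case
    by (rule Ck_on_SucI[OF assms(1) Deriv.has_derivative_inverse[OF assms(2) f(1)]])
       (auto intro!: Ck_on_linear[OF m assms(1)] Ck_on_bilinear[OF bounded_bilinear_mult assms(1)] I f)
qed

lemma Ck_on_Un: "open S \<Longrightarrow> open T \<Longrightarrow> Ck_on k S f \<Longrightarrow> Ck_on k T f \<Longrightarrow> Ck_on k (S \<union> T) f"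
  by (induction k arbitrary: f) (auto intro: continuous_on_open_Un)

lemma smooth_on_cong: "open S \<Longrightarrow> (\<And>x. x \<in> S \<Longrightarrow> f x = g x) \<Longrightarrow> smooth_on S f \<Longrightarrow> smooth_on S g"
  unfolding smooth_on_def using Ck_on_cong by blast

lemma smooth_on_const: "open S \<Longrightarrow> smooth_on S (\<lambda>x. c)"
  unfolding smooth_on_def using Ck_on_const by blast

lemma smooth_on_add: "open S \<Longrightarrow> smooth_on S f \<Longrightarrow> smooth_on S g \<Longrightarrow> smooth_on S (\<lambda>x. f x + g x)"
  unfolding smooth_on_def using Ck_on_add by blast

lemma smooth_on_mult:
  fixes f g :: "'a::real_normed_vector \<Rightarrow> 'b::real_normed_algebra"
  shows "open S \<Longrightarrow> smooth_on S f \<Longrightarrow> smooth_on S g \<Longrightarrow> smooth_on S (\<lambda>x. f x * g x)"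
  unfolding smooth_on_def using Ck_on_bilinear[OF bounded_bilinear_mult] by blast

lemma smooth_on_linear: "open S \<Longrightarrow> bounded_linear L \<Longrightarrow> smooth_on S f \<Longrightarrow> smooth_on S (\<lambda>x. L (f x))"
  unfolding smooth_on_def using Ck_on_linear by blast

lemma smooth_on_bounded_linear: "open S \<Longrightarrow> bounded_linear L \<Longrightarrow> smooth_on S L"
  using smooth_on_linear[of S L "\<lambda>x. x"] Ck_on_id[of S] unfolding smooth_on_def by blast

lemma smooth_on_inverse:
  fixes f :: "'a::real_normed_vector \<Rightarrow> 'b::real_normed_field"
  shows "open S \<Longrightarrow> (\<And>x. x \<in> S \<Longrightarrow> f x \<noteq> 0) \<Longrightarrow> smooth_on S f \<Longrightarrow> smooth_on S (\<lambda>x. inverse (f x))"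
  unfolding smooth_on_def using Ck_on_inverse by blast

lemma smooth_on_compose_real:
  fixes \<phi> :: "real \<Rightarrow> real"
  shows "open S \<Longrightarrow> smooth_on UNIV \<phi> \<Longrightarrow> smooth_on S q \<Longrightarrow> smooth_on S (\<lambda>x. \<phi> (q x))"
  unfolding smooth_on_def using Ck_on_compose_real by blast

lemma smooth_on_diff:
  assumes "open S" "smooth_on S f" "smooth_on S g"
  shows "smooth_on S (\<lambda>x. f x - g x)"
proof -
  have "smooth_on S (\<lambda>x. - g x)"
    by (rule smooth_on_linear[OF assms(1) bounded_linear_minus[OF bounded_linear_ident] assms(3)])
  from smooth_on_add[OF assms(1,2) this] show ?thesis by simp
qed

lemma smooth_on_sum:
  "open S \<Longrightarrow> (\<And>i. i \<in> I \<Longrightarrow> smooth_on S (f i)) \<Longrightarrow> smooth_on S (\<lambda>x. \<Sum>i\<in>I. f i x)"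
  by (induction I rule: infinite_finite_induct) (auto intro: smooth_on_const smooth_on_add)

lemma smooth_on_Un: "open S \<Longrightarrow> open T \<Longrightarrow> smooth_on S f \<Longrightarrow> smooth_on T f \<Longrightarrow> smooth_on (S \<union> T) f"
  unfolding smooth_on_def using Ck_on_Un by blast

lemma smooth_on_differentiable: "smooth_on S f \<Longrightarrow> x \<in> S \<Longrightarrow> f differentiable (at x)"
  unfolding smooth_on_def by (metis Ck_on.simps(2))

lemma smooth_on_frechet_derivative: "smooth_on S f \<Longrightarrow> smooth_on S (\<lambda>x. frechet_derivative f (at x) v)"
  unfolding smooth_on_def by (metis Ck_on.simps(2))

lemma smooth_on_continuous_on: "smooth_on S f \<Longrightarrow> continuous_on S f"
  unfolding smooth_on_def by (metis Ck_on.simps(1))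

lemma smooth_on_extend_0:
  assumes "smooth_on (- {0}) f" "closed K" "0 \<notin> K" "\<And>x. x \<notin> K \<Longrightarrow> f x = 0"
  shows "smooth_on UNIV f"
proof -
  have "smooth_on (- K) f"
    by (rule smooth_on_cong[of _ "\<lambda>x. 0"]) (use assms in \<open>auto intro: smooth_on_const\<close>)
  from smooth_on_Un[OF _ _ assms(1) this] assms(2,3) have "smooth_on (- {0} \<union> - K) f"
    by (auto simp: open_Compl)
  moreover have "- {0} \<union> - K = UNIV" using assms(3) by auto
  ultimately show ?thesis by simp
qed

text \<open>The function \<open>exp (- (1 / t))\<close>, extended by zero to
  \<open>t \<le> 0\<close>, together with its quotients by powers of \<open>t\<close>. The powers
  make the family closed under differentiation, so that smoothness follows by an induction over all
  \<open>k\<close> at once.\<close>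

definition flat_exp :: "nat \<Rightarrow> real \<Rightarrow> real" where
  "flat_exp k t = (if t > 0 then exp (- (1 / t)) / t ^ k else 0)"

lemma flat_exp_tendsto: "(flat_exp k \<longlongrightarrow> 0) (at 0)"
proof -
  have r: "((\<lambda>t::real. exp (- (1 / t)) / t ^ k) \<longlongrightarrow> 0) (at_right 0)"
  proof -
    have "((\<lambda>x::real. x ^ k / exp x) \<longlongrightarrow> 0) at_top" by (rule tendsto_power_div_exp_0)
    moreover have "(\<lambda>t::real. exp (- (1 / t)) / t ^ k) = (\<lambda>t. (inverse t) ^ k / exp (inverse t))"
      by (auto simp: exp_minus field_simps)
    ultimately show ?thesis
      using filterlim_compose[OF _ filterlim_inverse_at_top_right] by simp
  qed
  have "(flat_exp k \<longlongrightarrow> 0) (at_right 0)"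
    by (rule Lim_transform_eventually[OF r])
       (auto simp: eventually_at_filter flat_exp_def)
  moreover have "(flat_exp k \<longlongrightarrow> 0) (at_left 0)"
    by (rule Lim_transform_eventually[OF tendsto_const])
       (auto simp: eventually_at_filter flat_exp_def)
  ultimately show ?thesis by (simp add: filterlim_split_at)
qed

lemma flat_exp_deriv:
  "(flat_exp k has_real_derivative (flat_exp (k + 2) t - real k * flat_exp (k + 1) t)) (at t)"
proof -
  consider "t > 0" | "t < 0" | "t = 0" by linarith
  then show ?thesis
  proof cases
    case 1
    have "((\<lambda>t. exp (- (1 / t)) / t ^ k) has_real_derivative
        (flat_exp (k + 2) t - real k * flat_exp (k + 1) t)) (at t)"
    proof -
      have pw: "t * t ^ (n - Suc 0) = t ^ n" if "n > 0" for n
        using that by (cases n) auto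
      then show ?thesis
        using 1 by (cases k) (auto intro!: derivative_eq_intros
            simp: flat_exp_def field_simps power2_eq_square, metis gr0I pw)
    qed
    then show ?thesis
      by (rule has_field_derivative_transform_within_open[of _ _ _ "{0<..}"])
         (use 1 in \<open>auto simp: flat_exp_def\<close>)
  next
    case 2
    have "((\<lambda>t. 0) has_real_derivative (flat_exp (k + 2) t - real k * flat_exp (k + 1) t)) (at t)"
      using 2 by (auto simp: flat_exp_def)
    then show ?thesis
      by (rule has_field_derivative_transform_within_open[of _ _ _ "{..<0}"])
         (use 2 in \<open>auto simp: flat_exp_def\<close>)
  next
    case 3
    \<comment> \<open>For positive \<open>h\<close> the difference quotient of
      \<open>flat_exp k\<close> at \<open>0\<close> is \<open>flat_exp (k + 1) h\<close>, and for
      negative \<open>h\<close> both are \<open>0\<close>.\<close>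
    have "((\<lambda>h. flat_exp (k + 1) h) \<longlongrightarrow> 0) (at 0)" by (rule flat_exp_tendsto)
    then have "((\<lambda>h. (flat_exp k (0 + h) - flat_exp k 0) / h) \<longlongrightarrow> 0) (at 0)"
      by (rule Lim_transform_eventually) (auto simp: eventually_at_filter flat_exp_def)
    then show ?thesis using 3 by (simp add: DERIV_def flat_exp_def)
  qed
qed

lemma smooth_on_flat_exp: "smooth_on UNIV (flat_exp k)"
proof -
  have "Ck_on n UNIV (flat_exp k)" for n
  proof (induction n arbitrary: k)
    case 0
    show ?case using flat_exp_deriv[THEN DERIV_isCont] by (auto intro!: continuous_at_imp_continuous_on)
  next
    case (Suc n)
    have "Ck_on n UNIV (\<lambda>x. v * (flat_exp (k + 2) x + (- real k) * flat_exp (k + 1) x))" for v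
      by (intro Ck_on_bilinear[OF bounded_bilinear_mult] Ck_on_add Ck_on_const Suc open_UNIV)
    then have "Ck_on n UNIV (\<lambda>x. (flat_exp (k + 2) x - real k * flat_exp (k + 1) x) * v)" for v
      by (simp add: mult.commute)
    with Ck_on_SucI[OF open_UNIV flat_exp_deriv[unfolded has_field_derivative_def]]
    show ?case by blast
  qed
  then show ?thesis by (simp add: smooth_on_def)
qed

lemma flat_exp_pos: "flat_exp k t > 0 \<longleftrightarrow> t > 0" "flat_exp k t \<ge> 0" "flat_exp k t = 0 \<longleftrightarrow> t \<le> 0"
  by (auto simp: flat_exp_def)

section \<open>Integration in complex coordinates\<close>

lemma box_complex: "box l u = {z. Re l < Re z \<and> Re z < Re u \<and> Im l < Im z \<and> Im z < Im u}"
  by (auto simp: box_def Basis_complex_def)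

lemma measurable_Complex [measurable]: "(\<lambda>(x, y). Complex x y) \<in> borel \<Otimes>\<^sub>M borel \<rightarrow>\<^sub>M borel"
proof -
  have "(\<lambda>p::real \<times> real. complex_of_real (fst p) + \<i> * complex_of_real (snd p)) \<in> borel_measurable (borel \<Otimes>\<^sub>M borel)"
    by measurable
  then show ?thesis by (simp add: Complex_eq case_prod_beta)
qed

lemma lborel_complex: "lborel = distr (lborel \<Otimes>\<^sub>M lborel) borel (\<lambda>(x, y). Complex x y)"
proof (rule lborel_eqI)
  fix l u :: complex
  assume le: "\<And>b. b \<in> Basis \<Longrightarrow> l \<bullet> b \<le> u \<bullet> b"
  have le': "Re l \<le> Re u" "Im l \<le> Im u" using le[of 1] le[of \<i>] by (simp_all add: Basis_complex_def)
  have "emeasure (distr (lborel \<Otimes>\<^sub>M lborel) borel (\<lambda>(x, y). Complex x y)) (box l u) =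
      emeasure (lborel \<Otimes>\<^sub>M lborel) ({Re l<..<Re u} \<times> {Im l<..<Im u})"
    by (subst emeasure_distr) (auto simp: box_complex space_pair_measure intro!: arg_cong2[where f=emeasure])
  also have "\<dots> = ennreal (Re u - Re l) * ennreal (Im u - Im l)"
    using le' by (simp add: lborel.emeasure_pair_measure_Times)
  finally show "emeasure (distr (lborel \<Otimes>\<^sub>M lborel) borel (\<lambda>(x, y). Complex x y)) (box l u) =
      ennreal (\<Prod>b\<in>Basis. (u - l) \<bullet> b)"
    using le' by (simp add: Basis_complex_def ennreal_mult)
qed simp

lemma nn_integral_complex:
  fixes f :: "complex \<Rightarrow> ennreal"
  assumes [measurable]: "f \<in> borel_measurable borel"
  shows "(\<integral>\<^sup>+z. f z \<partial>lborel) = (\<integral>\<^sup>+x. \<integral>\<^sup>+y. f (Complex x y) \<partial>lborel \<partial>lborel)"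
proof -
  have "(\<integral>\<^sup>+z. f z \<partial>lborel) = (\<integral>\<^sup>+p. f (case p of (x, y) \<Rightarrow> Complex x y) \<partial>(lborel \<Otimes>\<^sub>M lborel))"
    by (subst lborel_complex, subst nn_integral_distr) auto
  also have "\<dots> = (\<integral>\<^sup>+x. \<integral>\<^sup>+y. f (Complex x y) \<partial>lborel \<partial>lborel)"
    by (subst lborel.nn_integral_fst[symmetric]) auto
  finally show ?thesis .
qed

lemma nn_integral_translate:
  fixes f :: "'a::euclidean_space \<Rightarrow> ennreal"
  assumes [measurable]: "f \<in> borel_measurable borel"
  shows "(\<integral>\<^sup>+x. f (c + x) \<partial>lborel) = (\<integral>\<^sup>+x. f x \<partial>lborel)"
  by (subst (2) lborel_distr_plus[of c, symmetric], subst nn_integral_distr) auto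

text \<open>Multiplication by \<open>a\<close> is the real matrix with rows \<open>(p, - q)\<close>
  and \<open>(q, p)\<close>. It is factored into affine substitutions in one real variable, with
  Fubini exchanging the order of integration in between.\<close>

lemma nn_integral_complex_mult:
  fixes f :: "complex \<Rightarrow> ennreal"
  assumes f [measurable]: "f \<in> borel_measurable borel" and a: "a \<noteq> 0"
  shows "ennreal ((norm a)\<^sup>2) * (\<integral>\<^sup>+z. f (a * z) \<partial>lborel) = (\<integral>\<^sup>+z. f z \<partial>lborel)"
proof -
  define p q where "p = Re a" and "q = Im a"
  have ne: "p \<noteq> 0 \<or> q \<noteq> 0" using a by (auto simp: p_def q_def complex_eq_iff)
  have na: "(norm a)\<^sup>2 = p\<^sup>2 + q\<^sup>2" by (simp add: cmod_power2 p_def q_def)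
  have m: "a * Complex x y = Complex (p * x - q * y) (q * x + p * y)" for x y
    by (simp add: complex_eq_iff p_def q_def)
  have I: "(\<integral>\<^sup>+z. f (a * z) \<partial>lborel) =
      (\<integral>\<^sup>+x. \<integral>\<^sup>+y. f (Complex (p * x - q * y) (q * x + p * y)) \<partial>lborel \<partial>lborel)"
    by (subst nn_integral_complex) (simp_all add: m)
  have sq: "ennreal \<bar>c\<bar> * (ennreal \<bar>d\<bar> * K) = ennreal \<bar>c * d\<bar> * K" for c d K
    by (simp add: ennreal_mult' abs_mult mult.assoc)
  show ?thesis
  proof (cases "p = 0")
    case True
    then have q: "q \<noteq> 0" using ne by simp
    have "(\<integral>\<^sup>+z. f z \<partial>lborel) = (\<integral>\<^sup>+x. \<integral>\<^sup>+y. f (Complex x y) \<partial>lborel \<partial>lborel)"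
      by (rule nn_integral_complex[OF f])
    also have "\<dots> = \<bar>- q\<bar> * (\<integral>\<^sup>+x. \<integral>\<^sup>+y. f (Complex (0 + (- q) * x) y) \<partial>lborel \<partial>lborel)"
      by (rule nn_integral_real_affine) (use q in auto)
    also have "(\<integral>\<^sup>+x. \<integral>\<^sup>+y. f (Complex (0 + (- q) * x) y) \<partial>lborel \<partial>lborel) =
        (\<integral>\<^sup>+x. \<bar>q\<bar> * (\<integral>\<^sup>+y. f (Complex (0 + (- q) * x) (0 + q * y)) \<partial>lborel) \<partial>lborel)"
      by (intro nn_integral_cong nn_integral_real_affine) (use q in auto)
    also have "\<dots> = \<bar>q\<bar> * (\<integral>\<^sup>+x. \<integral>\<^sup>+y. f (Complex (0 + (- q) * x) (0 + q * y)) \<partial>lborel \<partial>lborel)"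
      by (rule nn_integral_cmult) simp
    also have "(\<integral>\<^sup>+x. \<integral>\<^sup>+y. f (Complex (0 + (- q) * x) (0 + q * y)) \<partial>lborel \<partial>lborel) =
        (\<integral>\<^sup>+y. \<integral>\<^sup>+x. f (Complex (0 + (- q) * x) (0 + q * y)) \<partial>lborel \<partial>lborel)"
      by (rule lborel_pair.Fubini') simp
    also have "\<dots> = (\<integral>\<^sup>+z. f (a * z) \<partial>lborel)" by (simp add: I True)
    finally show ?thesis unfolding na sq using True q by (simp add: power2_eq_square abs_mult)
  next
    case False
    \<comment> \<open>The pivot \<open>p + q^2 / p\<close> that remains after eliminating the lower
      left entry with \<open>p\<close>; hence \<open>r * p\<close> is the determinant.\<close>
    define r where "r = (p\<^sup>2 + q\<^sup>2) / p"
    have r: "r \<noteq> 0" using False ne by (auto simp: r_def sum_power2_eq_zero_iff)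
    have "(\<integral>\<^sup>+z. f z \<partial>lborel) = (\<integral>\<^sup>+x. \<integral>\<^sup>+y. f (Complex x y) \<partial>lborel \<partial>lborel)"
      by (rule nn_integral_complex[OF f])
    also have "\<dots> = (\<integral>\<^sup>+x. \<bar>r\<bar> * (\<integral>\<^sup>+y. f (Complex x ((q / p) * x + r * y)) \<partial>lborel) \<partial>lborel)"
      by (intro nn_integral_cong nn_integral_real_affine) (use r in auto)
    also have "\<dots> = \<bar>r\<bar> * (\<integral>\<^sup>+x. \<integral>\<^sup>+y. f (Complex x ((q / p) * x + r * y)) \<partial>lborel \<partial>lborel)"
      by (rule nn_integral_cmult) simp
    also have "(\<integral>\<^sup>+x. \<integral>\<^sup>+y. f (Complex x ((q / p) * x + r * y)) \<partial>lborel \<partial>lborel) =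
        (\<integral>\<^sup>+y. \<integral>\<^sup>+x. f (Complex x ((q / p) * x + r * y)) \<partial>lborel \<partial>lborel)"
      by (rule lborel_pair.Fubini') simp
    also have "\<dots> = (\<integral>\<^sup>+y. \<bar>p\<bar> * (\<integral>\<^sup>+x. f (Complex (- q * y + p * x) ((q / p) * (- q * y + p * x) + r * y)) \<partial>lborel) \<partial>lborel)"
      by (intro nn_integral_cong nn_integral_real_affine) (use False in auto)
    also have "\<dots> = \<bar>p\<bar> * (\<integral>\<^sup>+y. \<integral>\<^sup>+x. f (Complex (- q * y + p * x) ((q / p) * (- q * y + p * x) + r * y)) \<partial>lborel \<partial>lborel)"
      by (rule nn_integral_cmult) simp
    also have "(\<integral>\<^sup>+y. \<integral>\<^sup>+x. f (Complex (- q * y + p * x) ((q / p) * (- q * y + p * x) + r * y)) \<partial>lborel \<partial>lborel) =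
        (\<integral>\<^sup>+x. \<integral>\<^sup>+y. f (Complex (- q * y + p * x) ((q / p) * (- q * y + p * x) + r * y)) \<partial>lborel \<partial>lborel)"
      by (rule lborel_pair.Fubini') simp
    also have "\<dots> = (\<integral>\<^sup>+z. f (a * z) \<partial>lborel)"
    proof -
      have "Complex (- q * y + p * x) ((q / p) * (- q * y + p * x) + r * y) =
          Complex (p * x - q * y) (q * x + p * y)" for x y
        using False by (simp add: r_def field_simps power2_eq_square)
      then show ?thesis by (simp add: I)
    qed
    finally have "(\<integral>\<^sup>+z. f z \<partial>lborel) = ennreal \<bar>r * p\<bar> * (\<integral>\<^sup>+z. f (a * z) \<partial>lborel)"
      unfolding sq .
    moreover have "\<bar>r * p\<bar> = p\<^sup>2 + q\<^sup>2" using False by (simp add: r_def)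
    ultimately show ?thesis by (simp add: na)
  qed
qed

text \<open>The disc \<open>(norm z)\<^sup>2 < r\<close> has area \<open>pi * r\<close>, so the
  image measure has constant density on the positive half-line. Comparison on half-lines suffices
  and takes the place of polar coordinates.\<close>

lemma distr_norm_square:
  "distr lborel borel (\<lambda>z::complex. (norm z)\<^sup>2) = density lborel (\<lambda>r. ennreal pi * indicator {0<..} r)"
  (is "?M = ?N")
proof -
  have ball: "emeasure lborel {z::complex. (norm z)\<^sup>2 < r} = ennreal (pi * max 0 r)" for r
  proof (cases "r > 0")
    case True
    then have "{z::complex. (norm z)\<^sup>2 < r} = ball 0 (sqrt r)"
      by (auto simp: real_less_rsqrt) (metis norm_ge_zero real_sqrt_less_iff real_sqrt_abs abs_of_nonneg real_sqrt_unique less_eq_real_def real_less_lsqrt sqrt_le_D not_le real_sqrt_pow2 power_mono)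
    then show ?thesis using True
      by (simp add: emeasure_ball unit_ball_vol_2 del: of_nat_Suc)
  next
    case False
    then have e: "{z::complex. (norm z)\<^sup>2 < r} = {}"
      using zero_le_power2[of "norm _"] by (auto simp del: zero_le_power2) (smt (verit) zero_le_power2)
    show ?thesis using False unfolding e by simp
  qed
  have N: "emeasure ?N {..<r} = ennreal (pi * max 0 r)" for r
  proof -
    have "emeasure ?N {..<r} = (\<integral>\<^sup>+x. ennreal pi * indicator {0<..<r} x \<partial>lborel)"
      by (subst emeasure_density) (auto intro!: nn_integral_cong split: split_indicator)
    also have "\<dots> = ennreal pi * emeasure lborel {0<..<r}"
      by (subst nn_integral_cmult_indicator) auto
    finally show ?thesis
      by (cases "r \<ge> 0") (auto simp: ennreal_mult max_def)
  qed
  show ?thesis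
  proof (rule measure_eqI_generator_eq_countable)
    let ?LT = "\<lambda>a::real. {..<a}" let ?E = "range ?LT"
    have "{..<a} \<inter> {..<b} = {..<min a b}" for a b :: real by auto
    then show "Int_stable ?E" by (auto simp: Int_stable_def)
    show "?E \<subseteq> Pow UNIV" "sets ?M = sigma_sets UNIV ?E" "sets ?N = sigma_sets UNIV ?E"
      by (auto simp: borel_Iio)
    have "\<exists>r\<in>\<rat>. x < r" for x :: real
      using Rats_dense_in_real[of x "x + 1"] by auto
    then show "?LT ` Rats \<subseteq> ?E" "\<Union>(?LT ` Rats) = UNIV" by auto
    show "countable (?LT ` Rats)" by (simp add: countable_rat)
    fix X assume X: "X \<in> ?E"
    then obtain r where r: "X = {..<r}" by auto
    have M: "emeasure ?M {..<r} = ennreal (pi * max 0 r)"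
      using ball[of r] by (simp add: emeasure_distr vimage_def)
    show "emeasure ?M X = emeasure ?N X" unfolding r M N ..
  next
    fix X assume "X \<in> (\<lambda>a::real. {..<a}) ` Rats"
    then obtain r where r: "X = {..<r}" by auto
    show "emeasure ?M X \<noteq> \<infinity>"
      using ball[of r] by (simp add: emeasure_distr vimage_def r)
  qed
qed

lemma nn_integral_norm_square:
  fixes g :: "real \<Rightarrow> ennreal"
  assumes [measurable]: "g \<in> borel_measurable borel"
  shows "(\<integral>\<^sup>+z. g ((norm (z::complex))\<^sup>2) \<partial>lborel) = ennreal pi * (\<integral>\<^sup>+r. g r * indicator {0<..} r \<partial>lborel)"
proof -
  have "(\<integral>\<^sup>+z. g ((norm (z::complex))\<^sup>2) \<partial>lborel) = (\<integral>\<^sup>+r. g r \<partial>(distr lborel borel (\<lambda>z::complex. (norm z)\<^sup>2)))"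
    by (subst nn_integral_distr) auto
  also have "\<dots> = (\<integral>\<^sup>+r. ennreal pi * (g r * indicator {0<..} r) \<partial>lborel)"
    unfolding distr_norm_square by (subst nn_integral_density) (auto intro!: nn_integral_cong simp: ac_simps)
  also have "\<dots> = ennreal pi * (\<integral>\<^sup>+r. g r * indicator {0<..} r \<partial>lborel)"
    by (rule nn_integral_cmult) auto
  finally show ?thesis .
qed

text \<open>The mass of the kernel in the regularised Poincare--Lelong formula at parameter one; it
  is the \<pi> that cancels the one in \<open>ddc\<close>.\<close>

lemma nn_integral_fubini_study_density:
  "(\<integral>\<^sup>+z. ennreal (1 / (1 + (norm (z::complex))\<^sup>2)\<^sup>2) \<partial>lborel) = ennreal pi"
proof -
  have "(\<integral>\<^sup>+r. ennreal (1 / (1 + r)\<^sup>2) * indicator {0..} r \<partial>lborel) = ennreal (0 - (- 1 / (1 + 0)))"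
  proof (rule nn_integral_FTC_atLeast)
    show "((\<lambda>r::real. - 1 / (1 + r)) \<longlongrightarrow> 0) at_top" by real_asymp
  qed (auto intro!: derivative_eq_intros simp: power2_eq_square)
  moreover have "(\<integral>\<^sup>+r. ennreal (1 / (1 + r)\<^sup>2) * indicator {0<..} r \<partial>lborel) =
      (\<integral>\<^sup>+r. ennreal (1 / (1 + r)\<^sup>2) * indicator {0..} r \<partial>lborel)"
    by (rule nn_integral_cong_AE, rule AE_mp[OF AE_lborel_singleton[of 0]]) (auto split: split_indicator)
  ultimately show ?thesis
    using nn_integral_norm_square[of "\<lambda>r. ennreal (1 / (1 + r)\<^sup>2)"] by simp
qed

lemma nn_integral_ln_norm_square:
  "(\<integral>\<^sup>+z. ennreal \<bar>ln ((norm (z::complex))\<^sup>2)\<bar> * indicator {z. (norm z)\<^sup>2 \<le> R} z \<partial>lborel) < \<infinity>"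
proof -
  define R' where "R' = max R 1"
  have R': "R' \<ge> 1" by (simp add: R'_def)
  have "(\<integral>\<^sup>+z. ennreal \<bar>ln ((norm (z::complex))\<^sup>2)\<bar> * indicator {z. (norm z)\<^sup>2 \<le> R} z \<partial>lborel) \<le>
      (\<integral>\<^sup>+z. (ennreal (2 / sqrt ((norm (z::complex))\<^sup>2)) * indicator {..R'} ((norm z)\<^sup>2) + ennreal R' * indicator {..R'} ((norm z)\<^sup>2)) \<partial>lborel)"
  proof (rule nn_integral_mono)
    fix z :: complex
    let ?r = "(norm z)\<^sup>2"
    \<comment> \<open>Near \<open>r = 0\<close> the inequality \<open>ln t \<le> t - 1\<close> at
      \<open>t = 1 / sqrt r\<close> bounds the logarithm by a power of \<open>r\<close> that is
      integrable there.\<close>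
    have b: "\<bar>ln r\<bar> \<le> 2 / sqrt r + R'" if "0 \<le> r" "r \<le> R'" for r
    proof (cases "r = 0")
      case False
      have "ln (1 / sqrt r) \<le> 1 / sqrt r - 1" using that False by (intro ln_le_minus_one) auto
      moreover have "ln r \<le> r - 1" using that False by (intro ln_le_minus_one) auto
      moreover have "ln (1 / sqrt r) = - ln r / 2" using that False by (simp add: ln_div ln_sqrt)
      moreover have "0 \<le> 2 / sqrt r" using that by simp
      moreover have "2 / sqrt r = 2 * (1 / sqrt r)" by simp
      ultimately show ?thesis using that R' by linarith
    qed (use R' in auto)
    show "ennreal \<bar>ln ?r\<bar> * indicator {z. (norm z)\<^sup>2 \<le> R} z \<le>
        ennreal (2 / sqrt ?r) * indicator {..R'} ?r + ennreal R' * indicator {..R'} ?r"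
    proof (cases "?r \<le> R")
      case True
      then have r: "?r \<le> R'" by (simp add: R'_def)
      have "ennreal \<bar>ln ?r\<bar> \<le> ennreal (2 / sqrt ?r + R')"
        using b[OF _ r] by (intro ennreal_leI) simp
      also have "\<dots> = ennreal (2 / sqrt ?r) + ennreal R'"
        using R' by (intro ennreal_plus) auto
      finally have "ennreal \<bar>ln ?r\<bar> \<le> ennreal (2 / sqrt ?r) + ennreal R'" .
      then show ?thesis using r True by simp
    qed simp
  qed
  also have "\<dots> = (\<integral>\<^sup>+z. ennreal (2 / sqrt ((norm (z::complex))\<^sup>2)) * indicator {..R'} ((norm z)\<^sup>2) \<partial>lborel)
      + (\<integral>\<^sup>+z. ennreal R' * indicator {..R'} ((norm (z::complex))\<^sup>2) \<partial>lborel)"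
    by (rule nn_integral_add) auto
  also have "(\<integral>\<^sup>+z. ennreal R' * indicator {..R'} ((norm (z::complex))\<^sup>2) \<partial>lborel) =
      ennreal pi * (\<integral>\<^sup>+r. ennreal R' * indicator {..R'} r * indicator {0<..} r \<partial>lborel)"
    by (rule nn_integral_norm_square) auto
  also have "(\<integral>\<^sup>+r. ennreal R' * indicator {..R'} r * indicator {0<..} r \<partial>lborel) =
      (\<integral>\<^sup>+r. ennreal R' * indicator {0<..R'} r \<partial>lborel)"
    by (intro nn_integral_cong) (auto split: split_indicator)
  also have "\<dots> = ennreal R' * emeasure lborel {0<..R'}" by (rule nn_integral_cmult_indicator) auto
  also have "(\<integral>\<^sup>+z. ennreal (2 / sqrt ((norm (z::complex))\<^sup>2)) * indicator {..R'} ((norm z)\<^sup>2) \<partial>lborel) =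
      ennreal pi * (\<integral>\<^sup>+r. ennreal (2 / sqrt r) * indicator {..R'} r * indicator {0<..} r \<partial>lborel)"
    by (rule nn_integral_norm_square) auto
  also have "(\<integral>\<^sup>+r. ennreal (2 / sqrt r) * indicator {..R'} r * indicator {0<..} r \<partial>lborel) = ennreal (2 * (R' powr (1/2) / (1/2)))"
  proof -
    have h: "((\<lambda>r. 2 * r powr (- (1/2))) has_integral 2 * (R' powr (- (1/2) + 1) / (- (1/2) + 1))) {0..R'}"
      by (intro has_integral_mult_right has_integral_powr_from_0) (use R' in auto)
    then have h': "((\<lambda>r. if r \<in> {0..R'} then 2 * r powr (- (1/2)) else 0) has_integral 2 * (R' powr (1/2) / (1/2))) UNIV"
      by (simp only: has_integral_restrict_UNIV) simp
    have "(\<integral>\<^sup>+r. ennreal (if r \<in> {0..R'} then 2 * r powr (- (1/2)) else 0) \<partial>lborel) = ennreal (2 * (R' powr (1/2) / (1/2)))"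
      by (rule nn_integral_has_integral_lborel[OF _ _ h']) auto
    moreover have "(\<integral>\<^sup>+r. ennreal (2 / sqrt r) * indicator {..R'} r * indicator {0<..} r \<partial>lborel) =
        (\<integral>\<^sup>+r. ennreal (if r \<in> {0..R'} then 2 * r powr (- (1/2)) else 0) \<partial>lborel)"
      by (rule nn_integral_cong) (auto split: split_indicator simp: powr_minus powr_half_sqrt field_simps)
    ultimately show ?thesis by simp
  qed
  also have "ennreal pi * ennreal (2 * (R' powr (1/2) / (1/2))) + ennreal pi * (ennreal R' * emeasure lborel {0<..R'}) < \<infinity>"
    using R' by (simp add: ennreal_mult_less_top)
  finally show ?thesis .
qed

section \<open>Complex linear substitutions in Lebesgue integrals\<close>

definition lin_comb :: "(complex^'n) list \<Rightarrow> (nat \<Rightarrow> complex) \<Rightarrow> complex^'n" where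
  "lin_comb bs z = (\<Sum>i<length bs. z i *s (bs ! i))"

abbreviation cvol :: "nat \<Rightarrow> (nat \<Rightarrow> complex) measure" where
  "cvol n \<equiv> Pi\<^sub>M {..<n} (\<lambda>_. lborel)"

interpretation cvol: product_sigma_finite "\<lambda>_::nat. lborel :: complex measure"
  by standard

lemma continuous_on_smult [continuous_intros]:
  assumes "continuous_on S f" "continuous_on S g"
  shows "continuous_on S (\<lambda>x. f x *s (g x :: complex^'n))"
  unfolding vector_scalar_mult_def by (intro continuous_intros assms)

lemma measurable_smult [measurable (raw)]:
  assumes [measurable]: "f \<in> borel_measurable M" "g \<in> borel_measurable M"
  shows "(\<lambda>x. f x *s (g x :: complex^'n)) \<in> borel_measurable M"
proof -
  have "(\<lambda>p. fst p *s (snd p :: complex^'n)) \<in> borel_measurable borel"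
    by (intro borel_measurable_continuous_onI continuous_intros)
  then have "(\<lambda>p. fst p *s (snd p :: complex^'n)) \<in> borel_measurable (borel \<Otimes>\<^sub>M borel)"
    by (simp add: borel_prod)
  from measurable_compose[OF measurable_Pair[OF assms] this] show ?thesis by simp
qed

lemma measurable_lin_comb [measurable]:
  "length bs = n \<Longrightarrow> lin_comb bs \<in> borel_measurable (cvol n)"
  unfolding lin_comb_def[abs_def] by measurable

lemma lin_comb_remove:
  "m < length A \<Longrightarrow> lin_comb A w = w m *s A ! m + (\<Sum>i\<in>{..<length A} - {m}. w i *s A ! i)"
  unfolding lin_comb_def by (subst sum.remove[of _ m]) auto

lemma lin_comb_update:
  assumes "m < length A"
  shows "lin_comb (A[m := b]) w = w m *s b + (\<Sum>i\<in>{..<length A} - {m}. w i *s A ! i)"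
proof -
  have "(\<Sum>i\<in>{..<length A} - {m}. w i *s A[m := b] ! i) = (\<Sum>i\<in>{..<length A} - {m}. w i *s A ! i)"
    by (intro sum.cong) auto
  then show ?thesis using lin_comb_remove[of m "A[m := b]" w] assms by simp
qed

lemma lin_comb_linear:
  "lin_comb A (\<lambda>i. c * z i + w i) = c *s lin_comb A z + lin_comb A w"
  unfolding lin_comb_def
  by (simp add: sum.distrib vec.scale_sum_right algebra_simps vec.scale_left_distrib)

lemma lin_comb_snoc: "lin_comb (cs @ [b]) z = lin_comb cs z + z (length cs) *s b"
  unfolding lin_comb_def by (simp add: nth_append)

text \<open>Gaussian elimination as an induction rule: the entries of a spanning list
  \<open>A\<close> are replaced one by one by those of the independent list \<open>B\<close>.
  Transpositions are avoided, since a vanishing pivot is repaired by a shear.\<close>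

lemma elementary_list_induct:
  fixes A B :: "(complex^'n) list"
  assumes len: "length A = n" "length B = n"
    and span: "\<And>v. \<exists>z. v = lin_comb A z"
    and indep: "\<And>z. lin_comb B z = 0 \<Longrightarrow> \<forall>i<n. z i = 0"
    and base: "P A"
    and scale: "\<And>A i a. P A \<Longrightarrow> length A = n \<Longrightarrow> i < n \<Longrightarrow> a \<noteq> 0 \<Longrightarrow> P (A[i := a *s A ! i])"
    and shear: "\<And>A i j a. P A \<Longrightarrow> length A = n \<Longrightarrow> i < n \<Longrightarrow> j < n \<Longrightarrow> i \<noteq> j \<Longrightarrow>
      P (A[i := A ! i + a *s A ! j])"
  shows "P B"
proof -
  \<comment> \<open>Spanning has to travel along with \<open>P\<close>, since the next entry of
    \<open>B\<close> must be expressed in the current list.\<close>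
  define Q where "Q A \<longleftrightarrow> length A = n \<and> P A \<and> (\<forall>v. \<exists>z. v = lin_comb A z)" for A
  have replace: "Q (A[m := lin_comb A z])" if Q: "Q A" and m: "m < n" and z: "z m \<noteq> 0" for A m z
  proof -
    have len: "length A = n" using Q by (simp add: Q_def)
    have "P (A[m := z m *s A ! m + (\<Sum>j\<in>J. z j *s A ! j)])"
      if "J \<subseteq> {..<n} - {m}" "finite J" for J
      using that(2,1)
    proof (induction J)
      case empty
      show ?case using scale[of A m "z m"] Q m z by (simp add: Q_def)
    next
      case (insert j J)
      let ?A = "A[m := z m *s A ! m + (\<Sum>j\<in>J. z j *s A ! j)]"
      have "P (?A[m := ?A ! m + z j *s ?A ! j])"
        by (rule shear) (use insert m len in auto)
      then show ?case using insert m len by (simp add: add.assoc add.commute add.left_commute)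
    qed
    from this[of "{..<n} - {m}"] have P: "P (A[m := lin_comb A z])"
      using lin_comb_remove[of m A z] m len by simp
    have "\<exists>w. v = lin_comb (A[m := lin_comb A z]) w" for v
    proof -
      obtain y where y: "v = lin_comb A y" using Q by (auto simp: Q_def)
      \<comment> \<open>The coefficients of \<open>v\<close> after solving
        \<open>lin_comb A z\<close> for \<open>A ! m\<close>, which is possible because
        \<open>z m \<noteq> 0\<close>.\<close>
      define w where "w i = (if i = m then y m / z m else y i - (y m / z m) * z i)" for i
      have "lin_comb (A[m := lin_comb A z]) w =
          (y m / z m) *s lin_comb A z + (\<Sum>i\<in>{..<n} - {m}. w i *s A ! i)"
        using m len by (simp add: lin_comb_update w_def)
      also have "(\<Sum>i\<in>{..<n} - {m}. w i *s A ! i) = lin_comb A (\<lambda>i. (- (y m / z m)) * z i + y i)"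
        using m len z by (subst lin_comb_remove[of m]) (auto simp: w_def intro!: sum.cong)
      also have "(y m / z m) *s lin_comb A z + \<dots> = v"
        unfolding lin_comb_linear y by (simp add: vec_eq_iff)
      finally show ?thesis by metis
    qed
    then show ?thesis using P len by (simp add: Q_def)
  qed
  have "\<exists>A. Q A \<and> (\<forall>i<m. A ! i = B ! i)" if "m \<le> n" for m
    using that
  proof (induction m)
    case 0
    then show ?case using assms by (auto simp: Q_def)
  next
    case (Suc m)
    then obtain A where A: "Q A" "\<forall>i<m. A ! i = B ! i" and m: "m < n" by auto
    have lA: "length A = n" using A by (simp add: Q_def)
    obtain z where z: "B ! m = lin_comb A z" using A by (auto simp: Q_def)
    \<comment> \<open>Otherwise \<open>B ! m\<close> would be a combination of the first
      \<open>m\<close> entries of \<open>A\<close>, which are already those of \<open>B\<close>,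
      against independence.\<close>
    have "\<exists>j<n. j \<ge> m \<and> z j \<noteq> 0"
    proof (rule ccontr)
      assume "\<not> ?thesis"
      then have 0: "z j = 0" if "j \<ge> m" "j < n" for j using that by blast
      define w where "w i = (if i < m then z i else if i = m then - 1 else 0)" for i
      have "lin_comb B w = - B ! m + (\<Sum>i\<in>{..<n} - {m}. w i *s B ! i)"
        using m len by (subst lin_comb_remove[of m]) (auto simp: w_def)
      also have "(\<Sum>i\<in>{..<n} - {m}. w i *s B ! i) = (\<Sum>i\<in>{..<n} - {m}. z i *s A ! i)"
        by (rule sum.cong) (use A 0 in \<open>auto simp: w_def\<close>)
      also have "\<dots> = lin_comb A z" using m lA 0[of m] by (subst lin_comb_remove[of m]) auto
      finally have "lin_comb B w = 0" using z by simp
      then have "w m = 0" using indep m by blast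
      then show False by (simp add: w_def)
    qed
    then obtain j where j: "j < n" "j \<ge> m" "z j \<noteq> 0" by blast
    obtain A' z' where A': "Q A'" "\<forall>i<m. A' ! i = B ! i" "B ! m = lin_comb A' z'" "z' m \<noteq> 0"
    proof (cases "z m = 0")
      case True
      \<comment> \<open>If the coefficient at \<open>m\<close> vanishes, \<open>A ! m\<close> is
        added to \<open>A ! j\<close>; after compensation \<open>B ! m\<close> has the coefficient
        \<open>- z j\<close> at \<open>m\<close>, which is not zero.\<close>
      define e :: "nat \<Rightarrow> complex" where "e i = (if i = j \<or> i = m then 1 else 0)" for i
      have jm: "j \<noteq> m" using True j by auto
      let ?A' = "A[j := lin_comb A e]"
      have e: "lin_comb A e = A ! j + A ! m"
      proof -
        have "(\<Sum>i\<in>{..<n} - {j}. e i *s A ! i) = A ! m"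
          using jm m by (subst sum.remove[of _ m]) (auto simp: e_def intro!: sum.neutral)
        then show ?thesis using j lA by (subst lin_comb_remove[of j]) (auto simp: e_def)
      qed
      define z' where "z' = z(m := - z j)"
      have "lin_comb ?A' z' = z j *s (A ! j + A ! m) + (\<Sum>i\<in>{..<n} - {j}. z' i *s A ! i)"
        using j lA jm by (simp add: lin_comb_update z'_def e)
      also have "(\<Sum>i\<in>{..<n} - {j}. z' i *s A ! i) = - z j *s A ! m + (\<Sum>i\<in>{..<n} - {j}. z i *s A ! i)"
      proof -
        have "(\<Sum>i\<in>{..<n} - {j} - {m}. z' i *s A ! i) = (\<Sum>i\<in>{..<n} - {j} - {m}. z i *s A ! i)"
          by (intro sum.cong) (auto simp: z'_def)
        moreover have "(\<Sum>i\<in>{..<n} - {j}. z' i *s A ! i) =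
            - z j *s A ! m + (\<Sum>i\<in>{..<n} - {j} - {m}. z' i *s A ! i)"
          using jm m by (subst sum.remove[of _ m]) (auto simp: z'_def)
        moreover have "(\<Sum>i\<in>{..<n} - {j}. z i *s A ! i) = (\<Sum>i\<in>{..<n} - {j} - {m}. z i *s A ! i)"
          using jm m True by (subst sum.remove[of _ m]) auto
        ultimately show ?thesis by simp
      qed
      also have "z j *s (A ! j + A ! m) + (- z j *s A ! m + (\<Sum>i\<in>{..<n} - {j}. z i *s A ! i)) =
          z j *s A ! j + (\<Sum>i\<in>{..<n} - {j}. z i *s A ! i)"
        by (simp add: vec_eq_iff algebra_simps)
      also have "\<dots> = lin_comb A z" using j lA by (subst lin_comb_remove[of j]) auto
      finally have "B ! m = lin_comb ?A' z'" using z by simp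
      moreover have "Q ?A'" by (rule replace) (use A j in \<open>auto simp: e_def\<close>)
      ultimately show ?thesis
        using that[of ?A' z'] A j jm by (auto simp: z'_def)
    qed (use that A z in blast)
    have "Q (A'[m := lin_comb A' z'])" by (rule replace) (use A' m in auto)
    then show ?case using A' m by (intro exI[of _ "A'[m := lin_comb A' z']"]) (auto simp: less_Suc_eq Q_def)
  qed
  from this[of n] obtain A where "Q A" "\<forall>i<n. A ! i = B ! i" by auto
  then have "A = B" using len by (intro nth_equalityI) (auto simp: Q_def)
  with \<open>Q A\<close> show ?thesis by (simp add: Q_def)
qed

lemma nn_integral_cvol_split:
  assumes "i < n" and [measurable]: "F \<in> borel_measurable (cvol n)"
  shows "(\<integral>\<^sup>+z. F z \<partial>cvol n) = (\<integral>\<^sup>+x. \<integral>\<^sup>+y. F (x(i := y)) \<partial>lborel \<partial>Pi\<^sub>M ({..<n} - {i}) (\<lambda>_. lborel))"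
proof -
  have e: "insert i ({..<n} - {i}) = {..<n}" using assms(1) by auto
  show ?thesis
    using cvol.product_nn_integral_insert[of "{..<n} - {i}" i F] assms(2) unfolding e by simp
qed

lemma measurable_cvol_split:
  assumes "i < n" and [measurable]: "F \<in> borel_measurable (cvol n)"
  shows "(\<lambda>x. \<integral>\<^sup>+y. F (x(i := y)) \<partial>lborel) \<in> borel_measurable (Pi\<^sub>M ({..<n} - {i}) (\<lambda>_. lborel :: complex measure))"
proof -
  have e: "insert i ({..<n} - {i}) = {..<n}" using assms(1) by auto
  have [measurable]: "F \<in> borel_measurable (Pi\<^sub>M (insert i ({..<n} - {i})) (\<lambda>_. lborel))"
    unfolding e by fact
  show ?thesis by measurable
qed

lemma nn_integral_lin_comb_scale:
  fixes A :: "(complex^'n) list"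
  assumes n: "length A = n" "i < n" and a: "a \<noteq> 0" and [measurable]: "f \<in> borel_measurable borel"
  shows "ennreal ((norm a)\<^sup>2) * (\<integral>\<^sup>+z. f (lin_comb (A[i := a *s A ! i]) z) \<partial>cvol n) =
    (\<integral>\<^sup>+z. f (lin_comb A z) \<partial>cvol n)"
proof -
  let ?A = "A[i := a *s A ! i]"
  let ?F = "\<lambda>z. f (lin_comb A z)" and ?F' = "\<lambda>z. f (lin_comb ?A z)"
  have m [measurable]: "?F \<in> borel_measurable (cvol n)" "?F' \<in> borel_measurable (cvol n)"
    by (intro measurable_compose[OF measurable_lin_comb]; simp add: n)+
  have e: "lin_comb ?A (x(i := y)) = lin_comb A (x(i := a * y))" for x y
    using n by (simp add: lin_comb_update lin_comb_remove[of i A] mult.commute)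
  have "(\<integral>\<^sup>+z. ?F z \<partial>cvol n) =
      (\<integral>\<^sup>+x. \<integral>\<^sup>+y. ?F (x(i := y)) \<partial>lborel \<partial>Pi\<^sub>M ({..<n} - {i}) (\<lambda>_. lborel))"
    by (rule nn_integral_cvol_split[OF n(2) m(1)])
  also have "\<dots> = (\<integral>\<^sup>+x. ennreal ((norm a)\<^sup>2) * (\<integral>\<^sup>+y. ?F' (x(i := y)) \<partial>lborel) \<partial>Pi\<^sub>M ({..<n} - {i}) (\<lambda>_. lborel))"
  proof (rule nn_integral_cong)
    fix x
    have "(\<lambda>y. lin_comb A (x(i := y))) \<in> borel_measurable borel"
      unfolding lin_comb_remove[OF n(2)[folded n(1)]] by (simp, measurable)
    then have "(\<lambda>y. f (lin_comb A (x(i := y)))) \<in> borel_measurable borel" by measurable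
    from nn_integral_complex_mult[OF this a]
    show "(\<integral>\<^sup>+y. ?F (x(i := y)) \<partial>lborel) = ennreal ((norm a)\<^sup>2) * (\<integral>\<^sup>+y. ?F' (x(i := y)) \<partial>lborel)"
      by (simp add: e)
  qed
  also have "\<dots> = ennreal ((norm a)\<^sup>2) * (\<integral>\<^sup>+x. \<integral>\<^sup>+y. ?F' (x(i := y)) \<partial>lborel \<partial>Pi\<^sub>M ({..<n} - {i}) (\<lambda>_. lborel))"
    by (rule nn_integral_cmult[OF measurable_cvol_split[OF n(2) m(2)]])
  also have "\<dots> = ennreal ((norm a)\<^sup>2) * (\<integral>\<^sup>+z. ?F' z \<partial>cvol n)"
    by (simp add: nn_integral_cvol_split[OF n(2) m(2)])
  finally show ?thesis by simp
qed

text \<open>With the other coordinates fixed, the shear translates the coordinate \<open>j\<close>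
  by \<open>a * x i\<close>, and Lebesgue measure is translation invariant.\<close>

lemma nn_integral_lin_comb_shear:
  fixes A :: "(complex^'n) list"
  assumes n: "length A = n" "i < n" "j < n" "i \<noteq> j" and [measurable]: "f \<in> borel_measurable borel"
  shows "(\<integral>\<^sup>+z. f (lin_comb (A[i := A ! i + a *s A ! j]) z) \<partial>cvol n) =
    (\<integral>\<^sup>+z. f (lin_comb A z) \<partial>cvol n)"
proof -
  let ?A = "A[i := A ! i + a *s A ! j]"
  let ?F = "\<lambda>z. f (lin_comb A z)" and ?F' = "\<lambda>z. f (lin_comb ?A z)"
  have m [measurable]: "?F \<in> borel_measurable (cvol n)" "?F' \<in> borel_measurable (cvol n)"
    by (intro measurable_compose[OF measurable_lin_comb]; simp add: n)+
  have e: "lin_comb ?A (x(j := y)) = lin_comb A (x(j := a * x i + y))" for x y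
  proof -
    have "lin_comb ?A (x(j := y)) = lin_comb A (x(j := y)) + (x i * a) *s A ! j"
      using n lin_comb_remove[of i A "x(j := y)"]
      by (simp add: lin_comb_update vec_eq_iff algebra_simps)
    moreover have "(\<Sum>k\<in>{..<n} - {j}. (x(j := y)) k *s A ! k) =
        (\<Sum>k\<in>{..<n} - {j}. (x(j := a * x i + y)) k *s A ! k)"
      by (intro sum.cong) auto
    ultimately show ?thesis
      using n lin_comb_remove[of j A "x(j := y)"] lin_comb_remove[of j A "x(j := a * x i + y)"]
      by (simp add: vec_eq_iff algebra_simps)
  qed
  have "(\<integral>\<^sup>+z. ?F z \<partial>cvol n) =
      (\<integral>\<^sup>+x. \<integral>\<^sup>+y. ?F (x(j := y)) \<partial>lborel \<partial>Pi\<^sub>M ({..<n} - {j}) (\<lambda>_. lborel))"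
    by (rule nn_integral_cvol_split[OF n(3) m(1)])
  also have "\<dots> = (\<integral>\<^sup>+x. \<integral>\<^sup>+y. ?F' (x(j := y)) \<partial>lborel \<partial>Pi\<^sub>M ({..<n} - {j}) (\<lambda>_. lborel))"
  proof (rule nn_integral_cong)
    fix x
    have "(\<lambda>y. lin_comb A (x(j := y))) \<in> borel_measurable borel"
      unfolding lin_comb_remove[OF n(3)[folded n(1)]] by (simp, measurable)
    then have "(\<lambda>y. f (lin_comb A (x(j := y)))) \<in> borel_measurable borel" by measurable
    from nn_integral_translate[OF this, of "a * x i"]
    show "(\<integral>\<^sup>+y. ?F (x(j := y)) \<partial>lborel) = (\<integral>\<^sup>+y. ?F' (x(j := y)) \<partial>lborel)"
      by (simp add: e)
  qed
  also have "\<dots> = (\<integral>\<^sup>+z. ?F' z \<partial>cvol n)"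
    by (simp add: nn_integral_cvol_split[OF n(3) m(2)])
  finally show ?thesis by simp
qed

lemma standard_basis_list:
  obtains ks :: "'n::finite list" where "distinct ks" "set ks = UNIV"
    "standard_basis = map (\<lambda>k. axis k 1 :: complex^'n) ks"
proof -
  have "\<exists>ks :: 'n list. distinct ks \<and> set ks = UNIV"
    using finite_distinct_list[of "UNIV :: 'n set"] by auto
  from someI_ex[OF this] show ?thesis
    by (intro that[of "SOME ks. distinct ks \<and> set ks = UNIV"]) (auto simp: standard_basis_def)
qed

lemma length_standard_basis [simp]: "length (standard_basis :: (complex^'n::finite) list) = CARD('n)"
  by (rule standard_basis_list[where 'n='n]) (metis distinct_card length_map)

lemma lin_comb_standard_basis:
  assumes "distinct ks" "set ks = (UNIV :: 'n::finite set)"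
    "standard_basis = map (\<lambda>k. axis k 1 :: complex^'n) ks" "i < length ks"
  shows "lin_comb standard_basis z $ (ks ! i) = z i"
proof -
  have "lin_comb standard_basis z $ (ks ! i) = (\<Sum>j<length ks. z j * (if j = i then 1 else 0))"
    unfolding lin_comb_def assms(3)
    by (auto intro!: sum.cong simp: axis_def nth_eq_iff_index_eq[OF assms(1)] assms(4))
  also have "\<dots> = z i" using assms(4) by (simp add: if_distrib sum.delta' cong: if_cong)
  finally show ?thesis .
qed

lemma lborel_standard_basis:
  "(lborel :: (complex^'n::finite) measure) = distr (cvol CARD('n)) borel (lin_comb standard_basis)"
proof (rule lborel_eqI)
  obtain ks :: "'n list" where ks: "distinct ks" "set ks = UNIV"
    "standard_basis = map (\<lambda>k. axis k 1 :: complex^'n) ks" by (rule standard_basis_list)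
  have len: "length ks = CARD('n)" using ks distinct_card by metis
  have bij: "bij_betw (\<lambda>i. ks ! i) {..<CARD('n)} UNIV"
    using bij_betw_nth[OF ks(1) _ ks(2)[symmetric]] len by simp
  have B: "(Basis :: (complex^'n) set) = (\<lambda>(k, c). axis k c) ` (UNIV \<times> Basis)"
    by (auto simp: Basis_vec_def)
  fix l u :: "complex^'n"
  assume le: "\<And>b. b \<in> Basis \<Longrightarrow> l \<bullet> b \<le> u \<bullet> b"
  have le': "l $ k \<bullet> c \<le> u $ k \<bullet> c" if "c \<in> Basis" for k c
    using le[of "axis k c"] that by (auto simp: B inner_axis)
  have mem: "x \<in> box l u \<longleftrightarrow> (\<forall>i<CARD('n). x $ (ks ! i) \<in> box (l $ (ks ! i)) (u $ (ks ! i)))" for x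
  proof -
    have "x \<in> box l u \<longleftrightarrow> (\<forall>k. x $ k \<in> box (l $ k) (u $ k))"
      unfolding mem_box B by (auto simp: inner_axis)
    also have "\<dots> \<longleftrightarrow> (\<forall>i<CARD('n). x $ (ks ! i) \<in> box (l $ (ks ! i)) (u $ (ks ! i)))"
      using all_set_conv_all_nth[of ks "\<lambda>k. x $ k \<in> box (l $ k) (u $ k)"] by (simp add: ks(2) len)
    finally show ?thesis .
  qed
  have "emeasure (distr (cvol CARD('n)) borel (lin_comb (standard_basis :: (complex^'n) list))) (box l u) =
      emeasure (cvol CARD('n)) (\<Pi>\<^sub>E i\<in>{..<CARD('n)}. box (l $ (ks ! i)) (u $ (ks ! i)))"
  proof -
    have "lin_comb standard_basis -` box l u \<inter> space (cvol CARD('n)) =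
        (\<Pi>\<^sub>E i\<in>{..<CARD('n)}. box (l $ (ks ! i)) (u $ (ks ! i)))"
      by (intro set_eqI) (simp add: mem space_PiM PiE_iff lin_comb_standard_basis[OF ks] len Ball_def conj_commute)
    then show ?thesis by (subst emeasure_distr) auto
  qed
  also have "\<dots> = (\<Prod>i<CARD('n). emeasure lborel (box (l $ (ks ! i)) (u $ (ks ! i))))"
    by (rule cvol.emeasure_PiM) auto
  also have "\<dots> = (\<Prod>i<CARD('n). ennreal (\<Prod>c\<in>Basis. (u $ (ks ! i) - l $ (ks ! i)) \<bullet> c))"
    using le' by (intro prod.cong) (auto simp: emeasure_lborel_box_eq)
  also have "\<dots> = (\<Prod>k\<in>UNIV. ennreal (\<Prod>c\<in>Basis. (u $ k - l $ k) \<bullet> c))"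
    by (rule prod.reindex_bij_betw[OF bij])
  also have "\<dots> = ennreal (\<Prod>k\<in>UNIV. \<Prod>c\<in>Basis. (u $ k - l $ k) \<bullet> c)"
    using le' by (intro prod_ennreal) (auto intro!: prod_nonneg simp: inner_diff_left)
  also have "(\<Prod>k\<in>UNIV. \<Prod>c\<in>Basis. (u $ k - l $ k) \<bullet> c) = (\<Prod>b\<in>Basis. (u - l) \<bullet> b)"
  proof -
    have inj: "inj_on (\<lambda>(k, c). axis k c :: complex^'n) (UNIV \<times> Basis)"
      by (auto simp: inj_on_def axis_eq_axis)
    show ?thesis
      unfolding B prod.reindex[OF inj] prod.cartesian_product
      by (intro prod.cong) (auto simp: inner_axis)
  qed
  finally show "emeasure (distr (cvol CARD('n)) borel (lin_comb (standard_basis :: (complex^'n) list))) (box l u) =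
      ennreal (\<Prod>b\<in>Basis. (u - l) \<bullet> b)" .
qed simp

lemma lin_comb_standard_basis_surj: "\<exists>z. v = lin_comb (standard_basis :: (complex^'n::finite) list) z"
proof -
  obtain ks :: "'n list" where ks: "distinct ks" "set ks = UNIV"
    "standard_basis = map (\<lambda>k. axis k 1 :: complex^'n) ks" by (rule standard_basis_list)
  have "v = lin_comb standard_basis (\<lambda>i. v $ (ks ! i))"
    unfolding vec_eq_iff
  proof
    fix k
    obtain i where i: "i < length ks" "ks ! i = k" using ks(2) by (metis UNIV_I in_set_conv_nth)
    show "v $ k = lin_comb standard_basis (\<lambda>i. v $ (ks ! i)) $ k"
      using lin_comb_standard_basis[OF ks i(1), of "\<lambda>i. v $ (ks ! i)"] i(2) by simp
  qed
  then show ?thesis by blast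
qed

lemma is_basis_lin_comb:
  assumes "is_basis W bs"
  shows "lin_comb bs z = 0 \<Longrightarrow> i < length bs \<Longrightarrow> z i = 0" and "lin_comb bs z \<in> W"
    and "v \<in> W \<Longrightarrow> \<exists>z. v = lin_comb bs z"
proof -
  have d: "distinct bs" and ind: "vec.independent (set bs)" and sp: "vec.span (set bs) = W"
    using assms by (auto simp: is_basis_def)
  have bij: "bij_betw (\<lambda>i. bs ! i) {..<length bs} (set bs)" by (rule bij_betw_nth[OF d]) auto
  show "lin_comb bs z \<in> W"
    unfolding lin_comb_def sp[symmetric] by (intro vec.span_sum vec.span_scale vec.span_base) auto
  {
    assume z: "lin_comb bs z = 0" and i: "i < length bs"
    define g where "g v = z (the_inv_into {..<length bs} (\<lambda>i. bs ! i) v)" for v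
    have g: "g (bs ! j) = z j" if "j < length bs" for j
      unfolding g_def using that the_inv_into_f_f[of "\<lambda>i. bs ! i" "{..<length bs}" j] bij
      by (simp add: bij_betw_def)
    have "(\<Sum>v\<in>set bs. g v *s v) = (\<Sum>i<length bs. g (bs ! i) *s bs ! i)"
      by (rule sum.reindex_bij_betw[OF bij, symmetric])
    also have "\<dots> = lin_comb bs z" unfolding lin_comb_def using g by simp
    finally have "g (bs ! i) = 0"
      using vec.independentD[OF ind _ subset_refl, of g "bs ! i"] z i by simp
    then show "z i = 0" using g i by simp
  }
  {
    assume "v \<in> W"
    then obtain u where u: "v = (\<Sum>w\<in>set bs. u w *s w)"
      unfolding sp[symmetric] vec.span_finite[OF finite_set] by auto
    also have "\<dots> = (\<Sum>i<length bs. u (bs ! i) *s bs ! i)"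
      by (rule sum.reindex_bij_betw[OF bij, symmetric])
    also have "\<dots> = lin_comb bs (\<lambda>i. u (bs ! i))" by (simp add: lin_comb_def)
    finally show "\<exists>z. v = lin_comb bs z" by blast
  }
qed

lemma is_basis_length: "is_basis UNIV (bs :: (complex^'n::finite) list) \<Longrightarrow> length bs = CARD('n)"
  unfolding is_basis_def by (metis distinct_card vec.basis_card_eq_dim top_greatest vec_dim_card)

text \<open>The number \<open>\<kappa>\<close> is the squared modulus of the complex determinant of
  \<open>bs\<close>. Top-degree forms and Lebesgue measure are followed together through the
  elementary operations, so one constant serves both and no determinant is expanded.\<close>

lemma basis_jacobian:
  fixes bs :: "(complex^'n::finite) list"
  assumes bs: "is_basis UNIV bs"
  obtains \<kappa> :: real where "\<kappa> > 0"
    and "\<And>D. alternating (2 * CARD('n)) D \<Longrightarrow> D (frame bs) = of_real \<kappa> * D (frame standard_basis)"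
    and "\<And>f. f \<in> borel_measurable borel \<Longrightarrow>
      ennreal \<kappa> * (\<integral>\<^sup>+z. f (lin_comb bs z) \<partial>cvol CARD('n)) = (\<integral>\<^sup>+y. f y \<partial>lborel)"
proof -
  define P where "P bs \<longleftrightarrow> (\<exists>\<kappa>>0.
      (\<forall>D. alternating (2 * CARD('n)) D \<longrightarrow> D (frame bs) = of_real \<kappa> * D (frame (standard_basis :: (complex^'n) list))) \<and>
      (\<forall>f\<in>borel_measurable borel.
        ennreal \<kappa> * (\<integral>\<^sup>+z. f (lin_comb bs z) \<partial>cvol CARD('n)) = (\<integral>\<^sup>+y. f y \<partial>lborel)))" for bs :: "(complex^'n) list"
  have "P bs"
  proof (rule elementary_list_induct[of standard_basis "CARD('n)" bs P])
    show "P standard_basis"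
      unfolding P_def
      by (intro exI[of _ 1] conjI ballI allI impI)
         (auto simp: lborel_standard_basis nn_integral_distr)
  next
    fix A :: "(complex^'n) list" and i and a :: complex
    assume A: "P A" and n: "length A = CARD('n)" "i < CARD('n)" and a: "a \<noteq> 0"
    obtain \<kappa> where \<kappa>: "\<kappa> > 0"
        "\<And>D. alternating (2 * CARD('n)) D \<Longrightarrow> D (frame A) = of_real \<kappa> * D (frame (standard_basis :: (complex^'n) list))"
        "\<And>f. f \<in> borel_measurable borel \<Longrightarrow>
          ennreal \<kappa> * (\<integral>\<^sup>+z. f (lin_comb A z) \<partial>cvol CARD('n)) = (\<integral>\<^sup>+y. f y \<partial>lborel)"
      using A unfolding P_def by blast
    have t: "A = take i A @ A ! i # drop (Suc i) A" using n by (simp add: id_take_nth_drop)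
    show "P (A[i := a *s A ! i])"
      unfolding P_def
    proof (intro exI[of _ "(norm a)\<^sup>2 * \<kappa>"] conjI ballI allI impI)
      show "(norm a)\<^sup>2 * \<kappa> > 0" using \<kappa>(1) a by simp
    next
      fix D :: "(complex^'n) list \<Rightarrow> complex" assume D: "alternating (2 * CARD('n)) D"
      have "D (frame (A[i := a *s A ! i])) = of_real ((norm a)\<^sup>2) * D (frame (take i A @ A ! i # drop (Suc i) A))"
        using n alternating_frame_scale[OF D, of "frame (take i A)" a "A ! i"]
        by (simp add: upd_conv_take_nth_drop)
      then show "D (frame (A[i := a *s A ! i])) = of_real ((norm a)\<^sup>2 * \<kappa>) * D (frame standard_basis)"
        using \<kappa>(2)[OF D] t by simp
    next
      fix f :: "complex^'n \<Rightarrow> ennreal" assume f: "f \<in> borel_measurable borel"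
      show "ennreal ((norm a)\<^sup>2 * \<kappa>) * (\<integral>\<^sup>+z. f (lin_comb (A[i := a *s A ! i]) z) \<partial>cvol CARD('n)) = (\<integral>\<^sup>+y. f y \<partial>lborel)"
        using nn_integral_lin_comb_scale[OF n a f] \<kappa>(1) \<kappa>(3)[OF f, symmetric]
        by (simp add: ennreal_mult ac_simps)
    qed
  next
    fix A :: "(complex^'n) list" and i j a
    assume A: "P A" and n: "length A = CARD('n)" "i < CARD('n)" "j < CARD('n)" "i \<noteq> j"
    obtain \<kappa> where \<kappa>: "\<kappa> > 0"
        "\<And>D. alternating (2 * CARD('n)) D \<Longrightarrow> D (frame A) = of_real \<kappa> * D (frame (standard_basis :: (complex^'n) list))"
        "\<And>f. f \<in> borel_measurable borel \<Longrightarrow>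
          ennreal \<kappa> * (\<integral>\<^sup>+z. f (lin_comb A z) \<partial>cvol CARD('n)) = (\<integral>\<^sup>+y. f y \<partial>lborel)"
      using A unfolding P_def by blast
    have t: "A = take i A @ A ! i # drop (Suc i) A" using n by (simp add: id_take_nth_drop)
    have "A ! j \<in> set (take i A @ drop (Suc i) A)"
    proof (cases "j < i")
      case True
      then show ?thesis using n by (auto simp: in_set_conv_nth intro!: exI[of _ j])
    next
      case False
      then have "drop (Suc i) A ! (j - Suc i) = A ! j" "j - Suc i < length (drop (Suc i) A)"
        using n by auto
      then show ?thesis by (metis UnI2 nth_mem set_append)
    qed
    then have j: "A ! j \<in> set (frame (take i A) @ frame (drop (Suc i) A))"
      "\<i> *s A ! j \<in> set (frame (take i A) @ frame (drop (Suc i) A))"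
      using mem_frame[of "A ! j" "take i A @ drop (Suc i) A"] by auto
    show "P (A[i := A ! i + a *s A ! j])"
      unfolding P_def
    proof (intro exI[of _ \<kappa>] conjI ballI allI impI)
      fix D :: "(complex^'n) list \<Rightarrow> complex" assume D: "alternating (2 * CARD('n)) D"
      have "D (frame (A[i := A ! i + a *s A ! j])) = D (frame (take i A @ A ! i # drop (Suc i) A))"
        using n alternating_frame_shear[OF D j] by (simp add: upd_conv_take_nth_drop)
      then show "D (frame (A[i := A ! i + a *s A ! j])) = of_real \<kappa> * D (frame standard_basis)"
        using \<kappa>(2)[OF D] t by simp
    next
      fix f :: "complex^'n \<Rightarrow> ennreal" assume f: "f \<in> borel_measurable borel"
      show "ennreal \<kappa> * (\<integral>\<^sup>+z. f (lin_comb (A[i := A ! i + a *s A ! j]) z) \<partial>cvol CARD('n)) = (\<integral>\<^sup>+y. f y \<partial>lborel)"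
        using nn_integral_lin_comb_shear[OF n f] \<kappa>(3)[OF f] by simp
    qed fact
  qed (use is_basis_lin_comb[OF bs] is_basis_length[OF bs] lin_comb_standard_basis_surj in auto)
  then show ?thesis using that unfolding P_def by blast
qed

text \<open>The rule for nonnegative integrands identifies \<open>lborel\<close> with a multiple of
  an image measure; in this form it passes to integrability and to complex integrands.\<close>

lemma integral_basis:
  fixes bs :: "(complex^'n::finite) list"
  assumes bs: "is_basis UNIV bs"
  obtains \<kappa> :: real where "\<kappa> > 0"
    and "\<And>D. alternating (2 * CARD('n)) D \<Longrightarrow> D (frame bs) = of_real \<kappa> * D (frame standard_basis)"
    and "\<And>g::complex^'n \<Rightarrow> complex. g \<in> borel_measurable borel \<Longrightarrow>
      integrable (cvol CARD('n)) (\<lambda>z. g (lin_comb bs z)) \<longleftrightarrow> integrable lborel g"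
    and "\<And>g::complex^'n \<Rightarrow> complex. g \<in> borel_measurable borel \<Longrightarrow>
      of_real \<kappa> * (LINT z|cvol CARD('n). g (lin_comb bs z)) = (LINT y|lborel. g y)"
proof -
  obtain \<kappa> :: real where \<kappa>: "\<kappa> > 0"
    and D: "\<And>D. alternating (2 * CARD('n)) D \<Longrightarrow> D (frame bs) = of_real \<kappa> * D (frame standard_basis)"
    and I: "\<And>f. f \<in> borel_measurable borel \<Longrightarrow>
      ennreal \<kappa> * (\<integral>\<^sup>+z. f (lin_comb bs z) \<partial>cvol CARD('n)) = (\<integral>\<^sup>+y. f y \<partial>lborel)"
    by (rule basis_jacobian[OF bs]) blast
  have [measurable]: "lin_comb bs \<in> borel_measurable (cvol CARD('n))"
    using is_basis_length[OF bs] by measurable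
  let ?M = "density (distr (cvol CARD('n)) borel (lin_comb bs)) (\<lambda>_. ennreal \<kappa>)"
  have M: "lborel = ?M"
  proof (rule measure_eqI)
    fix X :: "(complex^'n) set" assume "X \<in> sets lborel"
    then have [measurable]: "X \<in> sets borel" by simp
    have "emeasure ?M X = ennreal \<kappa> * (\<integral>\<^sup>+y. indicator X y \<partial>distr (cvol CARD('n)) borel (lin_comb bs))"
      by (subst emeasure_density, simp, simp, subst nn_integral_cmult) auto
    also have "\<dots> = (\<integral>\<^sup>+y. indicator X y \<partial>lborel)"
      by (subst nn_integral_distr) (auto simp: I)
    finally show "emeasure lborel X = emeasure ?M X" by simp
  qed simp
  show ?thesis
  proof (rule that[OF \<kappa> D])
    fix g :: "complex^'n \<Rightarrow> complex" assume [measurable]: "g \<in> borel_measurable borel"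
    show "integrable (cvol CARD('n)) (\<lambda>z. g (lin_comb bs z)) \<longleftrightarrow> integrable lborel g"
    proof -
      have "integrable (cvol CARD('n)) (\<lambda>z. \<kappa> *\<^sub>R g (lin_comb bs z)) \<longleftrightarrow> integrable (cvol CARD('n)) (\<lambda>z. g (lin_comb bs z))"
        using integrable_scaleR_right[of "1 / \<kappa>" "cvol CARD('n)" "\<lambda>z. \<kappa> *\<^sub>R g (lin_comb bs z)"] \<kappa>
        by (auto intro: integrable_scaleR_right)
      then show ?thesis
        using \<kappa> by (subst M) (simp add: integrable_density integrable_distr_eq)
    qed
    show "of_real \<kappa> * (LINT z|cvol CARD('n). g (lin_comb bs z)) = (LINT y|lborel. g y)"
      using \<kappa> by (subst M) (simp add: integral_density integral_distr scaleR_conv_of_real)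
  qed
qed

section \<open>Forms and the Dolbeault operators\<close>

text \<open>The parameter \<open>\<sigma> = 1\<close> gives \<open>\<partial>\<close>, and \<open>\<sigma> = - 1\<close> gives its conjugate.\<close>

definition wirtinger :: "complex \<Rightarrow> (complex^'n::finite \<Rightarrow> complex) \<Rightarrow> complex^'n \<Rightarrow> complex^'n \<Rightarrow> complex" where
  "wirtinger \<sigma> g x v = (frechet_derivative g (at x) v - \<sigma> * \<i> * frechet_derivative g (at x) (\<i> *s v)) / 2"

definition dolbeault :: "complex \<Rightarrow> ('n::finite) form \<Rightarrow> 'n form" where
  "dolbeault \<sigma> \<omega> x vs = (if x = 0 then 0 else alt_sum (\<lambda>v ws. wirtinger \<sigma> (\<lambda>y. \<omega> y ws) x v) vs)"

lemma del_eq_dolbeault: "del = dolbeault 1"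
  by (intro ext) (simp add: del_def dolbeault_def alt_sum_def wirtinger_def deriv10_def)

lemma delbar_eq_dolbeault: "delbar = dolbeault (- 1)"
  by (intro ext) (simp add: delbar_def dolbeault_def alt_sum_def wirtinger_def deriv01_def)

lemma frechet_derivative_cong_open:
  assumes "open S" "x \<in> S" "\<And>y. y \<in> S \<Longrightarrow> f y = g y"
  shows "frechet_derivative f (at x) = frechet_derivative g (at x)"
proof -
  have "(f has_derivative D) (at x) \<longleftrightarrow> (g has_derivative D) (at x)" for D
    using has_derivative_transform_within_open[of f D x UNIV S g]
      has_derivative_transform_within_open[of g D x UNIV S f] assms by auto
  then show ?thesis unfolding frechet_derivative_def by simp
qed

lemma wirtinger_cong_open:
  "open S \<Longrightarrow> x \<in> S \<Longrightarrow> (\<And>y. y \<in> S \<Longrightarrow> f y = g y) \<Longrightarrow> wirtinger \<sigma> f x v = wirtinger \<sigma> g x v"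
  unfolding wirtinger_def by (subst (1 2) frechet_derivative_cong_open[of S x f g]) auto

lemma wirtinger_has_derivative:
  "(f has_derivative D) (at x) \<Longrightarrow> wirtinger \<sigma> f x v = (D v - \<sigma> * \<i> * D (\<i> *s v)) / 2"
  unfolding wirtinger_def by (simp add: frechet_eq)

lemma wirtinger_const [simp]: "wirtinger \<sigma> (\<lambda>y. c) x v = 0"
  using wirtinger_has_derivative[OF has_derivative_const] by simp

lemma wirtinger_lincomb:
  assumes "f differentiable (at x)" "g differentiable (at x)"
  shows "wirtinger \<sigma> (\<lambda>y. c * f y + g y) x v = c * wirtinger \<sigma> f x v + wirtinger \<sigma> g x v"
proof -
  have "((\<lambda>y. c * f y + g y) has_derivative
      (\<lambda>v. c * frechet_derivative f (at x) v + frechet_derivative g (at x) v)) (at x)"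
    using assms[unfolded frechet_derivative_works] by (intro has_derivative_add has_derivative_mult_right)
  note d = wirtinger_has_derivative[OF this]
  show ?thesis
    unfolding d unfolding wirtinger_def by (simp add: field_simps)
qed

lemma wirtinger_mult:
  assumes "f differentiable (at x)" "g differentiable (at x)"
  shows "wirtinger \<sigma> (\<lambda>y. f y * g y) x v = f x * wirtinger \<sigma> g x v + wirtinger \<sigma> f x v * g x"
proof -
  have "((\<lambda>y. f y * g y) has_derivative
      (\<lambda>v. f x * frechet_derivative g (at x) v + frechet_derivative f (at x) v * g x)) (at x)"
    using assms[unfolded frechet_derivative_works] by (intro has_derivative_mult)
  note d = wirtinger_has_derivative[OF this]
  show ?thesis
    unfolding d unfolding wirtinger_def by (simp add: field_simps)
qed

lemma wirtinger_linear:
  assumes "f differentiable (at x)"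
  shows "wirtinger \<sigma> f x (r *\<^sub>R v + w) = of_real r * wirtinger \<sigma> f x v + wirtinger \<sigma> f x w"
proof -
  have l: "linear (frechet_derivative f (at x))" by (rule linear_frechet_derivative[OF assms])
  have "\<i> *s (r *\<^sub>R v + w) = r *\<^sub>R (\<i> *s v) + \<i> *s w" by (simp add: vec_eq_iff algebra_simps)
  then show ?thesis
    by (simp only: wirtinger_def linear_add[OF l] linear_cmul[OF l])
       (simp add: scaleR_conv_of_real[where 'a=complex] field_simps)
qed

lemma smooth_on_wirtinger:
  assumes "open S" "smooth_on S f"
  shows "smooth_on S (\<lambda>x. wirtinger \<sigma> f x v)"
proof -
  have "smooth_on S (\<lambda>x. (1/2) * (frechet_derivative f (at x) v - (\<sigma> * \<i>) * frechet_derivative f (at x) (\<i> *s v)))"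
    by (intro smooth_on_mult smooth_on_diff smooth_on_const smooth_on_frechet_derivative assms)
  then show ?thesis by (simp add: wirtinger_def)
qed

text \<open>The bidegree is forgotten: differentiation and integration are handled by degree alone,
  and types return only when membership in \<open>test_forms\<close> or \<open>proj_forms\<close> is
  shown.\<close>

definition smooth_form :: "nat \<Rightarrow> ('n::finite) form \<Rightarrow> bool" where
  "smooth_form k \<omega> \<longleftrightarrow> (\<forall>x. alternating k (\<omega> x)) \<and> (\<forall>vs. smooth_on (- {0}) (\<lambda>x. \<omega> x vs)) \<and> \<omega> 0 = (\<lambda>vs. 0)"

lemma forms_smooth_form: "\<omega> \<in> forms p q \<Longrightarrow> smooth_form (p + q) \<omega>"
  by (auto simp: forms_def smooth_form_def)

lemma smooth_formD:
  assumes "smooth_form k \<omega>"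
  shows "alternating k (\<omega> x)" "smooth_on (- {0}) (\<lambda>x. \<omega> x vs)" "\<omega> 0 vs = 0"
    and "x \<noteq> 0 \<Longrightarrow> (\<lambda>x. \<omega> x vs) differentiable (at x)"
  using assms smooth_on_differentiable[of "- {0}" "\<lambda>x. \<omega> x vs" x] by (auto simp: smooth_form_def)

lemma alternating_null: "alternating k (\<lambda>vs. 0)"
  by (auto simp: alternating_def)

lemma smooth_form_dolbeault:
  assumes \<omega>: "smooth_form k \<omega>"
  shows "smooth_form (Suc k) (dolbeault \<sigma> \<omega>)"
  unfolding smooth_form_def
proof (intro conjI allI)
  fix x
  show "alternating (Suc k) (dolbeault \<sigma> \<omega> x)"
  proof (cases "x = 0")
    case True
    then have "dolbeault \<sigma> \<omega> x = (\<lambda>vs. 0)" by (auto simp: dolbeault_def)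
    then show ?thesis by (simp add: alternating_null)
  next
    case False
    note diff = smooth_formD(4)[OF \<omega> False]
    have "alternating (Suc k) (alt_sum (\<lambda>v ws. wirtinger \<sigma> (\<lambda>y. \<omega> y ws) x v))"
    proof (rule alternating_alt_sum)
      fix v
      show "alternating k (\<lambda>ws. wirtinger \<sigma> (\<lambda>y. \<omega> y ws) x v)"
        unfolding alternating_def
        by (simp add: alternating_length[OF smooth_formD(1)[OF \<omega>]] alternating_not_distinct[OF smooth_formD(1)[OF \<omega>]]
            alternating_lincomb[OF smooth_formD(1)[OF \<omega>]] wirtinger_lincomb[OF diff diff])
    qed (rule wirtinger_linear[OF diff])
    moreover have "dolbeault \<sigma> \<omega> x = alt_sum (\<lambda>v ws. wirtinger \<sigma> (\<lambda>y. \<omega> y ws) x v)"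
      using False by (auto simp: dolbeault_def)
    ultimately show ?thesis by simp
  qed
next
  fix vs
  have o: "open (- {0 :: complex^'a})" by (simp add: open_Compl)
  have "smooth_on (- {0}) (\<lambda>x. alt_sum (\<lambda>v ws. wirtinger \<sigma> (\<lambda>y. \<omega> y ws) x v) vs)"
    unfolding alt_sum_def
    by (intro smooth_on_sum smooth_on_mult smooth_on_const smooth_on_wirtinger smooth_formD(2)[OF \<omega>] o)
  then show "smooth_on (- {0}) (\<lambda>x. dolbeault \<sigma> \<omega> x vs)"
    by (rule smooth_on_cong[OF o, rotated]) (simp add: dolbeault_def)
qed (auto simp: dolbeault_def)

lemma dolbeault_eq_0:
  assumes "closed K" "\<And>x. x \<notin> K \<Longrightarrow> \<omega> x = (\<lambda>vs. 0)" "x \<notin> K"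
  shows "dolbeault \<sigma> \<omega> x = (\<lambda>vs. 0)"
proof
  fix vs
  have "wirtinger \<sigma> (\<lambda>y. \<omega> y ws) x v = wirtinger \<sigma> (\<lambda>y. 0) x v" for v ws
    by (rule wirtinger_cong_open[of "- K"]) (use assms in auto)
  then show "dolbeault \<sigma> \<omega> x vs = 0" by (simp add: dolbeault_def alt_sum_def)
qed

lemma dolbeault_lincomb:
  assumes "smooth_form k \<omega>" "smooth_form l \<eta>"
  shows "dolbeault \<sigma> (\<lambda>x vs. c * \<omega> x vs + \<eta> x vs) = (\<lambda>x vs. c * dolbeault \<sigma> \<omega> x vs + dolbeault \<sigma> \<eta> x vs)"
  by (intro ext)
     (auto simp: dolbeault_def wirtinger_lincomb smooth_formD(4)[OF assms(1)] smooth_formD(4)[OF assms(2)] alt_sum_add alt_sum_cmult)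

lemma alternating_sum:
  assumes "alternating k \<alpha>" "alternating k \<beta>"
  shows "alternating k (\<lambda>vs. c * \<alpha> vs + \<beta> vs)"
  unfolding alternating_def
proof (intro conjI allI impI)
  fix us ws v w and r :: real
  show "c * \<alpha> (us @ (r *\<^sub>R v + w) # ws) + \<beta> (us @ (r *\<^sub>R v + w) # ws) =
      of_real r * (c * \<alpha> (us @ v # ws) + \<beta> (us @ v # ws)) + (c * \<alpha> (us @ w # ws) + \<beta> (us @ w # ws))"
    unfolding alternating_lincomb[OF assms(1)] alternating_lincomb[OF assms(2)] by (simp add: algebra_simps)
qed (simp_all add: alternating_length[OF assms(1)] alternating_length[OF assms(2)]
    alternating_not_distinct[OF assms(1)] alternating_not_distinct[OF assms(2)])

lemma smooth_form_lincomb: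
  assumes "smooth_form k \<omega>" "smooth_form k \<eta>"
  shows "smooth_form k (\<lambda>x vs. c * \<omega> x vs + \<eta> x vs)"
  unfolding smooth_form_def
proof (intro conjI allI)
  fix vs
  have o: "open (- {0 :: complex^'a})" by (simp add: open_Compl)
  show "smooth_on (- {0}) (\<lambda>x. c * \<omega> x vs + \<eta> x vs)"
    by (intro smooth_on_add smooth_on_mult smooth_on_const smooth_formD(2)[OF assms(1)] smooth_formD(2)[OF assms(2)] o)
qed (simp_all add: alternating_sum smooth_formD(1)[OF assms(1)] smooth_formD(1)[OF assms(2)]
    smooth_formD(3)[OF assms(1)] smooth_formD(3)[OF assms(2)])

text \<open>Basic forms in the sense of the principal bundle \<open>proj\<close>: invariant under
  scaling and zero on vertical vectors. They are the pullbacks of forms of degree \<open>k\<close>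
  on the projective space, without regard to type.\<close>

definition basic_form :: "nat \<Rightarrow> ('n::finite) form \<Rightarrow> bool" where
  "basic_form k \<omega> \<longleftrightarrow> smooth_form k \<omega> \<and>
     (\<forall>x vs c. c \<noteq> 0 \<longrightarrow> \<omega> (c *s x) (map ((*s) c) vs) = \<omega> x vs) \<and>
     (\<forall>x vs a. a *s x \<in> set vs \<longrightarrow> \<omega> x vs = 0)"

lemma proj_forms_basic_form: "\<omega> \<in> proj_forms p q \<Longrightarrow> basic_form (p + q) \<omega>"
  by (auto simp: proj_forms_def basic_form_def forms_smooth_form)

lemma basic_formD:
  assumes "basic_form k \<omega>"
  shows "smooth_form k \<omega>" "c \<noteq> 0 \<Longrightarrow> \<omega> (c *s x) (map ((*s) c) vs) = \<omega> x vs"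
    "a *s x \<in> set vs \<Longrightarrow> \<omega> x vs = 0"
  using assms unfolding basic_form_def by blast+

text \<open>The Leibniz rule for a multilinear function; \<open>pre\<close> collects the arguments
  that the induction has already passed.\<close>

lemma has_vector_derivative_alternating:
  assumes alt: "alternating k M"
  shows "((\<lambda>t. M (pre @ map (\<lambda>w. w + t *\<^sub>R u w) ws)) has_vector_derivative
      (\<Sum>i<length ws. M (pre @ take i ws @ u (ws ! i) # drop (Suc i) ws))) (at 0)"
proof (induction ws arbitrary: pre)
  case (Cons w ws)
  let ?m = "\<lambda>t. map (\<lambda>w. w + t *\<^sub>R u w) ws"
  have e: "M (pre @ map (\<lambda>w. w + t *\<^sub>R u w) (w # ws)) =
      M ((pre @ [w]) @ ?m t) + t *\<^sub>R M ((pre @ [u w]) @ ?m t)" for t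
    using alternating_lincomb[OF alt, of pre t "u w" w "?m t"]
    by (simp add: scaleR_conv_of_real add.commute)
  have "((\<lambda>t. M ((pre @ [w]) @ ?m t) + t *\<^sub>R M ((pre @ [u w]) @ ?m t)) has_vector_derivative
      ((\<Sum>i<length ws. M ((pre @ [w]) @ take i ws @ u (ws ! i) # drop (Suc i) ws)) +
       (0 *\<^sub>R (\<Sum>i<length ws. M ((pre @ [u w]) @ take i ws @ u (ws ! i) # drop (Suc i) ws)) +
        1 *\<^sub>R M ((pre @ [u w]) @ ?m 0)))) (at 0)"
    by (intro has_vector_derivative_add has_vector_derivative_scaleR Cons DERIV_ident)
  then show ?case unfolding e by (simp add: sum.lessThan_Suc_shift add.commute del: sum.lessThan_Suc)
qed (simp add: has_vector_derivative_const)

text \<open>Differentiation of \<open>\<omega>\<^sub>y(ay, us) = 0\<close> in \<open>y\<close> and of \<open>\<omega>\<^bsub>cx\<^esub>(c ws) = \<omega>\<^sub>x(ws)\<close> in \<open>c\<close>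
  gives terms that cancel in the contraction of \<open>\<partial>\<omega>\<close> with \<open>ax\<close>.\<close>

lemma basic_form_contraction_deriv:
  assumes \<omega>: "basic_form k \<omega>" and x: "x \<noteq> 0"
  shows "frechet_derivative (\<lambda>y. \<omega> y (a *s x # us)) (at x) w = - \<omega> x (a *s w # us)"
proof -
  note alt = smooth_formD(1)[OF basic_formD(1)[OF \<omega>]] and diff = smooth_formD(4)[OF basic_formD(1)[OF \<omega>] x]
  have e: "\<omega> (x + t *\<^sub>R w) (a *s x # us) = - (t *\<^sub>R \<omega> (x + t *\<^sub>R w) (a *s w # us))" for t
  proof -
    have "0 = \<omega> (x + t *\<^sub>R w) (a *s (x + t *\<^sub>R w) # us)"
      by (rule basic_formD(3)[OF \<omega>, symmetric, of a]) simp
    also have "a *s (x + t *\<^sub>R w) = t *\<^sub>R (a *s w) + a *s x" by (simp add: vec_eq_iff algebra_simps)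
    also have "\<omega> (x + t *\<^sub>R w) ((t *\<^sub>R (a *s w) + a *s x) # us) =
        of_real t * \<omega> (x + t *\<^sub>R w) (a *s w # us) + \<omega> (x + t *\<^sub>R w) (a *s x # us)"
      using alternating_lincomb[OF alt, of _ "[]"] by simp
    finally show ?thesis by (simp add: scaleR_conv_of_real add_eq_0_iff)
  qed
  have line: "((\<lambda>t. f (x + t *\<^sub>R w)) has_vector_derivative frechet_derivative f (at x) w) (at 0)"
    if "f differentiable (at x)" for f :: "complex^'a \<Rightarrow> complex"
  proof -
    have f: "(f has_derivative frechet_derivative f (at x)) (at (x + 0 *\<^sub>R w))"
      using that by (simp add: frechet_derivative_works)
    have "((\<lambda>t. x + t *\<^sub>R w) has_derivative (\<lambda>t. t *\<^sub>R w)) (at 0)"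
      by (auto intro!: derivative_eq_intros)
    from has_derivative_compose[OF this f] have
      "((\<lambda>t. f (x + t *\<^sub>R w)) has_derivative (\<lambda>t. frechet_derivative f (at x) (t *\<^sub>R w))) (at 0)" .
    then show ?thesis
      unfolding has_vector_derivative_def
      using linear_cmul[OF linear_frechet_derivative[OF that]] by simp
  qed
  have "((\<lambda>t. - (t *\<^sub>R \<omega> (x + t *\<^sub>R w) (a *s w # us))) has_vector_derivative
      - (0 *\<^sub>R frechet_derivative (\<lambda>y. \<omega> y (a *s w # us)) (at x) w + 1 *\<^sub>R \<omega> (x + 0 *\<^sub>R w) (a *s w # us))) (at 0)"
    by (intro has_vector_derivative_minus has_vector_derivative_scaleR line diff DERIV_ident)
  with line[OF diff, of "a *s x # us"] show ?thesis
    unfolding e by (auto dest: vector_derivative_unique_at)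
qed

lemma basic_form_euler_deriv:
  assumes \<omega>: "basic_form k \<omega>" and x: "x \<noteq> 0"
  shows "frechet_derivative (\<lambda>y. \<omega> y ws) (at x) (a *s x) = - alt_sum (\<lambda>w us. \<omega> x (a *s w # us)) ws"
proof -
  note alt = smooth_formD(1)[OF basic_formD(1)[OF \<omega>]] and diff = smooth_formD(4)[OF basic_formD(1)[OF \<omega>] x]
  \<comment> \<open>By invariance, scaling \<open>ws\<close> by \<open>1 + t * a\<close> at the
    point \<open>x\<close> amounts to keeping \<open>ws\<close> and moving the point to
    \<open>c t *s x\<close>. Hence the inverse factor, whose derivative at \<open>0\<close> is
    \<open>- a\<close>.\<close>
  define c where "c t = 1 / (1 + of_real t * a)" for t :: real
  have c0: "\<forall>\<^sub>F t in nhds 0. 1 + of_real t * a \<noteq> 0"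
  proof -
    have "open {t::real. 1 + of_real t * a \<noteq> 0}" by (intro open_Collect_neq continuous_intros)
    then show ?thesis unfolding eventually_nhds by force
  qed
  have c: "(c has_vector_derivative - a) (at 0)"
    unfolding c_def has_vector_derivative_def
    by (auto intro!: derivative_eq_intros simp: scaleR_conv_of_real)
  have "bounded_linear (\<lambda>d. d *s x)"
    by (rule linear_conv_bounded_linear[THEN iffD1], rule linearI) (simp_all add: vec_eq_iff algebra_simps)
  from bounded_linear.has_vector_derivative[OF this c]
  have g: "((\<lambda>t. c t *s x) has_derivative (\<lambda>h. h *\<^sub>R (- a *s x))) (at 0)"
    by (simp add: has_vector_derivative_def)
  have c00: "c 0 *s x = x" by (simp add: c_def)
  let ?f = "\<lambda>y. \<omega> y ws"
  have f: "(?f has_derivative frechet_derivative ?f (at x)) (at (c 0 *s x))"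
    unfolding c00 using diff by (simp add: frechet_derivative_works)
  from has_derivative_compose[OF g f]
  have L: "((\<lambda>t. \<omega> (c t *s x) ws) has_vector_derivative - frechet_derivative ?f (at x) (a *s x)) (at 0)"
    unfolding has_vector_derivative_def
    using linear_cmul[OF linear_frechet_derivative[OF diff]] linear_neg[OF linear_frechet_derivative[OF diff]]
    by (simp add: vec.scale_minus_left)
  have "((\<lambda>t. \<omega> x ([] @ map (\<lambda>w. w + t *\<^sub>R (a *s w)) ws)) has_vector_derivative
      (\<Sum>i<length ws. \<omega> x ([] @ take i ws @ a *s (ws ! i) # drop (Suc i) ws))) (at 0)"
    by (rule has_vector_derivative_alternating[OF alt])
  moreover have "(\<Sum>i<length ws. \<omega> x ([] @ take i ws @ a *s (ws ! i) # drop (Suc i) ws)) =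
      alt_sum (\<lambda>w us. \<omega> x (a *s w # us)) ws"
    unfolding alt_sum_def alternating_move[OF alt] by (simp add: remove_nth_def)
  ultimately have R: "((\<lambda>t. \<omega> x (map (\<lambda>w. w + t *\<^sub>R (a *s w)) ws)) has_vector_derivative
      alt_sum (\<lambda>w us. \<omega> x (a *s w # us)) ws) (at 0)" by simp
  have ev: "\<forall>\<^sub>F t in nhds 0. \<omega> x (map (\<lambda>w. w + t *\<^sub>R (a *s w)) ws) = \<omega> (c t *s x) ws"
    using c0
  proof eventually_elim
    case (elim t)
    have "c t \<noteq> 0" using elim by (simp add: c_def)
    have "map ((*s) (c t)) (map (\<lambda>w. w + t *\<^sub>R (a *s w)) ws) = ws"
    proof -
      have "c t *s (w + t *\<^sub>R (a *s w)) = w" for w :: "complex^'a"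
      proof -
        have "w + t *\<^sub>R (a *s w) = (1 + of_real t * a) *s w"
          by (simp add: vec_eq_iff scaleR_conv_of_real[where 'a=complex] algebra_simps)
        then have "c t *s (w + t *\<^sub>R (a *s w)) = (c t * (1 + of_real t * a)) *s w"
          by (simp only: vec.scale_scale)
        also have "c t * (1 + of_real t * a) = 1" using elim by (simp add: c_def)
        finally show ?thesis by simp
      qed
      then show ?thesis by (simp add: o_def)
    qed
    with basic_formD(2)[OF \<omega> \<open>c t \<noteq> 0\<close>, of x "map (\<lambda>w. w + t *\<^sub>R (a *s w)) ws"] show ?case by simp
  qed
  have "((\<lambda>t. \<omega> (c t *s x) ws) has_vector_derivative
      alt_sum (\<lambda>w us. \<omega> x (a *s w # us)) ws) (at 0)"
  proof (rule has_vector_derivative_cong_ev[THEN iffD1, OF _ _ R])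
    show "\<forall>\<^sub>F t in nhds 0. t \<in> UNIV \<longrightarrow> \<omega> x (map (\<lambda>w. w + t *\<^sub>R (a *s w)) ws) = \<omega> (c t *s x) ws"
      using ev by simp
    show "\<omega> x (map (\<lambda>w. w + 0 *\<^sub>R (a *s w)) ws) = \<omega> (c 0 *s x) ws"
      by (rule eventually_nhds_x_imp_x[OF ev])
  qed
  then have "- frechet_derivative ?f (at x) (a *s x) = alt_sum (\<lambda>w us. \<omega> x (a *s w # us)) ws"
    by (rule vector_derivative_unique_at[OF L])
  from this[symmetric] show ?thesis by simp
qed

text \<open>This keeps \<open>ddc\<close> of a form on the projective space there. Invariance is the
  chain rule for a dilation; for a vertical argument \<open>a *s x\<close>, the derivative in its
  direction cancels against the terms that contract the form with it.\<close>

lemma basic_form_dolbeault: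
  assumes \<omega>: "basic_form k \<omega>"
  shows "basic_form (Suc k) (dolbeault \<sigma> \<omega>)"
  unfolding basic_form_def
proof (intro conjI allI impI)
  show s: "smooth_form (Suc k) (dolbeault \<sigma> \<omega>)" by (rule smooth_form_dolbeault[OF basic_formD(1)[OF \<omega>]])
  note diff = smooth_formD(4)[OF basic_formD(1)[OF \<omega>]]
  fix x :: "complex^'a" and vs :: "(complex^'a) list"
  {
    fix c :: complex assume c: "c \<noteq> 0"
    show "dolbeault \<sigma> \<omega> (c *s x) (map ((*s) c) vs) = dolbeault \<sigma> \<omega> x vs"
    proof (cases "x = 0")
      case False
      have D: "frechet_derivative (\<lambda>y. \<omega> y (map ((*s) c) ws)) (at (c *s x)) (c *s v) =
          frechet_derivative (\<lambda>y. \<omega> y ws) (at x) v" for ws v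
      proof -
        have bl: "bounded_linear (\<lambda>y. (1 / c) *s (y :: complex^'a))"
          by (rule linear_conv_bounded_linear[THEN iffD1], rule linearI) (simp_all add: vec_eq_iff algebra_simps)
        have x: "(1 / c) *s (c *s x) = x" using c by simp
        have "((\<lambda>y. \<omega> y ws) has_derivative frechet_derivative (\<lambda>y. \<omega> y ws) (at x)) (at ((1 / c) *s (c *s x)))"
          unfolding x using diff[OF False] by (simp add: frechet_derivative_works)
        from has_derivative_compose[OF bounded_linear_imp_has_derivative[OF bl] this]
        have "((\<lambda>y. \<omega> ((1 / c) *s y) ws) has_derivative
            (\<lambda>v. frechet_derivative (\<lambda>y. \<omega> y ws) (at x) ((1 / c) *s v))) (at (c *s x))" .
        moreover have "\<omega> ((1 / c) *s y) ws = \<omega> y (map ((*s) c) ws)" for y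
          using basic_formD(2)[OF \<omega> c, of "(1 / c) *s y" ws] c by simp
        ultimately show ?thesis using c by (simp add: frechet_eq)
      qed
      have i: "\<i> *s (c *s v) = c *s (\<i> *s v)" for v :: "complex^'a" by (simp add: vec_eq_iff)
      have "wirtinger \<sigma> (\<lambda>y. \<omega> y (map ((*s) c) ws)) (c *s x) (c *s v) = wirtinger \<sigma> (\<lambda>y. \<omega> y ws) x v" for v ws
        unfolding wirtinger_def i D ..
      then show ?thesis using False c by (simp add: dolbeault_def alt_sum_def remove_nth_map)
    qed (simp add: dolbeault_def)
  }
  {
    fix a :: complex assume a: "a *s x \<in> set vs"
    show "dolbeault \<sigma> \<omega> x vs = 0"
    proof (cases "x = 0")
      case False
      obtain us ws where vs: "vs = us @ a *s x # ws" using a by (meson split_list)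
      have "wirtinger \<sigma> (\<lambda>y. \<omega> y ws) x (a *s x) =
          alt_sum (\<lambda>w us. wirtinger \<sigma> (\<lambda>y. \<omega> y (a *s x # us)) x w) ws" for ws
      proof -
        have "alt_sum (\<lambda>w us. wirtinger \<sigma> (\<lambda>y. \<omega> y (a *s x # us)) x w) ws =
            alt_sum (\<lambda>w us. (- 1 / 2) * \<omega> x (a *s w # us) + (\<sigma> * \<i> / 2) * \<omega> x ((\<i> * a) *s w # us)) ws"
          by (rule alt_sum_cong) (simp add: wirtinger_def basic_form_contraction_deriv[OF \<omega> False] mult.commute)
        also have "\<dots> = wirtinger \<sigma> (\<lambda>y. \<omega> y ws) x (a *s x)"
          unfolding alt_sum_add alt_sum_cmult
          by (simp add: wirtinger_def basic_form_euler_deriv[OF \<omega> False] add_divide_distrib)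
        finally show ?thesis ..
      qed
      then have "dolbeault \<sigma> \<omega> x (a *s x # us @ ws) = 0"
        using False by (simp add: dolbeault_def alt_sum_Cons)
      then show ?thesis
        using alternating_move[OF smooth_formD(1)[OF s], of x "[]" us "a *s x" ws] by (simp add: vs)
    qed (simp add: dolbeault_def)
  }
qed

lemma basic_form_lincomb:
  assumes "basic_form k \<omega>" "basic_form k \<eta>"
  shows "basic_form k (\<lambda>x vs. c * \<omega> x vs + \<eta> x vs)"
  unfolding basic_form_def
  by (auto simp: smooth_form_lincomb basic_formD(1)[OF assms(1)] basic_formD(1)[OF assms(2)]
      basic_formD(2)[OF assms(1)] basic_formD(2)[OF assms(2)] basic_formD(3)[OF assms(1)] basic_formD(3)[OF assms(2)])

section \<open>The Poincare--Lelong formula\<close>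

lemma integrable_compact_support:
  fixes f :: "'a::euclidean_space \<Rightarrow> complex"
  assumes "continuous_on UNIV f" "compact K" "\<And>x. x \<notin> K \<Longrightarrow> f x = 0"
  shows "integrable lborel f"
proof -
  have "integrable lborel (\<lambda>x. indicator K x *\<^sub>R f x)"
    by (rule borel_integrable_compact[OF assms(2) continuous_on_subset[OF assms(1)]]) simp
  moreover have "(\<lambda>x. indicator K x *\<^sub>R f x) = f"
    using assms(3) by (auto split: split_indicator)
  ultimately show ?thesis by simp
qed

lemma bounded_compact_support:
  fixes f :: "'a::euclidean_space \<Rightarrow> complex"
  assumes "continuous_on UNIV f" "compact K" "\<And>x. x \<notin> K \<Longrightarrow> f x = 0"
  shows "\<exists>M>0. \<forall>x. norm (f x) \<le> M"
proof -
  have "bounded (f ` K)"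
    by (intro compact_imp_bounded compact_continuous_image continuous_on_subset[OF assms(1)] assms(2)) simp
  then obtain M where M: "M > 0" "\<And>x. x \<in> K \<Longrightarrow> norm (f x) \<le> M"
    unfolding bounded_pos by auto
  then have "norm (f x) \<le> M" for x using assms(3)[of x] by (cases "x \<in> K") auto
  with M(1) show ?thesis by blast
qed

lemma integral_translate:
  fixes f :: "'a::euclidean_space \<Rightarrow> complex"
  assumes [measurable]: "f \<in> borel_measurable borel"
  shows "(LINT x|lborel. f (c + x)) = (LINT x|lborel. f x)"
    and "integrable lborel f \<Longrightarrow> integrable lborel (\<lambda>x. f (c + x))"
proof -
  show "(LINT x|lborel. f (c + x)) = (LINT x|lborel. f x)"
    by (subst (2) lborel_distr_plus[of c, symmetric], subst integral_distr) auto
  show "integrable lborel (\<lambda>x. f (c + x))" if "integrable lborel f"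
    using that by (subst (asm) lborel_distr_plus[of c, symmetric]) (simp add: integrable_distr_eq)
qed

text \<open>Difference quotients along \<open>v\<close> integrate to zero by translation invariance;
  the mean value theorem bounds them uniformly, so dominated convergence passes to the
  derivative.\<close>

lemma integral_directional_derivative_eq_0:
  fixes f :: "'a::euclidean_space \<Rightarrow> complex"
  assumes der: "\<And>x. (f has_derivative D x) (at x)" and cont: "continuous_on UNIV (\<lambda>x. D x v)"
    and K: "compact K" "\<And>x. x \<notin> K \<Longrightarrow> f x = 0"
  shows "(LINT x|lborel. D x v) = 0"
proof -
  have D0: "D x v = 0" if "x \<notin> K" for x
  proof -
    have "((\<lambda>x. 0) has_derivative D x) (at x)"
      by (rule has_derivative_transform_within_open[OF der, of "- K"])
         (use that K in \<open>auto intro: compact_imp_closed\<close>)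
    from has_derivative_unique[OF this has_derivative_const] show ?thesis by (simp add: fun_eq_iff)
  qed
  obtain M where M: "M > 0" "\<And>x. norm (D x v) \<le> M"
    using bounded_compact_support[OF cont K(1) D0] by auto
  have contf: "continuous_on UNIV f"
    using has_derivative_continuous[OF der] by (simp add: continuous_at_imp_continuous_on)
  then have [measurable]: "f \<in> borel_measurable borel" by (rule borel_measurable_continuous_onI)
  have intf: "integrable lborel f" by (rule integrable_compact_support[OF contf K])
  define t where "t n = 1 / real (Suc n)" for n
  have t: "t n > 0" "t n \<le> 1" for n by (auto simp: t_def)
  define s where "s n x = (f (t n *\<^sub>R v + x) - f x) / of_real (t n)" for n x
  \<comment> \<open>All points \<open>x\<close> such that \<open>x + r *\<^sub>R v\<close> lies in
    \<open>K\<close> for some \<open>r\<close> between \<open>0\<close> and \<open>1\<close>; as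
    \<open>t n \<le> 1\<close>, every quotient \<open>s n\<close> vanishes off this compact
    set.\<close>
  define K' where "K' = (\<lambda>(x, r). x - r *\<^sub>R v) ` (K \<times> {0..1::real})"
  have K': "compact K'"
    unfolding K'_def by (intro compact_continuous_image compact_Times K compact_Icc)
      (auto simp: case_prod_beta intro!: continuous_intros)
  have line: "((\<lambda>r. f (x + r *\<^sub>R v)) has_derivative (\<lambda>h. h *\<^sub>R D (x + r *\<^sub>R v) v)) (at r)" for x r
  proof -
    have "((\<lambda>r. x + r *\<^sub>R v) has_derivative (\<lambda>h. h *\<^sub>R v)) (at r)"
      by (auto intro!: derivative_eq_intros)
    from has_derivative_compose[OF this der] show ?thesis
      using linear_cmul[OF has_derivative_linear[OF der]] by simp
  qed
  have bound: "norm (s n x) \<le> M * indicator K' x" for n x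
  proof (cases "x \<in> K'")
    case True
    have "\<exists>r\<in>{0<..<t n}. norm (f (x + t n *\<^sub>R v) - f (x + 0 *\<^sub>R v)) \<le> norm ((t n - 0) *\<^sub>R D (x + r *\<^sub>R v) v)"
    proof (rule mvt_general[OF t(1)])
      show "continuous_on {0..t n} (\<lambda>r. f (x + r *\<^sub>R v))"
        by (rule continuous_on_compose2[OF contf]) (auto intro!: continuous_intros)
    qed (rule line)
    then obtain r where "norm (f (x + t n *\<^sub>R v) - f x) \<le> t n * norm (D (x + r *\<^sub>R v) v)"
      using t(1)[of n] by auto
    also have "\<dots> \<le> t n * M" using t(1)[of n] M by (intro mult_left_mono) auto
    finally show ?thesis using True t(1)[of n] by (simp add: s_def norm_divide divide_simps add.commute mult.commute)
  next
    case False
    have "x + r *\<^sub>R v \<notin> K" if "0 \<le> r" "r \<le> 1" for r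
    proof
      assume "x + r *\<^sub>R v \<in> K"
      then have "(\<lambda>(x, r). x - r *\<^sub>R v) (x + r *\<^sub>R v, r) \<in> K'"
        unfolding K'_def using that by (intro imageI) auto
      then show False using False by simp
    qed
    from this[of 0] this[of "t n"] show ?thesis
      using False K(2) t[of n] by (simp add: s_def add.commute less_imp_le)
  qed
  have lim: "(\<lambda>n. s n x) \<longlonglongrightarrow> D x v" for x
  proof -
    have "((\<lambda>r. f (x + r *\<^sub>R v)) has_vector_derivative D x v) (at 0)"
      using line[of x 0] by (simp add: has_vector_derivative_def)
    then have "(\<lambda>h. norm (f (x + (0 + h) *\<^sub>R v) - f (x + 0 *\<^sub>R v) - h *\<^sub>R D x v) / norm h) \<midarrow>0\<rightarrow> 0"
      unfolding has_vector_derivative_def has_derivative_at by blast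
    then have "(\<lambda>h. norm ((f (x + h *\<^sub>R v) - f x - h *\<^sub>R D x v) /\<^sub>R h)) \<midarrow>0\<rightarrow> 0"
      by (simp add: divide_inverse mult.commute)
    then have "(\<lambda>h. (f (x + h *\<^sub>R v) - f x - h *\<^sub>R D x v) /\<^sub>R h) \<midarrow>0\<rightarrow> 0"
      by (rule tendsto_norm_zero_cancel)
    then have "(\<lambda>h. (f (x + h *\<^sub>R v) - f x) /\<^sub>R h - D x v) \<midarrow>0\<rightarrow> 0"
      by (rule Lim_transform_eventually) (auto simp: eventually_at_filter scaleR_diff_right)
    then have "(\<lambda>h. (f (x + h *\<^sub>R v) - f x) /\<^sub>R h) \<midarrow>0\<rightarrow> D x v"
      by (rule LIM_zero_cancel)
    moreover have "filterlim t (at 0) sequentially"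
    proof (rule filterlim_atI)
      show "t \<longlonglongrightarrow> 0" unfolding t_def using LIMSEQ_inverse_real_of_nat by (simp add: inverse_eq_divide)
    qed (use t(1) in \<open>auto intro!: always_eventually simp: less_imp_neq[symmetric]\<close>)
    ultimately have "(\<lambda>n. (f (x + t n *\<^sub>R v) - f x) /\<^sub>R t n) \<longlonglongrightarrow> D x v"
      by (rule filterlim_compose)
    then show ?thesis
      by (simp add: s_def add.commute scaleR_conv_of_real[where 'a=complex] divide_inverse mult.commute)
  qed
  have "(\<lambda>n. LINT x|lborel. s n x) \<longlonglongrightarrow> (LINT x|lborel. D x v)"
  proof (rule integral_dominated_convergence[where w = "\<lambda>x. M * indicator K' x"])
    show "integrable lborel (\<lambda>x. M * indicator K' x)"
      using K' by (intro integrable_mult_right integrable_real_indicator)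
        (use emeasure_compact_finite[OF K'] in \<open>auto intro: compact_imp_closed borel_closed\<close>)
    show "(\<lambda>x. D x v) \<in> borel_measurable lborel"
      using borel_measurable_continuous_onI[OF cont] by simp
    show "s n \<in> borel_measurable lborel" for n unfolding s_def by measurable
  qed (use lim bound in auto)
  moreover have "(LINT x|lborel. s n x) = 0" for n
    unfolding s_def using intf integral_translate[of f "t n *\<^sub>R v"] by simp
  ultimately show ?thesis by (simp add: LIMSEQ_const_iff)
qed

lemma integral_wirtinger_eq_0:
  assumes g: "Ck_on (Suc 0) UNIV g" and K: "compact K" "\<And>x. x \<notin> K \<Longrightarrow> g x = 0"
  shows "integrable lborel (\<lambda>x. wirtinger \<sigma> g x v)" "(LINT x|lborel. wirtinger \<sigma> g x v) = 0"
proof -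
  have der: "(g has_derivative frechet_derivative g (at x)) (at x)" for x
    using g by (simp add: frechet_derivative_works)
  have cont: "continuous_on UNIV (\<lambda>x. frechet_derivative g (at x) v)" for v using g by simp
  have 0: "frechet_derivative g (at x) v = 0" if "x \<notin> K" for x v
    using frechet_derivative_cong_open[of "- K" x g "\<lambda>_. 0"] that K compact_imp_closed[OF K(1)]
    by (simp add: open_Compl frechet_derivative_const)
  have I: "integrable lborel (\<lambda>x. frechet_derivative g (at x) v)" for v
    by (rule integrable_compact_support[OF cont K(1) 0])
  show "integrable lborel (\<lambda>x. wirtinger \<sigma> g x v)" unfolding wirtinger_def using I by auto
  show "(LINT x|lborel. wirtinger \<sigma> g x v) = 0"
    unfolding wirtinger_def using I integral_directional_derivative_eq_0[OF der cont K] by simp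
qed

lemma wirtinger_continuous:
  assumes "Ck_on (Suc 0) UNIV g"
  shows "continuous_on UNIV (\<lambda>x. wirtinger \<sigma> g x v)"
  using assms unfolding wirtinger_def by (auto intro!: continuous_intros)

lemma wirtinger_support:
  assumes "closed K" "\<And>x. x \<notin> K \<Longrightarrow> g x = 0" "x \<notin> K"
  shows "wirtinger \<sigma> g x v = 0"
  using wirtinger_cong_open[of "- K" x g "\<lambda>_. 0"] assms by auto

lemma integral_wirtinger_by_parts:
  assumes Q: "Ck_on (Suc 0) UNIV Q" and g: "Ck_on (Suc 0) UNIV g"
    and K: "compact K" "\<And>x. x \<notin> K \<Longrightarrow> g x = 0"
  shows "integrable lborel (\<lambda>x. Q x * wirtinger \<sigma> g x v)" "integrable lborel (\<lambda>x. wirtinger \<sigma> Q x v * g x)"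
    and "(LINT x|lborel. Q x * wirtinger \<sigma> g x v) = - (LINT x|lborel. wirtinger \<sigma> Q x v * g x)"
proof -
  have c: "continuous_on UNIV Q" "continuous_on UNIV g"
    using Ck_on_lower[OF Q] Ck_on_lower[OF g] by simp_all
  have Qg: "Ck_on (Suc 0) UNIV (\<lambda>x. Q x * g x)"
    by (rule Ck_on_bilinear[OF bounded_bilinear_mult open_UNIV Q g])
  show 1: "integrable lborel (\<lambda>x. Q x * wirtinger \<sigma> g x v)"
    by (rule integrable_compact_support[OF _ K(1)])
       (use wirtinger_support[OF compact_imp_closed[OF K(1)] K(2)] wirtinger_continuous[OF g] c
         in \<open>auto intro!: continuous_intros\<close>)
  show 2: "integrable lborel (\<lambda>x. wirtinger \<sigma> Q x v * g x)"
    by (rule integrable_compact_support[OF _ K(1)])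
       (use K(2) wirtinger_continuous[OF Q] c in \<open>auto intro!: continuous_intros\<close>)
  have "wirtinger \<sigma> (\<lambda>x. Q x * g x) x v = Q x * wirtinger \<sigma> g x v + wirtinger \<sigma> Q x v * g x" for x
    using Q g by (intro wirtinger_mult) auto
  moreover have "(LINT x|lborel. wirtinger \<sigma> (\<lambda>x. Q x * g x) x v) = 0"
    by (rule integral_wirtinger_eq_0[OF Qg K(1)]) (simp add: K)
  ultimately show "(LINT x|lborel. Q x * wirtinger \<sigma> g x v) = - (LINT x|lborel. wirtinger \<sigma> Q x v * g x)"
    using 1 2 by (simp add: eq_neg_iff_add_eq_0)
qed

lemma smooth_form_smooth_UNIV:
  assumes "smooth_form k \<omega>" "compact K" "0 \<notin> K" "\<And>x. x \<notin> K \<Longrightarrow> \<omega> x = (\<lambda>vs. 0)"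
  shows "smooth_on UNIV (\<lambda>x. \<omega> x vs)"
  by (rule smooth_on_extend_0[OF smooth_formD(2)[OF assms(1)] compact_imp_closed[OF assms(2)]])
     (use assms in auto)

text \<open>Partial integration of each coefficient, the vectors being constant. It takes the place
  of Stokes' formula: the integrand on the right is minus the wedge of the derivative of
  \<open>Q\<close> with \<open>\<beta>\<close>.\<close>

lemma integral_dolbeault_by_parts:
  assumes \<beta>: "smooth_form k \<beta>" and K: "compact K" "0 \<notin> K" "\<And>x. x \<notin> K \<Longrightarrow> \<beta> x = (\<lambda>vs. 0)"
    and Q: "Ck_on (Suc 0) UNIV Q"
  shows "(LINT y|lborel. Q y * dolbeault \<sigma> \<beta> y vs) = alt_sum (\<lambda>v us. - (LINT y|lborel. wirtinger \<sigma> Q y v * \<beta> y us)) vs"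
proof -
  have s: "Ck_on (Suc 0) UNIV (\<lambda>x. \<beta> x us)" for us
    using smooth_form_smooth_UNIV[OF \<beta> K] unfolding smooth_on_def by blast
  have K0: "x \<notin> K \<Longrightarrow> \<beta> x us = 0" for x us using K(3) by simp
  have "Q y * dolbeault \<sigma> \<beta> y vs = (\<Sum>i<length vs. (- 1) ^ i *
      (Q y * wirtinger \<sigma> (\<lambda>y. \<beta> y (remove_nth i vs)) y (vs ! i)))" for y
  \<comment> \<open>By convention \<open>dolbeault\<close> is zero at the origin; the derivatives
    vanish there too, because \<open>K\<close> is closed and omits it.\<close>
  proof (cases "y = 0")
    case True
    then show ?thesis
      using wirtinger_support[OF compact_imp_closed[OF K(1)] K0 K(2)] by (simp add: dolbeault_def)
  next
    case False
    then show ?thesis by (simp add: dolbeault_def alt_sum_def sum_distrib_left mult.left_commute)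
  qed
  then have "(LINT y|lborel. Q y * dolbeault \<sigma> \<beta> y vs) = (\<Sum>i<length vs. (- 1) ^ i *
      (LINT y|lborel. Q y * wirtinger \<sigma> (\<lambda>y. \<beta> y (remove_nth i vs)) y (vs ! i)))"
    by (simp add: Bochner_Integration.integral_sum integral_wirtinger_by_parts(1)[OF Q s K(1) K0])
  then show ?thesis
    by (simp add: alt_sum_def integral_wirtinger_by_parts(3)[OF Q s K(1) K0])
qed

definition linear_form :: "(complex^'n \<Rightarrow> complex) \<Rightarrow> bool" where
  "linear_form s \<longleftrightarrow> (\<forall>x y. s (x + y) = s x + s y) \<and> (\<forall>c x. s (c *s x) = c * s x)"

lemma linear_formD:
  assumes "linear_form s"
  shows "s (x + y) = s x + s y" "s (c *s x) = c * s x" "s (r *\<^sub>R x) = of_real r * s x"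
    "s 0 = 0" "s (x - y) = s x - s y"
proof -
  show 1: "s (x + y) = s x + s y" "s (c *s x) = c * s x" for x y c
    using assms by (auto simp: linear_form_def)
  have "r *\<^sub>R x = of_real r *s x" by (simp add: vec_eq_iff scaleR_conv_of_real[where 'a=complex])
  then show "s (r *\<^sub>R x) = of_real r * s x" using 1 by simp
  show "s 0 = 0" using 1(1)[of 0 0] by simp
  show "s (x - y) = s x - s y" using 1(1)[of "x - y" y] by simp
qed

lemma linear_form_bounded_linear:
  fixes s :: "complex^'n::finite \<Rightarrow> complex"
  assumes "linear_form s"
  shows "bounded_linear s"
  by (rule linear_conv_bounded_linear[THEN iffD1], rule linearI)
     (simp_all add: linear_formD[OF assms] scaleR_conv_of_real[where 'a=complex])

lemma linear_form_lin_comb: "linear_form s \<Longrightarrow> s (lin_comb bs z) = (\<Sum>i<length bs. z i * s (bs ! i))"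
proof -
  assume s: "linear_form s"
  have "s (\<Sum>i\<in>I. f i) = (\<Sum>i\<in>I. s (f i))" for f and I :: "nat set"
    by (induction I rule: infinite_finite_induct) (auto simp: linear_formD[OF s])
  then show ?thesis unfolding lin_comb_def by (simp add: linear_formD[OF s])
qed

section \<open>The regularised logarithm of a linear form\<close>

context
  fixes s :: "complex^'n::finite \<Rightarrow> complex" and \<epsilon> :: real
  assumes s: "linear_form s" and \<epsilon>: "\<epsilon> > 0"
begin

lemma regularized_pos: "(norm (s x))\<^sup>2 + \<epsilon> > 0"
  using \<epsilon> by (simp add: add_nonneg_pos)

lemma regularized_nonzero: "(complex_of_real (norm (s x)))\<^sup>2 + of_real \<epsilon> \<noteq> 0"
  using regularized_pos[of x]
  by (metis less_irrefl of_real_add of_real_eq_0_iff of_real_power)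

lemma has_derivative_linear_form: "(s has_derivative s) (at x)"
  by (rule bounded_linear_imp_has_derivative[OF linear_form_bounded_linear[OF s]])

lemma has_derivative_norm_square_linear_form:
  "((\<lambda>x. (norm (s x))\<^sup>2 + \<epsilon>) has_derivative (\<lambda>v. 2 * Re (cnj (s x) * s v))) (at x)"
proof -
  note d = bounded_linear.has_derivative[OF bounded_linear_Re has_derivative_linear_form[of x]]
    bounded_linear.has_derivative[OF bounded_linear_Im has_derivative_linear_form[of x]]
  have "((\<lambda>x. (Re (s x))\<^sup>2 + (Im (s x))\<^sup>2 + \<epsilon>) has_derivative (\<lambda>v. 2 * Re (cnj (s x) * s v))) (at x)"
    by (rule derivative_eq_intros d refl)+ (simp add: algebra_simps)
  then show ?thesis by (simp add: cmod_power2)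
qed

lemma continuous_linear_form: "continuous_on UNIV s"
  by (rule linear_continuous_on[OF linear_form_bounded_linear[OF s]])

lemma regularized_log:
  "Ck_on (Suc 0) UNIV (\<lambda>x. complex_of_real (ln ((norm (s x))\<^sup>2 + \<epsilon>)))"
  "wirtinger 1 (\<lambda>x. complex_of_real (ln ((norm (s x))\<^sup>2 + \<epsilon>))) x v =
     s v * (cnj (s x) / of_real ((norm (s x))\<^sup>2 + \<epsilon>))"
proof -
  have D: "((\<lambda>x. complex_of_real (ln ((norm (s x))\<^sup>2 + \<epsilon>))) has_derivative
      (\<lambda>v. of_real (2 * Re (cnj (s x) * s v) / ((norm (s x))\<^sup>2 + \<epsilon>)))) (at x)" for x
    by (rule has_derivative_of_real)
       (use has_derivative_ln[OF regularized_pos[of x] has_derivative_norm_square_linear_form] in \<open>simp add: divide_inverse\<close>)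
  show "Ck_on (Suc 0) UNIV (\<lambda>x. complex_of_real (ln ((norm (s x))\<^sup>2 + \<epsilon>)))"
    by (rule Ck_on_SucI[OF open_UNIV D])
       (use regularized_pos in \<open>auto intro!: continuous_intros continuous_linear_form simp: less_imp_neq[symmetric] regularized_nonzero\<close>)
  show "wirtinger 1 (\<lambda>x. complex_of_real (ln ((norm (s x))\<^sup>2 + \<epsilon>))) x v =
     s v * (cnj (s x) / of_real ((norm (s x))\<^sup>2 + \<epsilon>))"
    unfolding wirtinger_has_derivative[OF D]
    by (simp add: complex_eq_iff linear_formD[OF s] divide_simps) (simp add: algebra_simps)
qed

text \<open>With \<open>q\<close> the denominator, the two terms of the product rule combine to
  \<open>1/q - (q - \<epsilon>)/q^2\<close>, which leaves the kernel
  \<open>\<epsilon>/q^2\<close>.\<close>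

lemma regularized_log_deriv:
  "Ck_on (Suc 0) UNIV (\<lambda>x. cnj (s x) / of_real ((norm (s x))\<^sup>2 + \<epsilon>))"
  "wirtinger (- 1) (\<lambda>x. cnj (s x) / of_real ((norm (s x))\<^sup>2 + \<epsilon>)) x v =
     cnj (s v) * of_real (\<epsilon> / ((norm (s x))\<^sup>2 + \<epsilon>)\<^sup>2)"
proof -
  define q where "q x = (norm (s x))\<^sup>2 + \<epsilon>" for x
  have q: "q x > 0" for x using regularized_pos by (simp add: q_def)
  have D: "((\<lambda>x. cnj (s x) * of_real (inverse (q x))) has_derivative
      (\<lambda>v. cnj (s x) * of_real (- (inverse (q x) * (2 * Re (cnj (s x) * s v)) * inverse (q x))) +
        cnj (s v) * of_real (inverse (q x)))) (at x)" for x
  proof (rule has_derivative_mult)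
    show "((\<lambda>x. cnj (s x)) has_derivative (\<lambda>v. cnj (s v))) (at x)"
      by (rule bounded_linear.has_derivative[OF bounded_linear_cnj has_derivative_linear_form])
    show "((\<lambda>x. complex_of_real (inverse (q x))) has_derivative
        (\<lambda>v. of_real (- (inverse (q x) * (2 * Re (cnj (s x) * s v)) * inverse (q x))))) (at x)"
      by (rule has_derivative_of_real, rule Deriv.has_derivative_inverse)
         (use q[of x] has_derivative_norm_square_linear_form[of x] in \<open>auto simp: q_def\<close>)
  qed
  have e: "(\<lambda>x. cnj (s x) / of_real ((norm (s x))\<^sup>2 + \<epsilon>)) = (\<lambda>x. cnj (s x) * of_real (inverse (q x)))"
    by (simp add: q_def divide_inverse)
  show "Ck_on (Suc 0) UNIV (\<lambda>x. cnj (s x) / of_real ((norm (s x))\<^sup>2 + \<epsilon>))"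
    unfolding e
    by (rule Ck_on_SucI[OF open_UNIV D])
       (use q in \<open>auto intro!: continuous_intros continuous_linear_form simp: q_def less_imp_neq[symmetric] regularized_nonzero\<close>)
  have "wirtinger (- 1) (\<lambda>x. cnj (s x) * of_real (inverse (q x))) x v =
      cnj (s v) * of_real (inverse (q x)) - cnj (s v) * (s x * cnj (s x)) * of_real (inverse (q x) ^ 2)"
    unfolding wirtinger_has_derivative[OF D]
    by (simp add: complex_eq_iff linear_formD[OF s] power2_eq_square) (simp add: field_simps)
  also have "s x * cnj (s x) = of_real (q x - \<epsilon>)" using complex_norm_square[of "s x"] by (simp add: q_def)
  also have "cnj (s v) * of_real (inverse (q x)) - cnj (s v) * of_real (q x - \<epsilon>) * of_real (inverse (q x) ^ 2) =
      cnj (s v) * of_real (inverse (q x) - (q x - \<epsilon>) * inverse (q x) ^ 2)"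
    by (simp add: algebra_simps)
  also have "inverse (q x) - (q x - \<epsilon>) * inverse (q x) ^ 2 = \<epsilon> / (q x)\<^sup>2"
    using q[of x] by (simp add: field_simps power2_eq_square)
  finally show "wirtinger (- 1) (\<lambda>x. cnj (s x) / of_real ((norm (s x))\<^sup>2 + \<epsilon>)) x v =
     cnj (s v) * of_real (\<epsilon> / ((norm (s x))\<^sup>2 + \<epsilon>)\<^sup>2)"
    unfolding e by (simp add: q_def)
qed

text \<open>The factor \<open>\<epsilon> / (\<bar>s\<bar>\<^sup>2 + \<epsilon>)\<^sup>2\<close> tends to \<open>\<pi>\<close> times the Dirac measure of the hyperplane \<open>s = 0\<close>.\<close>

lemma regularized_poincare_lelong:
  assumes \<eta>: "smooth_form k \<eta>" and K: "compact K" "0 \<notin> K" "\<And>x. x \<notin> K \<Longrightarrow> \<eta> x = (\<lambda>vs. 0)"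
    and e: "s e = 1" and ws: "\<And>w. w \<in> set ws \<Longrightarrow> s w = 0"
  shows "(LINT y|lborel. of_real (ln ((norm (s y))\<^sup>2 + \<epsilon>)) * dolbeault 1 (dolbeault (- 1) \<eta>) y (e # (\<i> *s e) # ws)) =
    - 2 * \<i> * (LINT y|lborel. of_real (\<epsilon> / ((norm (s y))\<^sup>2 + \<epsilon>)\<^sup>2) * \<eta> y ws)"
proof -
  let ?F2 = "\<lambda>x. cnj (s x) / of_real ((norm (s x))\<^sup>2 + \<epsilon>)"
  define J where "J us = (LINT y|lborel. ?F2 y * dolbeault (- 1) \<eta> y us)" for us
  define I where "I us = (LINT y|lborel. of_real (\<epsilon> / ((norm (s y))\<^sup>2 + \<epsilon>)\<^sup>2) * \<eta> y us)" for us
  have K': "x \<notin> K \<Longrightarrow> dolbeault (- 1) \<eta> x = (\<lambda>vs. 0)" for x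
    by (rule dolbeault_eq_0[OF compact_imp_closed[OF K(1)] K(3)])
  have wsr: "w \<in> set (remove_nth i ws) \<Longrightarrow> s w = 0" for w i using ws set_remove_nth by fast
  have "(LINT y|lborel. of_real (ln ((norm (s y))\<^sup>2 + \<epsilon>)) * dolbeault 1 (dolbeault (- 1) \<eta>) y (e # (\<i> *s e) # ws)) =
      alt_sum (\<lambda>v us. - (LINT y|lborel. wirtinger 1 (\<lambda>x. complex_of_real (ln ((norm (s x))\<^sup>2 + \<epsilon>))) y v *
        dolbeault (- 1) \<eta> y us)) (e # (\<i> *s e) # ws)"
    by (rule integral_dolbeault_by_parts[OF smooth_form_dolbeault[OF \<eta>] K(1,2) K' regularized_log(1)])
  also have "\<dots> = alt_sum (\<lambda>v us. - (s v * J us)) (e # (\<i> *s e) # ws)"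
    unfolding regularized_log(2) J_def
    by (simp only: mult.assoc Bochner_Integration.integral_mult_right_zero)
  \<comment> \<open>Only the directions \<open>e\<close> and \<open>\<i> *s e\<close> survive, since
    \<open>s\<close> vanishes on \<open>ws\<close>.\<close>
  also have "\<dots> = - J ((\<i> *s e) # ws) + \<i> * J (e # ws)"
  proof -
    have "alt_sum (\<lambda>v us. s v * J (e # (\<i> *s e) # us)) ws = 0"
      by (rule alt_sum_eq_0) (simp add: ws)
    then show ?thesis
      using alt_sum_cmult[of "- 1" "\<lambda>v us. s v * J (e # (\<i> *s e) # us)" ws]
      by (simp add: alt_sum_Cons e linear_formD[OF s])
  qed
  finally have start: "(LINT y|lborel. of_real (ln ((norm (s y))\<^sup>2 + \<epsilon>)) * dolbeault 1 (dolbeault (- 1) \<eta>) y (e # (\<i> *s e) # ws)) =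
      - J ((\<i> *s e) # ws) + \<i> * J (e # ws)" .
  have J: "J (v # ws) = - (cnj (s v) * I ws)" for v
  proof -
    have "J (v # ws) = alt_sum (\<lambda>v us. - (LINT y|lborel. wirtinger (- 1) ?F2 y v * \<eta> y us)) (v # ws)"
      unfolding J_def by (rule integral_dolbeault_by_parts[OF \<eta> K regularized_log_deriv(1)])
    also have "\<dots> = alt_sum (\<lambda>v us. - (cnj (s v) * I us)) (v # ws)"
      unfolding regularized_log_deriv(2) I_def
      by (simp only: mult.assoc Bochner_Integration.integral_mult_right_zero)
    finally have "J (v # ws) = alt_sum (\<lambda>v us. - (cnj (s v) * I us)) (v # ws)" .
    moreover have "alt_sum (\<lambda>w us. - (cnj (s w) * I (v # us))) ws = 0"
      by (rule alt_sum_eq_0) (simp add: ws)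
    ultimately show ?thesis by (simp add: alt_sum_Cons)
  qed
  \<comment> \<open>Both summands equal \<open>- \<i> * I ws\<close>; the factor of
    \<open>ddc\<close> turns their sum into \<open>I ws\<close> divided by
    \<open>pi\<close>.\<close>
  note start also have "- J ((\<i> *s e) # ws) + \<i> * J (e # ws) = - 2 * \<i> * I ws"
    unfolding J by (simp add: e linear_formD[OF s])
  finally show ?thesis unfolding I_def .
qed

end

section \<open>Product measures and coordinates with respect to a basis\<close>

lemma integral_mult_left_commute:
  fixes f g :: "'a \<Rightarrow> complex"
  shows "(LINT y|M. f y * (c * g y)) = c * (LINT y|M. f y * g y)"
  unfolding mult.left_commute[of _ c] by simp

lemma integral_complex_mult:
  fixes g :: "complex \<Rightarrow> complex"
  assumes [measurable]: "g \<in> borel_measurable borel" and a: "a \<noteq> 0"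
  shows "of_real ((norm a)\<^sup>2) * (LINT z|lborel. g (a * z)) = (LINT z|lborel. g z)"
    and "integrable lborel (\<lambda>z. g (a * z)) \<longleftrightarrow> integrable lborel g"
proof -
  let ?M = "density (distr lborel borel (\<lambda>z. a * z)) (\<lambda>_. ennreal ((norm a)\<^sup>2))"
  have M: "lborel = ?M"
  proof (rule measure_eqI)
    fix X :: "complex set" assume "X \<in> sets lborel"
    then have [measurable]: "X \<in> sets borel" by simp
    have "emeasure ?M X = ennreal ((norm a)\<^sup>2) * (\<integral>\<^sup>+y. indicator X y \<partial>distr lborel borel (\<lambda>z. a * z))"
      by (subst emeasure_density, simp, simp, subst nn_integral_cmult) auto
    also have "\<dots> = (\<integral>\<^sup>+y. indicator X y \<partial>lborel)"
      using nn_integral_complex_mult[of "indicator X" a] a by (subst nn_integral_distr) auto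
    finally show "emeasure lborel X = emeasure ?M X" by simp
  qed simp
  have I: "integrable lborel (\<lambda>z. (norm a)\<^sup>2 *\<^sub>R g (a * z)) \<longleftrightarrow> integrable lborel (\<lambda>z. g (a * z))"
    using integrable_scaleR_right[of "1 / (norm a)\<^sup>2" lborel "\<lambda>z. (norm a)\<^sup>2 *\<^sub>R g (a * z)"] a
    by (auto intro: integrable_scaleR_right)
  show "of_real ((norm a)\<^sup>2) * (LINT z|lborel. g (a * z)) = (LINT z|lborel. g z)"
    by (subst (2) M) (simp add: integral_density integral_distr scaleR_conv_of_real[where 'a=complex])
  show "integrable lborel (\<lambda>z. g (a * z)) \<longleftrightarrow> integrable lborel g"
    by (subst (2) M) (simp add: integrable_density integrable_distr_eq I)
qed

lemma measurable_cvol_update [measurable]: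
  "(\<lambda>(x, y). x(m := y)) \<in> measurable (cvol m \<Otimes>\<^sub>M lborel) (cvol (Suc m))"
  using measurable_add_dim[of m "{..<m}" "\<lambda>_. lborel :: complex measure"] by (simp add: lessThan_Suc)

lemma cvol_Suc: "cvol (Suc m) = distr (cvol m \<Otimes>\<^sub>M lborel) (cvol (Suc m)) (\<lambda>(x, y). x(m := y))"
proof (rule measure_eqI)
  fix X assume X [measurable]: "X \<in> sets (cvol (Suc m))"
  have "emeasure (cvol (Suc m)) X = (\<integral>\<^sup>+x. indicator X x \<partial>cvol (Suc m))" by simp
  also have "\<dots> = (\<integral>\<^sup>+x. \<integral>\<^sup>+y. indicator X (x(m := y)) \<partial>lborel \<partial>cvol m)"
    unfolding lessThan_Suc by (rule cvol.product_nn_integral_insert) (auto simp flip: lessThan_Suc)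
  also have "\<dots> = (\<integral>\<^sup>+p. indicator X (case p of (x, y) \<Rightarrow> x(m := y)) \<partial>(cvol m \<Otimes>\<^sub>M lborel))"
    by (subst lborel.nn_integral_fst[symmetric]) auto
  also have "\<dots> = (\<integral>\<^sup>+z. indicator X z \<partial>distr (cvol m \<Otimes>\<^sub>M lborel) (cvol (Suc m)) (\<lambda>(x, y). x(m := y)))"
    by (subst nn_integral_distr) auto
  finally show "emeasure (cvol (Suc m)) X =
      emeasure (distr (cvol m \<Otimes>\<^sub>M lborel) (cvol (Suc m)) (\<lambda>(x, y). x(m := y))) X" by simp
qed simp

lemma pair_sigma_finite_cvol: "pair_sigma_finite (cvol m) (lborel :: complex measure)"
  by (intro pair_sigma_finite.intro cvol.sigma_finite lborel.sigma_finite_measure_axioms) simp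

lemma lin_comb_update_snoc: "lin_comb (cs @ [b]) (x(length cs := y)) = lin_comb cs x + y *s b"
  unfolding lin_comb_snoc by (simp add: lin_comb_def)

lemma integral_cvol_snoc:
  fixes g :: "complex^'n \<Rightarrow> complex"
  assumes [measurable]: "g \<in> borel_measurable borel" and m: "length cs = m"
  shows "integrable (cvol (Suc m)) (\<lambda>z. g (lin_comb (cs @ [b]) z)) \<longleftrightarrow>
      integrable (cvol m \<Otimes>\<^sub>M lborel) (\<lambda>p. g (lin_comb cs (fst p) + snd p *s b))"
    and "(LINT z|cvol (Suc m). g (lin_comb (cs @ [b]) z)) =
      (LINT p|(cvol m \<Otimes>\<^sub>M lborel). g (lin_comb cs (fst p) + snd p *s b))"
proof -
  have [measurable]: "lin_comb (cs @ [b]) \<in> borel_measurable (cvol (Suc m))"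
    by (rule measurable_lin_comb) (simp add: m)
  have e: "(\<lambda>p. g (lin_comb (cs @ [b]) (case p of (x, y) \<Rightarrow> x(m := y)))) = (\<lambda>p. g (lin_comb cs (fst p) + snd p *s b))"
    by (auto simp: lin_comb_update_snoc simp flip: m)
  show "integrable (cvol (Suc m)) (\<lambda>z. g (lin_comb (cs @ [b]) z)) \<longleftrightarrow>
      integrable (cvol m \<Otimes>\<^sub>M lborel) (\<lambda>p. g (lin_comb cs (fst p) + snd p *s b))"
    by (subst cvol_Suc, subst integrable_distr_eq) (simp_all add: e)
  show "(LINT z|cvol (Suc m). g (lin_comb (cs @ [b]) z)) =
      (LINT p|(cvol m \<Otimes>\<^sub>M lborel). g (lin_comb cs (fst p) + snd p *s b))"
    by (subst cvol_Suc, subst integral_distr) (simp_all add: e)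
qed

text \<open>Coordinates are linear in the vector by uniqueness, hence bounded. A compact set of
  vectors therefore lies in a box of coordinates, which has finite measure.\<close>

lemma is_basis_coordinate_bound:
  fixes bs :: "(complex^'n::finite) list"
  assumes bs: "is_basis UNIV bs"
  obtains C where "C > 0" "\<And>z i. i < length bs \<Longrightarrow> norm (z i) \<le> C * norm (lin_comb bs z)"
proof -
  define \<phi> where "\<phi> v = (SOME z. v = lin_comb bs z)" for v
  have \<phi>: "v = lin_comb bs (\<phi> v)" for v
    unfolding \<phi>_def using is_basis_lin_comb(3)[OF bs UNIV_I] by (rule someI_ex)
  have uniq: "z i = w i" if "lin_comb bs z = lin_comb bs w" "i < length bs" for z w i
  proof -
    have "lin_comb bs (\<lambda>i. - 1 * w i + z i) = 0" unfolding lin_comb_linear using that by simp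
    from is_basis_lin_comb(1)[OF bs this that(2)] show ?thesis by simp
  qed
  have "\<exists>C>0. \<forall>v. norm (\<phi> v i) \<le> C * norm v" if i: "i < length bs" for i
  proof -
    have "linear (\<lambda>v. \<phi> v i)"
    proof (rule linearI)
      fix v w :: "complex^'n" and r :: real
      have "lin_comb bs (\<phi> (v + w)) = lin_comb bs (\<lambda>i. 1 * \<phi> v i + \<phi> w i)"
        unfolding lin_comb_linear using \<phi> by simp
      from uniq[OF this i] show "\<phi> (v + w) i = \<phi> v i + \<phi> w i" by simp
      have "lin_comb bs (\<phi> (r *\<^sub>R v)) = lin_comb bs (\<lambda>i. of_real r * \<phi> v i + 0)"
        unfolding lin_comb_linear using \<phi>[of v] \<phi>[of "r *\<^sub>R v"]
        by (simp add: lin_comb_def) (simp add: vec_eq_iff scaleR_conv_of_real[where 'a=complex])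
      from uniq[OF this i] show "\<phi> (r *\<^sub>R v) i = r *\<^sub>R \<phi> v i"
        by (simp add: scaleR_conv_of_real[where 'a=complex])
    qed
    then have "bounded_linear (\<lambda>v. \<phi> v i)" by (simp add: linear_conv_bounded_linear)
    from bounded_linear.pos_bounded[OF this] show ?thesis by (metis mult.commute)
  qed
  then obtain c where c: "\<And>i. i < length bs \<Longrightarrow> c i > 0" "\<And>i v. i < length bs \<Longrightarrow> norm (\<phi> v i) \<le> c i * norm v"
    by metis
  let ?C = "1 + (\<Sum>i<length bs. c i)"
  have le: "c i \<le> ?C" if "i < length bs" for i
    using that c(1) member_le_sum[of i "{..<length bs}" c] by (force intro: less_imp_le)
  show ?thesis
  proof (rule that)
    have "0 \<le> (\<Sum>i<length bs. c i)" by (intro sum_nonneg less_imp_le c(1)) simp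
    then show "?C > 0" by simp
    fix z i assume i: "i < length bs"
    have "z i = \<phi> (lin_comb bs z) i" by (rule uniq[OF \<phi> i])
    then have "norm (z i) \<le> c i * norm (lin_comb bs z)" using c(2)[OF i] by metis
    also have "\<dots> \<le> ?C * norm (lin_comb bs z)" by (rule mult_right_mono[OF le[OF i]]) simp
    finally show "norm (z i) \<le> ?C * norm (lin_comb bs z)" .
  qed
qed

lemma is_basis_coordinate_bound_compact:
  fixes bs :: "(complex^'n::finite) list"
  assumes bs: "is_basis UNIV bs" and K: "compact K"
  obtains R where "R > 0" "\<And>z i. lin_comb bs z \<in> K \<Longrightarrow> i < length bs \<Longrightarrow> norm (z i) \<le> R"
proof -
  obtain C where C: "C > 0" "\<And>z i. i < length bs \<Longrightarrow> norm (z i) \<le> C * norm (lin_comb bs z)"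
    by (rule is_basis_coordinate_bound[OF bs]) blast
  obtain B where B: "B > 0" "\<And>x. x \<in> K \<Longrightarrow> norm x \<le> B"
    using compact_imp_bounded[OF K] unfolding bounded_pos by auto
  show ?thesis
  proof (rule that[of "C * B"])
    fix z i assume "lin_comb bs z \<in> K" "i < length bs"
    then have "norm (z i) \<le> C * norm (lin_comb bs z)" "norm (lin_comb bs z) \<le> B" using C B by auto
    with C(1) show "norm (z i) \<le> C * B" by (meson mult_left_mono less_imp_le order_trans)
  qed (use B C in simp)
qed

lemma measurable_cvol_box: "{x \<in> space (cvol m). \<forall>i<m. norm (x i) \<le> (R::real)} \<in> sets (cvol m)"
  by measurable

lemma emeasure_cvol_box: "emeasure (cvol m) {x \<in> space (cvol m). \<forall>i<m. norm (x i) \<le> R} < \<infinity>"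
proof -
  have e: "{x \<in> space (cvol m). \<forall>i<m. norm (x i) \<le> R} = (\<Pi>\<^sub>E i\<in>{..<m}. cball 0 R)"
    by (intro set_eqI) (simp add: space_PiM PiE_iff Ball_def conj_commute)
  have "emeasure (cvol m) {x \<in> space (cvol m). \<forall>i<m. norm (x i) \<le> R} = emeasure lborel (cball (0::complex) R) ^ m"
    unfolding e by (subst cvol.emeasure_PiM) auto
  moreover have "c ^ m < \<infinity>" if "c < \<infinity>" for c :: ennreal
    using that by (induction m) (auto simp: ennreal_mult_less_top)
  ultimately show ?thesis
    using emeasure_compact_finite[OF compact_cball, of "0::complex" R] by simp
qed

text \<open>The coordinates of a point of \<open>\<complex>\<^sup>N\<^sup>+\<^sup>1\<close> are adapted to the hyperplane \<open>s = 0\<close>: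
  the last one is the value of \<open>s\<close>.\<close>

context
  fixes s :: "complex^'n::finite \<Rightarrow> complex" and cs e m
  assumes s: "linear_form s" and basis: "is_basis UNIV (cs @ [e])" and m: "length cs = m"
    and se: "s e = 1" and scs: "\<And>c. c \<in> set cs \<Longrightarrow> s c = 0"
begin

lemma card_eq: "CARD('n) = Suc m"
  using is_basis_length[OF basis] m by simp

lemma s_adapted: "s (lin_comb cs x + y *s e) = y"
  by (simp add: linear_formD[OF s] se scs linear_form_lin_comb[OF s] m)

lemma s_adapted_snoc: "s (lin_comb (cs @ [e]) z) = z m"
  using s_adapted[of z "z m"] by (simp add: lin_comb_snoc m)

lemma measurable_linear_form [measurable]: "s \<in> borel_measurable borel"
  by (rule borel_measurable_continuous_onI[OF linear_continuous_on[OF linear_form_bounded_linear[OF s]]])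

text \<open>In adapted coordinates the integrand is dominated by a product of functions of one
  complex variable: the logarithm on a disc in the last coordinate, the indicator of a disc in every
  other one.\<close>

lemma integrable_ln_linear_form:
  assumes K: "compact K"
  shows "integrable lborel (\<lambda>y. ln ((norm (s y))\<^sup>2) * indicator K y)"
proof (rule integrableI_bounded)
  have [measurable]: "K \<in> sets borel" using K by (simp add: borel_compact)
  then show "(\<lambda>y. ln ((norm (s y))\<^sup>2) * indicator K y) \<in> borel_measurable lborel" by simp
  obtain \<kappa> :: real where \<kappa>: "\<kappa> > 0"
    "\<And>f. f \<in> borel_measurable borel \<Longrightarrow>
      ennreal \<kappa> * (\<integral>\<^sup>+z. f (lin_comb (cs @ [e]) z) \<partial>cvol CARD('n)) = (\<integral>\<^sup>+y. f y \<partial>lborel)"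
    by (rule basis_jacobian[OF basis]) blast
  obtain R where R: "R > 0" "\<And>z i. lin_comb (cs @ [e]) z \<in> K \<Longrightarrow> i < length (cs @ [e]) \<Longrightarrow> norm (z i) \<le> R"
    by (rule is_basis_coordinate_bound_compact[OF basis K]) blast
  define f where "f i (y::complex) =
      (if i = m then ennreal \<bar>ln ((norm y)\<^sup>2)\<bar> * indicator {z. (norm z)\<^sup>2 \<le> R\<^sup>2} y else indicator (cball 0 R) y)" for i y
  have [measurable]: "cball (0::complex) R \<in> sets borel" by simp
  have [measurable]: "f i \<in> borel_measurable borel" for i by (cases "i = m") (simp_all add: f_def[abs_def])
  have "(\<integral>\<^sup>+y. ennreal (norm (ln ((norm (s y))\<^sup>2) * indicator K y)) \<partial>lborel) =
      ennreal \<kappa> * (\<integral>\<^sup>+z. ennreal (norm (ln ((norm (s (lin_comb (cs @ [e]) z)))\<^sup>2) * indicator K (lin_comb (cs @ [e]) z))) \<partial>cvol (Suc m))"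
    by (subst \<kappa>(2)[symmetric]) (auto simp: card_eq)
  also have "\<dots> \<le> ennreal \<kappa> * (\<integral>\<^sup>+z. (\<Prod>i<Suc m. f i (z i)) \<partial>cvol (Suc m))"
  proof (intro mult_left_mono nn_integral_mono)
    fix z
    show "ennreal (norm (ln ((norm (s (lin_comb (cs @ [e]) z)))\<^sup>2) * indicator K (lin_comb (cs @ [e]) z))) \<le>
        (\<Prod>i<Suc m. f i (z i))"
    proof (cases "lin_comb (cs @ [e]) z \<in> K")
      case True
      then have z: "norm (z i) \<le> R" if "i < Suc m" for i using R(2) m that by simp
      have "(\<Prod>i<m. f i (z i)) = 1" by (rule prod.neutral) (use z in \<open>auto simp: f_def\<close>)
      moreover have "(norm (z m))\<^sup>2 \<le> R\<^sup>2" using z[of m] by (intro power_mono) auto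
      ultimately show ?thesis using True by (simp add: s_adapted_snoc f_def)
    qed simp
  qed simp
  also have "\<dots> = ennreal \<kappa> * (\<Prod>i<Suc m. \<integral>\<^sup>+y. f i y \<partial>lborel)"
    by (subst cvol.product_nn_integral_prod) auto
  also have "\<dots> < \<infinity>"
  proof -
    have "(\<integral>\<^sup>+y. f i y \<partial>lborel) < \<infinity>" for i
      using nn_integral_ln_norm_square[of "R\<^sup>2"] emeasure_compact_finite[OF compact_cball, of "0::complex" R]
      by (cases "i = m") (auto simp: f_def)
    then have "(\<Prod>i<k. \<integral>\<^sup>+y. f i y \<partial>lborel) < \<infinity>" for k
      by (induction k) (auto simp: ennreal_mult_less_top)
    from this[of "Suc m"] have "(\<Prod>i<Suc m. \<integral>\<^sup>+y. f i y \<partial>lborel) < \<infinity>" .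
    then show ?thesis by (simp add: ennreal_mult_less_top)
  qed
  finally show "(\<integral>\<^sup>+y. ennreal (norm (ln ((norm (s y))\<^sup>2) * indicator K y)) \<partial>lborel) < \<infinity>" .
qed

lemma integrable_ln_mult:
  assumes K: "compact K" and g: "continuous_on UNIV g" "\<And>y. y \<notin> K \<Longrightarrow> g y = 0"
  shows "integrable lborel (\<lambda>y. complex_of_real (ln ((norm (s y))\<^sup>2)) * g y)"
proof -
  obtain M where M: "M > 0" "\<And>y. norm (g y) \<le> M"
    using bounded_compact_support[OF g(1) K g(2)] by auto
  have [measurable]: "g \<in> borel_measurable borel" by (rule borel_measurable_continuous_onI[OF g(1)])
  have "integrable lborel (\<lambda>y. M * (ln ((norm (s y))\<^sup>2) * indicator K y))"
    by (intro integrable_mult_right integrable_ln_linear_form K)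
  then show ?thesis
  proof (rule Bochner_Integration.integrable_bound)
    show "AE y in lborel. norm (complex_of_real (ln ((norm (s y))\<^sup>2)) * g y) \<le> norm (M * (ln ((norm (s y))\<^sup>2) * indicator K y))"
    proof (rule AE_I2)
      fix y
      show "norm (complex_of_real (ln ((norm (s y))\<^sup>2)) * g y) \<le> norm (M * (ln ((norm (s y))\<^sup>2) * indicator K y))"
        using M(1) M(2)[of y] g(2)[of y] mult_left_mono[OF M(2)[of y], of "\<bar>ln ((norm (s y))\<^sup>2)\<bar>"]
        by (cases "y \<in> K") (auto simp: norm_mult abs_mult mult.commute)
    qed
  qed simp
qed

lemma AE_linear_form_nonzero: "AE y in lborel. s y \<noteq> 0"
proof -
  obtain \<kappa> :: real where \<kappa>: "\<kappa> > 0"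
    "\<And>f. f \<in> borel_measurable borel \<Longrightarrow>
      ennreal \<kappa> * (\<integral>\<^sup>+z. f (lin_comb (cs @ [e]) z) \<partial>cvol CARD('n)) = (\<integral>\<^sup>+y. f y \<partial>lborel)"
    by (rule basis_jacobian[OF basis]) blast
  have "emeasure lborel {y. s y = 0} = (\<integral>\<^sup>+y. indicator {y. s y = 0} y \<partial>lborel)" by simp
  also have "\<dots> = ennreal \<kappa> * (\<integral>\<^sup>+z. indicator {0} (z m) \<partial>cvol (Suc m))"
    by (subst \<kappa>(2)[symmetric])
       (auto simp: card_eq s_adapted_snoc intro!: arg_cong2[where f="(*)"] nn_integral_cong split: split_indicator)
  also have "(\<integral>\<^sup>+z. indicator {0} (z m) \<partial>cvol (Suc m)) = (\<integral>\<^sup>+x. \<integral>\<^sup>+y. indicator {0} y \<partial>lborel \<partial>cvol m)"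
    unfolding lessThan_Suc by (subst cvol.product_nn_integral_insert) auto
  finally have "emeasure lborel {y. s y = 0} = 0" by simp
  then show ?thesis by (subst AE_iff_measurable[of "{y. s y = 0}"]) auto
qed

text \<open>The parameter is written as \<open>(d n)\<^sup>2\<close> so that substituting
  \<open>d n * y\<close> for the value of \<open>s\<close> turns the kernel into the fixed density
  \<open>w\<close> of mass \<open>pi\<close>. In the limit the point is pushed onto the
  hyperplane.\<close>

lemma regularized_delta_limit:
  fixes \<phi> :: "complex^'n \<Rightarrow> complex"
  assumes K: "compact K" and \<phi>: "continuous_on UNIV \<phi>" "\<And>y. y \<notin> K \<Longrightarrow> \<phi> y = 0"
    and \<kappa>: "\<And>g::complex^'n \<Rightarrow> complex. g \<in> borel_measurable borel \<Longrightarrow>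
        integrable (cvol CARD('n)) (\<lambda>z. g (lin_comb (cs @ [e]) z)) \<longleftrightarrow> integrable lborel g"
      "\<And>g::complex^'n \<Rightarrow> complex. g \<in> borel_measurable borel \<Longrightarrow>
        of_real \<kappa> * (LINT z|cvol CARD('n). g (lin_comb (cs @ [e]) z)) = (LINT y|lborel. g y)"
    and d: "\<And>n. d n > 0" "d \<longlonglongrightarrow> (0::real)"
  shows "(\<lambda>n. LINT y|lborel. of_real ((d n)\<^sup>2 / ((norm (s y))\<^sup>2 + (d n)\<^sup>2)\<^sup>2) * \<phi> y) \<longlonglongrightarrow>
    of_real (\<kappa> * pi) * (LINT x|cvol m. \<phi> (lin_comb cs x))"
proof -
  interpret P: pair_sigma_finite "cvol m" "lborel :: complex measure" by (rule pair_sigma_finite_cvol)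
  obtain M where M: "M > 0" "\<And>y. norm (\<phi> y) \<le> M"
    using bounded_compact_support[OF \<phi>(1) K \<phi>(2)] by auto
  have \<phi>m [measurable]: "\<phi> \<in> borel_measurable borel" by (rule borel_measurable_continuous_onI[OF \<phi>(1)])
  have lm [measurable]: "lin_comb cs \<in> borel_measurable (cvol m)" by (rule measurable_lin_comb[OF m])
  obtain R where R: "R > 0" "\<And>z i. lin_comb (cs @ [e]) z \<in> K \<Longrightarrow> i < length (cs @ [e]) \<Longrightarrow> norm (z i) \<le> R"
    by (rule is_basis_coordinate_bound_compact[OF basis K]) blast
  \<comment> \<open>A box containing the hyperplane coordinates of all points of \<open>K\<close>;
    it makes \<open>W\<close> an integrable majorant of every \<open>H n\<close>.\<close>
  define B where "B = {x \<in> space (cvol m). \<forall>i<m. norm (x i) \<le> R}"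
  have Bm [measurable]: "B \<in> sets (cvol m)" unfolding B_def by (rule measurable_cvol_box)
  have \<phi>0: "\<phi> (lin_comb cs x + y *s e) = 0" if "x \<notin> B" "x \<in> space (cvol m)" for x y
  proof (rule ccontr)
    assume "\<phi> (lin_comb cs x + y *s e) \<noteq> 0"
    then have inK: "lin_comb (cs @ [e]) (x(m := y)) \<in> K" using \<phi>(2) lin_comb_update_snoc[of cs e x y] m by auto
    have "norm (x i) \<le> R" if "i < m" for i using R(2)[OF inK, of i] that m by simp
    with that show False by (auto simp: B_def)
  qed
  define w where "w y = 1 / (1 + (norm y)\<^sup>2)\<^sup>2" for y :: complex
  have w0: "w y > 0" for y
    unfolding w_def by (intro divide_pos_pos zero_less_power add_pos_nonneg) simp_all
  have wm [measurable]: "w \<in> borel_measurable borel" unfolding w_def by measurable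
  have wI: "integrable lborel w" "(LINT y|lborel. w y) = pi"
    using nn_integral_fubini_study_density w0
    by (auto simp: w_def[abs_def] less_imp_le intro!: integrableI_nonneg integral_eq_nn_integral[THEN trans])
  define H where "H n p = complex_of_real (w (snd p)) * \<phi> (lin_comb cs (fst p) + (of_real (d n) * snd p) *s e)" for n and p :: "(nat \<Rightarrow> complex) \<times> complex"
  define L where "L p = complex_of_real (w (snd p)) * \<phi> (lin_comb cs (fst p))" for p :: "(nat \<Rightarrow> complex) \<times> complex"
  define W where "W p = M * (indicator B (fst p) * w (snd p))" for p :: "(nat \<Rightarrow> complex) \<times> complex"
  have Hm [measurable]: "H n \<in> borel_measurable (cvol m \<Otimes>\<^sub>M lborel)" for n unfolding H_def by measurable
  have Lm [measurable]: "L \<in> borel_measurable (cvol m \<Otimes>\<^sub>M lborel)" unfolding L_def by measurable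
  have W: "integrable (cvol m \<Otimes>\<^sub>M lborel) W"
  proof -
    have "(\<integral>\<^sup>+p. ennreal (indicator B (fst p) * w (snd p)) \<partial>(cvol m \<Otimes>\<^sub>M lborel)) =
        (\<integral>\<^sup>+x. \<integral>\<^sup>+y. ennreal (indicator B x * w y) \<partial>lborel \<partial>cvol m)"
      by (subst lborel.nn_integral_fst[symmetric]) auto
    also have "\<dots> = (\<integral>\<^sup>+x. ennreal pi * indicator B x \<partial>cvol m)"
      using nn_integral_fubini_study_density
      by (intro nn_integral_cong) (auto simp: w_def split: split_indicator)
    also have "\<dots> = ennreal pi * emeasure (cvol m) B" by (rule nn_integral_cmult_indicator) measurable
    also have "\<dots> < \<infinity>" using emeasure_cvol_box[of m R] by (simp add: B_def ennreal_mult_less_top)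
    finally have "integrable (cvol m \<Otimes>\<^sub>M lborel) (\<lambda>p. indicator B (fst p) * w (snd p))"
    proof (intro integrableI_nonneg AE_I2)
      show "(\<lambda>p. indicator B (fst p) * w (snd p)) \<in> borel_measurable (cvol m \<Otimes>\<^sub>M lborel)" by measurable
      show "0 \<le> indicator B (fst p) * w (snd p)" for p :: "(nat \<Rightarrow> complex) \<times> complex"
        using less_imp_le[OF w0] by simp
    qed
    then show ?thesis unfolding W_def by (rule integrable_mult_right)
  qed
  have HW: "norm (H n p) \<le> W p" if "p \<in> space (cvol m \<Otimes>\<^sub>M lborel)" for n p
    using that M(1) M(2)[of "lin_comb cs (fst p) + (of_real (d n) * snd p) *s e"] w0[of "snd p"]
      \<phi>0[of "fst p" "of_real (d n) * snd p"]
    by (cases "fst p \<in> B") (auto simp: H_def W_def norm_mult space_pair_measure mult.commute[of _ M] intro: mult_mono)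
  have Hint: "integrable (cvol m \<Otimes>\<^sub>M lborel) (H n)" for n
  proof (rule Bochner_Integration.integrable_bound[OF W Hm AE_I2])
    fix p assume "p \<in> space (cvol m \<Otimes>\<^sub>M (lborel :: complex measure))"
    from HW[OF this, of n] show "norm (H n p) \<le> norm (W p)" by simp
  qed
  have HL: "(\<lambda>n. H n p) \<longlonglongrightarrow> L p" for p
  proof -
    have "isCont \<phi> (lin_comb cs (fst p))" using \<phi>(1) by (simp add: continuous_on_eq_continuous_at)
    moreover have "(\<lambda>n. lin_comb cs (fst p) + (of_real (d n) * snd p) *s e) \<longlonglongrightarrow> lin_comb cs (fst p)"
    proof -
      have "continuous_on UNIV (\<lambda>t. lin_comb cs (fst p) + (of_real t * snd p) *s e)"
        by (intro continuous_intros)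
      then have "isCont (\<lambda>t. lin_comb cs (fst p) + (of_real t * snd p) *s e) 0"
        by (simp add: continuous_on_eq_continuous_at)
      from isCont_tendsto_compose[OF this d(2)]
      have "(\<lambda>n. lin_comb cs (fst p) + (of_real (d n) * snd p) *s e) \<longlonglongrightarrow> lin_comb cs (fst p) + (of_real 0 * snd p) *s e" .
      then show ?thesis by simp
    qed
    ultimately have "(\<lambda>n. \<phi> (lin_comb cs (fst p) + (of_real (d n) * snd p) *s e)) \<longlonglongrightarrow> \<phi> (lin_comb cs (fst p))"
      by (rule isCont_tendsto_compose)
    then show ?thesis unfolding H_def L_def by (intro tendsto_mult tendsto_const)
  qed
  have "(\<lambda>n. LINT p|(cvol m \<Otimes>\<^sub>M lborel). H n p) \<longlonglongrightarrow> (LINT p|(cvol m \<Otimes>\<^sub>M lborel). L p)"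
    by (rule integral_dominated_convergence[where w = W]) (auto intro!: W AE_I2 HW HL)
  moreover have "(LINT p|(cvol m \<Otimes>\<^sub>M lborel). L p) = of_real pi * (LINT x|cvol m. \<phi> (lin_comb cs x))"
  proof -
    have LW: "norm (L p) \<le> W p" if "p \<in> space (cvol m \<Otimes>\<^sub>M lborel)" for p
      by (rule LIMSEQ_le_const2[OF tendsto_norm[OF HL]]) (use HW[OF that] in auto)
    have "integrable (cvol m \<Otimes>\<^sub>M lborel) L"
    proof (rule Bochner_Integration.integrable_bound[OF W Lm AE_I2])
      fix p assume "p \<in> space (cvol m \<Otimes>\<^sub>M (lborel :: complex measure))"
      from LW[OF this] show "norm (L p) \<le> norm (W p)" by simp
    qed
    from P.integral_fst'[OF this] have "(LINT p|(cvol m \<Otimes>\<^sub>M lborel). L p) = (LINT x|cvol m. LINT y|lborel. L (x, y))" ..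
    also have "\<dots> = (LINT x|cvol m. of_real pi * \<phi> (lin_comb cs x))"
      by (simp add: L_def wI)
    finally show ?thesis by simp
  qed
  moreover have "(LINT y|lborel. of_real ((d n)\<^sup>2 / ((norm (s y))\<^sup>2 + (d n)\<^sup>2)\<^sup>2) * \<phi> y) =
      of_real \<kappa> * (LINT p|(cvol m \<Otimes>\<^sub>M lborel). H n p)" for n
  proof -
    define g where "g y = of_real ((d n)\<^sup>2 / ((norm (s y))\<^sup>2 + (d n)\<^sup>2)\<^sup>2) * \<phi> y" for y
    have pos: "(norm (s y))\<^sup>2 + (d n)\<^sup>2 \<noteq> 0" for y using d(1)[of n] by (simp add: add_nonneg_eq_0_iff)
    have gc: "continuous_on UNIV g"
      unfolding g_def using pos
      by (intro continuous_intros \<phi> linear_continuous_on linear_form_bounded_linear s) auto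
    have gm [measurable]: "g \<in> borel_measurable borel" by (rule borel_measurable_continuous_onI[OF gc])
    have gI: "integrable lborel g" by (rule integrable_compact_support[OF gc K]) (simp add: g_def \<phi>)
    let ?g = "\<lambda>p. g (lin_comb cs (fst p) + snd p *s e)"
    have gI': "integrable (cvol m \<Otimes>\<^sub>M lborel) ?g"
      using gI \<kappa>(1)[OF gm] integral_cvol_snoc(1)[OF gm m, of e] by (simp add: card_eq)
    have "(LINT y|lborel. g y) = of_real \<kappa> * (LINT p|(cvol m \<Otimes>\<^sub>M lborel). ?g p)"
      using \<kappa>(2)[OF gm] integral_cvol_snoc(2)[OF gm m, of e] by (simp add: card_eq)
    also have "(LINT p|(cvol m \<Otimes>\<^sub>M lborel). ?g p) = (LINT x|cvol m. LINT y|lborel. ?g (x, y))"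
      by (rule P.integral_fst'[OF gI', symmetric])
    also have "\<dots> = (LINT x|cvol m. LINT y|lborel. H n (x, y))"
    proof (rule Bochner_Integration.integral_cong[OF refl])
      fix x
      have [measurable]: "(\<lambda>y. g (lin_comb cs x + y *s e)) \<in> borel_measurable borel" by measurable
      have dn: "complex_of_real (d n) \<noteq> 0" using d(1)[of n] by simp
      have "(LINT y|lborel. g (lin_comb cs x + y *s e)) =
          of_real ((norm (complex_of_real (d n)))\<^sup>2) * (LINT y|lborel. g (lin_comb cs x + (of_real (d n) * y) *s e))"
        by (rule integral_complex_mult(1)[OF _ dn, symmetric]) measurable
      also have "\<dots> = (LINT y|lborel. of_real ((norm (complex_of_real (d n)))\<^sup>2) * g (lin_comb cs x + (of_real (d n) * y) *s e))"
        by simp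
      also have "\<dots> = (LINT y|lborel. H n (x, y))"
      proof (rule Bochner_Integration.integral_cong[OF refl])
        fix y
        \<comment> \<open>The Jacobian of the substitution and the numerator of the kernel together
          cancel the fourth power of \<open>d n\<close> in the denominator.\<close>
        have "(d n)\<^sup>2 * ((d n)\<^sup>2 / ((d n * norm y)\<^sup>2 + (d n)\<^sup>2)\<^sup>2) = w y"
        proof -
          have "(d n * norm y)\<^sup>2 + (d n)\<^sup>2 = (d n)\<^sup>2 * (1 + (norm y)\<^sup>2)"
            by (simp add: power_mult_distrib algebra_simps)
          then show ?thesis using d(1)[of n] by (simp add: w_def power_mult_distrib power2_eq_square)
        qed
        moreover have "norm (complex_of_real (d n)) = d n" "norm (complex_of_real (d n) * y) = d n * norm y"
          using d(1)[of n] by (simp_all add: norm_mult)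
        ultimately show "of_real ((norm (complex_of_real (d n)))\<^sup>2) * g (lin_comb cs x + (of_real (d n) * y) *s e) = H n (x, y)"
          unfolding g_def H_def s_adapted mult.assoc[symmetric] of_real_mult[symmetric] by simp
      qed
      finally show "(LINT y|lborel. ?g (x, y)) = (LINT y|lborel. H n (x, y))" by simp
    qed
    also have "\<dots> = (LINT p|(cvol m \<Otimes>\<^sub>M lborel). H n p)" by (rule P.integral_fst'[OF Hint])
    finally show ?thesis by (simp add: g_def)
  qed
  ultimately show ?thesis
    using tendsto_mult_left[of "\<lambda>n. LINT p|(cvol m \<Otimes>\<^sub>M lborel). H n p" "LINT p|(cvol m \<Otimes>\<^sub>M lborel). L p" sequentially "of_real \<kappa>"]
    by (simp add: mult.assoc)
qed

text \<open>The right side is an integral over the linear hyperplane \<open>s = 0\<close> in the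
  coordinates given by \<open>cs\<close>. The constant \<open>\<kappa>\<close> of the adapted basis
  enters once through the frame and once through the measure, and cancels.\<close>

lemma poincare_lelong:
  assumes \<eta>: "smooth_form (2 * m) \<eta>" and K: "compact K" "0 \<notin> K" "\<And>x. x \<notin> K \<Longrightarrow> \<eta> x = (\<lambda>vs. 0)"
  shows "integrable lborel (\<lambda>y. of_real (ln ((norm (s y))\<^sup>2)) * ddc \<eta> y (frame standard_basis))"
    and "(LINT y|lborel. of_real (ln ((norm (s y))\<^sup>2)) * ddc \<eta> y (frame standard_basis)) =
      (LINT x|cvol m. \<eta> (lin_comb cs x) (frame cs))"
proof -
  let ?D = "dolbeault 1 (dolbeault (- 1) \<eta>)"
  have D: "smooth_form (2 * CARD('n)) ?D" using smooth_form_dolbeault[OF smooth_form_dolbeault[OF \<eta>]] card_eq by simp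
  have D0: "x \<notin> K \<Longrightarrow> ?D x = (\<lambda>vs. 0)" for x
    by (intro dolbeault_eq_0[OF compact_imp_closed[OF K(1)]] K(3))
  have Dc: "continuous_on UNIV (\<lambda>y. ?D y vs)" for vs
    by (rule smooth_on_continuous_on[OF smooth_form_smooth_UNIV[OF D K(1,2) D0]])
  have \<eta>c: "continuous_on UNIV (\<lambda>y. \<eta> y vs)" for vs
    by (rule smooth_on_continuous_on[OF smooth_form_smooth_UNIV[OF \<eta> K]])
  have ddc: "ddc \<eta> y vs = \<i> / (2 * of_real pi) * ?D y vs" for y vs
    by (simp add: ddc_def del_eq_dolbeault delbar_eq_dolbeault)
  show "integrable lborel (\<lambda>y. of_real (ln ((norm (s y))\<^sup>2)) * ddc \<eta> y (frame standard_basis))"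
    by (rule integrable_ln_mult[OF K(1)]) (auto simp: ddc D0 intro!: continuous_intros Dc)
  obtain \<kappa> :: real where \<kappa>: "\<kappa> > 0"
    and jac: "\<And>D. alternating (2 * CARD('n)) D \<Longrightarrow> D (frame (cs @ [e])) = of_real \<kappa> * D (frame standard_basis)"
    and int: "\<And>g::complex^'n \<Rightarrow> complex. g \<in> borel_measurable borel \<Longrightarrow>
      integrable (cvol CARD('n)) (\<lambda>z. g (lin_comb (cs @ [e]) z)) \<longleftrightarrow> integrable lborel g"
      "\<And>g::complex^'n \<Rightarrow> complex. g \<in> borel_measurable borel \<Longrightarrow>
      of_real \<kappa> * (LINT z|cvol CARD('n). g (lin_comb (cs @ [e]) z)) = (LINT y|lborel. g y)"
    by (rule integral_basis[OF basis]) blast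
  have fr: "?D y (e # (\<i> *s e) # frame cs) = of_real \<kappa> * ?D y (frame standard_basis)" for y
    using jac[OF smooth_formD(1)[OF D], of y] alternating_frame_rotate[OF smooth_formD(1)[OF D], of y "[]" cs e] by simp
  define d where "d n = 1 / real (Suc n)" for n
  have d: "d n > 0" "d n \<le> 1" "d \<longlonglongrightarrow> 0" for n
    using LIMSEQ_inverse_real_of_nat by (auto simp: d_def[abs_def] inverse_eq_divide)
  let ?F = "\<lambda>n y. complex_of_real (ln ((norm (s y))\<^sup>2 + (d n)\<^sup>2)) * ?D y (e # (\<i> *s e) # frame cs)"
  let ?L = "\<lambda>y. complex_of_real (ln ((norm (s y))\<^sup>2)) * ?D y (e # (\<i> *s e) # frame cs)"
  have "(\<lambda>n. LINT y|lborel. ?F n y) \<longlonglongrightarrow> (LINT y|lborel. ?L y)"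
  proof (rule integral_dominated_convergence)
    let ?g = "\<lambda>y. of_real (norm (?D y (e # (\<i> *s e) # frame cs))) :: complex"
    \<comment> \<open>As \<open>0 < (d n)\<^sup>2 \<le> 1\<close>, the regularised logarithm lies
      between those for the parameters \<open>0\<close> and \<open>1\<close>; this yields a majorant
      that does not depend on \<open>n\<close>.\<close>
    let ?w = "\<lambda>y. norm (of_real (ln ((norm (s y))\<^sup>2)) * ?g y) + norm (of_real (ln ((norm (s y))\<^sup>2 + 1)) * ?g y)"
    have gc: "continuous_on UNIV ?g" by (intro continuous_intros Dc)
    have "continuous_on UNIV (\<lambda>y. complex_of_real (ln ((norm (s y))\<^sup>2 + 1)) * ?g y)"
      by (intro continuous_intros gc linear_continuous_on linear_form_bounded_linear s) (simp add: add_nonneg_eq_0_iff)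
    then have "integrable lborel (\<lambda>y. complex_of_real (ln ((norm (s y))\<^sup>2 + 1)) * ?g y)"
      by (rule integrable_compact_support[OF _ K(1)]) (simp add: D0)
    moreover have "integrable lborel (\<lambda>y. complex_of_real (ln ((norm (s y))\<^sup>2)) * ?g y)"
      by (rule integrable_ln_mult[OF K(1) gc]) (simp add: D0)
    ultimately show "integrable lborel ?w" by (intro Bochner_Integration.integrable_add integrable_norm)
    have [measurable]: "(\<lambda>y. ?D y (e # (\<i> *s e) # frame cs)) \<in> borel_measurable borel"
      by (rule borel_measurable_continuous_onI[OF Dc])
    show "?L \<in> borel_measurable lborel" "?F n \<in> borel_measurable lborel" for n by measurable
    show "AE y in lborel. (\<lambda>n. ?F n y) \<longlonglongrightarrow> ?L y"
      using AE_linear_form_nonzero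
    proof eventually_elim
      case (elim y)
      have "(\<lambda>n. ln ((norm (s y))\<^sup>2 + (d n)\<^sup>2)) \<longlonglongrightarrow> ln ((norm (s y))\<^sup>2 + 0\<^sup>2)"
        by (intro tendsto_ln tendsto_add tendsto_const tendsto_power d(3)) (use elim in auto)
      then show ?case by (intro tendsto_mult tendsto_const tendsto_of_real) simp
    qed
    show "AE y in lborel. norm (?F n y) \<le> ?w y" for n
      using AE_linear_form_nonzero
    proof eventually_elim
      case (elim y)
      have d1: "(d n)\<^sup>2 \<le> 1" using d(1,2)[of n] by (simp add: power_le_one)
      have "ln ((norm (s y))\<^sup>2) \<le> ln ((norm (s y))\<^sup>2 + (d n)\<^sup>2)" using elim by (subst ln_le_cancel_iff) (auto simp: add_pos_nonneg)
      moreover have "ln ((norm (s y))\<^sup>2 + (d n)\<^sup>2) \<le> ln ((norm (s y))\<^sup>2 + 1)"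
        using elim d1 by (subst ln_le_cancel_iff) (auto simp: add_pos_nonneg)
      ultimately have "\<bar>ln ((norm (s y))\<^sup>2 + (d n)\<^sup>2)\<bar> \<le> \<bar>ln ((norm (s y))\<^sup>2)\<bar> + \<bar>ln ((norm (s y))\<^sup>2 + 1)\<bar>" by linarith
      from mult_right_mono[OF this, of "norm (?D y (e # (\<i> *s e) # frame cs))"]
      show ?case by (simp add: norm_mult algebra_simps)
    qed
  qed
  moreover have "(LINT y|lborel. ?F n y) = - 2 * \<i> * (LINT y|lborel. of_real ((d n)\<^sup>2 / ((norm (s y))\<^sup>2 + (d n)\<^sup>2)\<^sup>2) * \<eta> y (frame cs))" for n
  proof (rule regularized_poincare_lelong[OF s _ \<eta> K se])
    fix w assume "w \<in> set (frame cs)"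
    then show "s w = 0" using scs by (auto simp: frame_def linear_formD[OF s])
  qed (use d(1)[of n] in simp)
  moreover have "(\<lambda>n. - 2 * \<i> * (LINT y|lborel. of_real ((d n)\<^sup>2 / ((norm (s y))\<^sup>2 + (d n)\<^sup>2)\<^sup>2) * \<eta> y (frame cs))) \<longlonglongrightarrow>
      - 2 * \<i> * (of_real (\<kappa> * pi) * (LINT x|cvol m. \<eta> (lin_comb cs x) (frame cs)))"
    by (rule tendsto_mult_left, rule regularized_delta_limit[OF K(1) \<eta>c _ int d(1,3)]) (simp_all add: K)
  ultimately have L: "(LINT y|lborel. ?L y) = - 2 * \<i> * (of_real (\<kappa> * pi) * (LINT x|cvol m. \<eta> (lin_comb cs x) (frame cs)))"
    using LIMSEQ_unique by simp
  have "of_real \<kappa> * (LINT y|lborel. of_real (ln ((norm (s y))\<^sup>2)) * ?D y (frame standard_basis)) =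
      (LINT y|lborel. ?L y)"
    unfolding fr by (rule integral_mult_left_commute[symmetric])
  also have "\<dots> = of_real \<kappa> * (- 2 * \<i> * of_real pi * (LINT x|cvol m. \<eta> (lin_comb cs x) (frame cs)))"
    unfolding L by simp
  finally have eq: "of_real \<kappa> * (LINT y|lborel. of_real (ln ((norm (s y))\<^sup>2)) * ?D y (frame standard_basis)) =
      of_real \<kappa> * (- 2 * \<i> * of_real pi * (LINT x|cvol m. \<eta> (lin_comb cs x) (frame cs)))" .
  have "complex_of_real \<kappa> \<noteq> 0" using \<kappa> by simp
  from mult_left_cancel[OF this, THEN iffD1, OF eq]
  have "(LINT y|lborel. of_real (ln ((norm (s y))\<^sup>2)) * ?D y (frame standard_basis)) =
      - 2 * \<i> * of_real pi * (LINT x|cvol m. \<eta> (lin_comb cs x) (frame cs))" .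
  then show "(LINT y|lborel. of_real (ln ((norm (s y))\<^sup>2)) * ddc \<eta> y (frame standard_basis)) =
      (LINT x|cvol m. \<eta> (lin_comb cs x) (frame cs))"
    unfolding ddc integral_mult_left_commute by simp
qed

end

section \<open>Integration over the fibres of the projection\<close>

lemma measurable_cvol_scale:
  "(\<lambda>(z, c). (\<lambda>i\<in>{..<m}. c * z i, c)) \<in> measurable (cvol m \<Otimes>\<^sub>M lborel) (cvol m \<Otimes>\<^sub>M (lborel :: complex measure))"
  by measurable

lemma cvol_scale:
  fixes c :: complex
  assumes c: "c \<noteq> 0"
  shows "cvol m = density (distr (cvol m) (cvol m) (\<lambda>z. \<lambda>i\<in>{..<m}. c * z i)) (\<lambda>_. ennreal (norm c ^ (2 * m)))"
    (is "_ = ?P")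
proof (rule cvol.PiM_eqI[symmetric])
  have meas [measurable]: "(\<lambda>z. \<lambda>i\<in>{..<m}. c * z i) \<in> measurable (cvol m) (cvol m)" by measurable
  fix A :: "nat \<Rightarrow> complex set" assume A: "\<And>i. i \<in> {..<m} \<Longrightarrow> A i \<in> sets lborel"
  have A' [measurable]: "A i \<in> sets borel" if "i < m" for i using A that by simp
  have E: "(\<Pi>\<^sub>E i\<in>{..<m}. A i) \<in> sets (cvol m)" using A by (intro sets_PiM_I_finite) auto
  have v: "(\<lambda>z. \<lambda>i\<in>{..<m}. c * z i) -` (\<Pi>\<^sub>E i\<in>{..<m}. A i) \<inter> space (cvol m) = (\<Pi>\<^sub>E i\<in>{..<m}. (\<lambda>z. c * z) -` A i)"
    by (auto simp: space_PiM PiE_iff)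
  have vm: "(\<lambda>z. c * z) -` A i \<in> sets lborel" if "i < m" for i
    using measurable_sets[OF _ A'[OF that], of "\<lambda>z. c * z" borel] by simp
  have "emeasure ?P (\<Pi>\<^sub>E i\<in>{..<m}. A i) =
      ennreal (norm c ^ (2 * m)) * emeasure (distr (cvol m) (cvol m) (\<lambda>z. \<lambda>i\<in>{..<m}. c * z i)) (\<Pi>\<^sub>E i\<in>{..<m}. A i)"
    using E by (subst emeasure_density) (auto simp: nn_integral_cmult_indicator)
  also have "\<dots> = ennreal (norm c ^ (2 * m)) * (\<Prod>i<m. emeasure lborel ((\<lambda>z. c * z) -` A i))"
    unfolding emeasure_distr[OF meas E] v using vm by (subst cvol.emeasure_PiM) auto
  also have "\<dots> = (\<Prod>i<m. ennreal ((norm c)\<^sup>2) * emeasure lborel ((\<lambda>z. c * z) -` A i))"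
    by (simp add: power_mult ennreal_power prod.distrib)
  also have "\<dots> = (\<Prod>i<m. emeasure lborel (A i))"
  proof (rule prod.cong[OF refl])
    fix i assume i: "i \<in> {..<m}"
    have "emeasure lborel ((\<lambda>z. c * z) -` A i) = (\<integral>\<^sup>+z. indicator (A i) (c * z) \<partial>lborel)"
    proof -
      have "(\<lambda>z. indicator (A i) (c * z) :: ennreal) = indicator ((\<lambda>z. c * z) -` A i)"
        by (auto simp: indicator_def)
      then show ?thesis using vm i by simp
    qed
    then show "ennreal ((norm c)\<^sup>2) * emeasure lborel ((\<lambda>z. c * z) -` A i) = emeasure lborel (A i)"
      using nn_integral_complex_mult[OF _ c, of "indicator (A i)"] i by simp
  qed
  finally show "emeasure ?P (\<Pi>\<^sub>E i\<in>{..<m}. A i) = (\<Prod>i\<in>{..<m}. emeasure lborel (A i))" .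
qed simp_all

text \<open>For fixed nonzero \<open>c\<close> the map scales each of \<open>m\<close> complex
  coordinates, with real Jacobian \<open>norm c ^ (2 * m)\<close>; the exceptional value
  \<open>c = 0\<close> is a null set.\<close>

lemma cvol_cone:
  "cvol m \<Otimes>\<^sub>M lborel = distr (density (cvol m \<Otimes>\<^sub>M lborel) (\<lambda>(z, c). ennreal (norm c ^ (2 * m))))
     (cvol m \<Otimes>\<^sub>M lborel) (\<lambda>(z, c). (\<lambda>i\<in>{..<m}. c * z i, c :: complex))" (is "?M = distr (density _ ?d) _ ?\<Psi>")
proof (rule measure_eqI)
  interpret P: pair_sigma_finite "cvol m" "lborel :: complex measure" by (rule pair_sigma_finite_cvol)
  fix X assume X [measurable]: "X \<in> sets ?M"
  have \<Psi>m: "?\<Psi> \<in> measurable (density ?M ?d) ?M" using measurable_cvol_scale by simp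
  have "emeasure ?M X = (\<integral>\<^sup>+c. \<integral>\<^sup>+z. indicator X (z, c) \<partial>cvol m \<partial>lborel)"
    using X by (subst P.nn_integral_snd) (auto simp: nn_integral_indicator)
  also have "\<dots> = (\<integral>\<^sup>+c. \<integral>\<^sup>+z. ?d (z, c) * indicator X (?\<Psi> (z, c)) \<partial>cvol m \<partial>lborel)"
  proof (rule nn_integral_cong_AE, rule AE_mp[OF AE_lborel_singleton[of "0::complex"]], rule AE_I2, rule impI)
    fix c :: complex assume c: "c \<noteq> 0"
    have [measurable]: "(\<lambda>z. indicator X (z, c) :: ennreal) \<in> borel_measurable (cvol m)" by measurable
    have [measurable]: "(\<lambda>z. \<lambda>i\<in>{..<m}. c * z i) \<in> measurable (cvol m) (cvol m)" by measurable
    show "(\<integral>\<^sup>+z. indicator X (z, c) \<partial>cvol m) = (\<integral>\<^sup>+z. ?d (z, c) * indicator X (?\<Psi> (z, c)) \<partial>cvol m)"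
      by (subst cvol_scale[OF c])
         (simp add: nn_integral_density nn_integral_distr nn_integral_cmult)
  qed
  also have "\<dots> = (\<integral>\<^sup>+p. ?d p * indicator X (?\<Psi> p) \<partial>?M)"
    by (subst P.nn_integral_snd) (auto simp: case_prod_beta)
  also have "\<dots> = (\<integral>\<^sup>+p. indicator X (?\<Psi> p) \<partial>density ?M ?d)"
    by (subst nn_integral_density) auto
  also have "\<dots> = (\<integral>\<^sup>+p. indicator X p \<partial>distr (density ?M ?d) ?M ?\<Psi>)"
    by (rule nn_integral_distr[OF \<Psi>m, symmetric]) measurable
  also have "\<dots> = emeasure (distr (density ?M ?d) ?M ?\<Psi>) X"
    using X by simp
  finally show "emeasure ?M X = emeasure (distr (density ?M ?d) ?M ?\<Psi>) X" .
qed simp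

lemma lin_comb_scale: "lin_comb cs (\<lambda>i\<in>{..<length cs}. c * z i) = c *s lin_comb cs z"
  unfolding lin_comb_def by (simp add: vec.scale_sum_right)

text \<open>The passage from linear coordinates to an affine chart and a fibre coordinate: with the
  first coordinates written as \<open>c * z\<close>, the point becomes
  \<open>c *s (b + lin_comb cs z)\<close>.\<close>

lemma integral_cone_coordinates:
  fixes g :: "complex^'n \<Rightarrow> complex"
  assumes g [measurable]: "g \<in> borel_measurable borel" and m: "length cs = m"
  shows "integrable (cvol m \<Otimes>\<^sub>M lborel) (\<lambda>p. g (lin_comb cs (fst p) + snd p *s b)) \<longleftrightarrow>
      integrable (cvol m \<Otimes>\<^sub>M lborel) (\<lambda>p. of_real (norm (snd p) ^ (2 * m)) * g (snd p *s (b + lin_comb cs (fst p))))"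
    and "(LINT p|(cvol m \<Otimes>\<^sub>M lborel). g (lin_comb cs (fst p) + snd p *s b)) =
      (LINT p|(cvol m \<Otimes>\<^sub>M lborel). of_real (norm (snd p) ^ (2 * m)) * g (snd p *s (b + lin_comb cs (fst p))))"
proof -
  let ?M = "cvol m \<Otimes>\<^sub>M (lborel :: complex measure)"
  let ?d = "\<lambda>(z, c). ennreal (norm c ^ (2 * m))" and ?\<Psi> = "\<lambda>(z, c). (\<lambda>i\<in>{..<m}. c * z i, c :: complex)"
  let ?G = "\<lambda>p. g (lin_comb cs (fst p) + snd p *s b)"
  have lm [measurable]: "lin_comb cs \<in> borel_measurable (cvol m)" by (rule measurable_lin_comb[OF m])
  have \<Psi>m: "?\<Psi> \<in> measurable (density ?M ?d) ?M" using measurable_cvol_scale by simp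
  have Gm [measurable]: "?G \<in> borel_measurable ?M" by measurable
  have e: "?G (?\<Psi> p) = g (snd p *s (b + lin_comb cs (fst p)))" for p :: "(nat \<Rightarrow> complex) \<times> complex"
    by (simp add: case_prod_beta lin_comb_scale vec.scale_right_distrib add.commute flip: m)
  have d: "?d = (\<lambda>p. ennreal (norm (snd p) ^ (2 * m)))" by auto
  have km: "(\<lambda>p. g (snd p *s (b + lin_comb cs (fst p)))) \<in> borel_measurable ?M" by measurable
  have "integrable ?M ?G \<longleftrightarrow> integrable (density ?M ?d) (\<lambda>p. ?G (?\<Psi> p))"
    by (subst cvol_cone, subst integrable_distr_eq[OF \<Psi>m Gm]) simp
  also have "\<dots> \<longleftrightarrow> integrable ?M (\<lambda>p. norm (snd p) ^ (2 * m) *\<^sub>R g (snd p *s (b + lin_comb cs (fst p))))"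
    unfolding e d using km by (subst integrable_density) auto
  finally show "integrable ?M ?G \<longleftrightarrow>
      integrable ?M (\<lambda>p. of_real (norm (snd p) ^ (2 * m)) * g (snd p *s (b + lin_comb cs (fst p))))"
    by (simp only: scaleR_conv_of_real)
  have "(LINT p|?M. ?G p) = (LINT p|density ?M ?d. ?G (?\<Psi> p))"
    by (subst cvol_cone, subst integral_distr[OF \<Psi>m Gm]) simp
  also have "\<dots> = (LINT p|?M. norm (snd p) ^ (2 * m) *\<^sub>R g (snd p *s (b + lin_comb cs (fst p))))"
    unfolding e d using km by (subst integral_density) auto
  finally show "(LINT p|?M. ?G p) =
      (LINT p|?M. of_real (norm (snd p) ^ (2 * m)) * g (snd p *s (b + lin_comb cs (fst p))))"
    by (simp only: scaleR_conv_of_real)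
qed

lemma alternating_frame_shear_lin_comb:
  assumes alt: "alternating k D"
  shows "D ((b + lin_comb cs z) # (\<i> *s (b + lin_comb cs z)) # frame cs) = D (b # (\<i> *s b) # frame cs)"
proof -
  have "D ((b + (\<Sum>i<j. z i *s cs ! i)) # (\<i> *s (b + (\<Sum>i<j. z i *s cs ! i))) # frame cs) =
      D (b # (\<i> *s b) # frame cs)" if "j \<le> length cs" for j
    using that
  proof (induction j)
    case (Suc j)
    have c: "cs ! j \<in> set ([] @ frame cs)" "\<i> *s cs ! j \<in> set ([] @ frame cs)"
      using mem_frame[of "cs ! j" cs] Suc.prems by auto
    show ?case
      using Suc alternating_frame_shear[OF alt c, of "b + (\<Sum>i<j. z i *s cs ! i)" "z j"] by (simp add: add.assoc)
  qed simp
  from this[of "length cs"] show ?thesis by (simp add: lin_comb_def)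
qed

text \<open>Fubini for \<open>proj\<close> in an affine chart. The factor
  \<open>norm c ^ (2 * m)\<close> of the cone coordinates is the one by which scaling the frame
  changes the integrand of \<open>fibre_integral\<close>, and \<open>F\<close> is constant on
  fibres. As \<open>cs @ [b]\<close> may span a proper subspace, the statement serves the hyperplane
  as well.\<close>

lemma integral_over_cone:
  fixes \<Theta> :: "('n::finite) form"
  assumes alt: "\<And>y. alternating (2 * Suc m) (\<Theta> y)" and m: "length cs = m"
    and F: "\<And>c x. c \<noteq> 0 \<Longrightarrow> F (c *s x) = F x"
    and meas: "(\<lambda>y. F y * \<Theta> y (frame (cs @ [b]))) \<in> borel_measurable borel"
    and int: "integrable (cvol (Suc m)) (\<lambda>z. F (lin_comb (cs @ [b]) z) * \<Theta> (lin_comb (cs @ [b]) z) (frame (cs @ [b])))"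
    and indep: "\<And>z. b + lin_comb cs z \<noteq> 0"
  shows "integrable (cvol m) (\<lambda>z. F (b + lin_comb cs z) * fibre_integral \<Theta> (b + lin_comb cs z) (frame cs))"
    and "(LINT z|cvol (Suc m). F (lin_comb (cs @ [b]) z) * \<Theta> (lin_comb (cs @ [b]) z) (frame (cs @ [b]))) =
      (LINT z|cvol m. F (b + lin_comb cs z) * fibre_integral \<Theta> (b + lin_comb cs z) (frame cs))"
proof -
  interpret P: pair_sigma_finite "cvol m" "lborel :: complex measure" by (rule pair_sigma_finite_cvol)
  define H where "H p = of_real (norm (snd p) ^ (2 * m)) * (F (snd p *s (b + lin_comb cs (fst p))) *
      \<Theta> (snd p *s (b + lin_comb cs (fst p))) (frame (cs @ [b])))" for p :: "(nat \<Rightarrow> complex) \<times> complex"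
  have H: "integrable (cvol m \<Otimes>\<^sub>M lborel) H"
    using int unfolding integral_cvol_snoc(1)[OF meas m] integral_cone_coordinates(1)[OF meas m] H_def .
  have I: "(LINT c|lborel. H (z, c)) = F (b + lin_comb cs z) * fibre_integral \<Theta> (b + lin_comb cs z) (frame cs)" for z
  proof -
    let ?x = "b + lin_comb cs z"
    have pt: "H (z, c) = F ?x * \<Theta> (c *s ?x) (?x # (\<i> *s ?x) # map ((*s) c) (frame cs))" if c: "c \<noteq> 0" for c
    proof -
      have "\<Theta> (c *s ?x) (?x # (\<i> *s ?x) # map ((*s) c) (frame cs)) =
          of_real (norm c ^ (2 * m)) * \<Theta> (c *s ?x) (?x # (\<i> *s ?x) # frame cs)"
        using alternating_frame_scale_all[OF alt, of "c *s ?x" "[?x, \<i> *s ?x]" c cs] m by simp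
      also have "\<Theta> (c *s ?x) (?x # (\<i> *s ?x) # frame cs) = \<Theta> (c *s ?x) (frame (b # cs))"
        unfolding frame_simps by (rule alternating_frame_shear_lin_comb[OF alt])
      also have "\<dots> = \<Theta> (c *s ?x) (frame (cs @ [b]))"
        using alternating_frame_rotate[OF alt, of "c *s ?x" "[]" cs b] by simp
      finally have T: "\<Theta> (c *s ?x) (?x # (\<i> *s ?x) # map ((*s) c) (frame cs)) =
          of_real (norm c ^ (2 * m)) * \<Theta> (c *s ?x) (frame (cs @ [b]))" .
      show ?thesis unfolding H_def fst_conv snd_conv F[OF c] T by (rule mult.left_commute)
    qed
    have "(LINT c|lborel. H (z, c)) = (LINT c|lborel. F ?x * \<Theta> (c *s ?x) (?x # (\<i> *s ?x) # map ((*s) c) (frame cs)))"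
    proof (rule integral_cong_AE)
      have "(\<lambda>c. c *s ?x) \<in> borel_measurable borel" by measurable
      from measurable_compose[OF this meas]
      have [measurable]: "(\<lambda>c. F (c *s ?x) * \<Theta> (c *s ?x) (frame (cs @ [b]))) \<in> borel_measurable borel" .
      show Hm: "(\<lambda>c. H (z, c)) \<in> borel_measurable lborel" unfolding H_def fst_conv snd_conv by measurable
      show ae: "AE c in lborel. H (z, c) = F ?x * \<Theta> (c *s ?x) (?x # (\<i> *s ?x) # map ((*s) c) (frame cs))"
        by (rule AE_mp[OF AE_lborel_singleton[of "0::complex"]], rule AE_I2) (simp add: pt)
      \<comment> \<open>The two integrands differ at most at \<open>c = 0\<close>, so measurability
        passes over from \<open>H\<close>.\<close>
      have e: "(\<lambda>c. F ?x * \<Theta> (c *s ?x) (?x # (\<i> *s ?x) # map ((*s) c) (frame cs))) =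
          (\<lambda>c. if c = 0 then F ?x * \<Theta> (0 *s ?x) (?x # (\<i> *s ?x) # map ((*s) 0) (frame cs)) else H (z, c))"
        by (auto simp: pt)
      show "(\<lambda>c. F ?x * \<Theta> (c *s ?x) (?x # (\<i> *s ?x) # map ((*s) c) (frame cs))) \<in> borel_measurable lborel"
        unfolding e using Hm by (intro measurable_If) auto
    qed
    then show ?thesis using indep[of z] by (simp add: fibre_integral_def)
  qed
  show "integrable (cvol m) (\<lambda>z. F (b + lin_comb cs z) * fibre_integral \<Theta> (b + lin_comb cs z) (frame cs))"
    using P.integrable_fst'[OF H] by (simp only: I)
  have "(LINT z|cvol (Suc m). F (lin_comb (cs @ [b]) z) * \<Theta> (lin_comb (cs @ [b]) z) (frame (cs @ [b]))) =
      (LINT p|(cvol m \<Otimes>\<^sub>M lborel). H p)"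
    unfolding integral_cvol_snoc(2)[OF meas m] integral_cone_coordinates(2)[OF meas m] H_def ..
  also have "\<dots> = (LINT z|cvol m. LINT c|lborel. H (z, c))" by (rule P.integral_fst'[OF H, symmetric])
  finally show "(LINT z|cvol (Suc m). F (lin_comb (cs @ [b]) z) * \<Theta> (lin_comb (cs @ [b]) z) (frame (cs @ [b]))) =
      (LINT z|cvol m. F (b + lin_comb cs z) * fibre_integral \<Theta> (b + lin_comb cs z) (frame cs))"
    by (simp only: I)
qed

section \<open>Admissible metrics and the Green function\<close>

lemma cone_proj: "x \<noteq> 0 \<Longrightarrow> cone (proj x) = {c *s x | c. c \<noteq> 0}"
  unfolding proj_def by (rule Abs_proj_inverse) blast

lemma mem_cone_proj: "x \<noteq> 0 \<Longrightarrow> y \<in> cone (proj x) \<longleftrightarrow> (\<exists>c. c \<noteq> 0 \<and> y = c *s x)"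
  by (auto simp: cone_proj)

lemma proj_surj: obtains x where "x \<noteq> 0" "p = proj x"
proof -
  obtain x where "x \<noteq> 0" "cone p = {c *s x | c. c \<noteq> 0}" using cone[of p] by blast
  then have "p = proj x" unfolding proj_def by (metis cone_inverse)
  with \<open>x \<noteq> 0\<close> show ?thesis by (rule that)
qed

lemma proj_smult: "c \<noteq> 0 \<Longrightarrow> proj (c *s x) = proj x"
proof -
  assume c: "c \<noteq> 0"
  have "\<exists>d. y = d *s (c *s x) \<and> d \<noteq> 0" if "y = e *s x" "e \<noteq> 0" for e y
    by (rule exI[of _ "e / c"]) (use that c in simp)
  then have "{d *s (c *s x) | d. d \<noteq> 0} = {d *s x | d. d \<noteq> 0}"
    using c by auto
  then show ?thesis unfolding proj_def by simp
qed

lemma rep_in_cone: "rep p \<in> cone p"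
proof -
  obtain x where "x \<noteq> 0" "p = proj x" by (rule proj_surj)
  then have "x \<in> cone p" using mem_cone_proj[of x x] by (metis scaleR_one vec.scale_one zero_neq_one)
  then show ?thesis unfolding rep_def by (rule someI)
qed

lemma self_in_cone: "x \<noteq> 0 \<Longrightarrow> x \<in> cone (proj x)"
  using mem_cone_proj[of x x] by (metis vec.scale_one zero_neq_one)

text \<open>The element of the fibre of \<open>\<O>(1)\<close> over \<open>\<pi>(x)\<close> with value \<open>1\<close> at \<open>x\<close>.\<close>

definition unit_at :: "complex^'n::finite \<Rightarrow> complex^'n \<Rightarrow> complex" where
  "unit_at x y = (if y \<in> cone (proj x) then (THE c. y = c *s x) else 0)"

lemma unit_at_smult: "x \<noteq> 0 \<Longrightarrow> c \<noteq> 0 \<Longrightarrow> unit_at x (c *s x) = c"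
  unfolding unit_at_def by (auto simp: mem_cone_proj)

lemma unit_at_self: "x \<noteq> 0 \<Longrightarrow> unit_at x x = 1"
  using unit_at_smult[of x 1] by simp

lemma unit_at_nonzero: "x \<noteq> 0 \<Longrightarrow> unit_at x \<noteq> (\<lambda>y. 0)"
  using unit_at_self[of x] by (metis zero_neq_one)

lemma fibre_smult: "v \<in> fibre d (proj x) \<Longrightarrow> x \<noteq> 0 \<Longrightarrow> c \<noteq> 0 \<Longrightarrow> v (c *s x) = c ^ d * v x"
  using self_in_cone[of x] unfolding fibre_def by blast

lemma fibre_eqI:
  assumes "v \<in> fibre d (proj x)" "w \<in> fibre d (proj x)" "x \<noteq> 0" "v x = w x"
  shows "v = w"
proof
  fix y
  show "v y = w y"
  proof (cases "y \<in> cone (proj x)")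
    case True
    then show ?thesis using assms by (auto simp: mem_cone_proj fibre_smult)
  qed (use assms in \<open>simp add: fibre_def\<close>)
qed

lemma fibreI:
  assumes "x \<noteq> 0" "\<And>c. c \<noteq> 0 \<Longrightarrow> v (c *s x) = c ^ d * v x" "\<And>y. y \<notin> cone (proj x) \<Longrightarrow> v y = 0"
  shows "v \<in> fibre d (proj x)"
proof -
  have "v (c *s (e *s x)) = c ^ d * v (e *s x)" if "c \<noteq> 0" "e \<noteq> 0" for c e
    using assms(2)[of "c * e"] assms(2)[of e] that by (simp add: power_mult_distrib)
  then show ?thesis unfolding fibre_def using assms(1,3) by (auto simp: mem_cone_proj)
qed

lemma unit_at_fibre: "x \<noteq> 0 \<Longrightarrow> unit_at x \<in> fibre 1 (proj x)"
  by (rule fibreI) (auto simp: unit_at_smult unit_at_self, simp add: unit_at_def)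

lemma unit_at_power_fibre: "x \<noteq> 0 \<Longrightarrow> d > 0 \<Longrightarrow> (\<lambda>y. unit_at x y ^ d) \<in> fibre d (proj x)"
  by (rule fibreI) (auto simp: unit_at_smult unit_at_self, simp add: unit_at_def)

lemma fibre_cmult: "v \<in> fibre d p \<Longrightarrow> (\<lambda>y. a * v y) \<in> fibre d p"
  by (auto simp: fibre_def)

lemma fibre_zero: "(\<lambda>y. 0) \<in> fibre d p"
  by (auto simp: fibre_def)

lemma fibre_unit_at: "v \<in> fibre 1 (proj x) \<Longrightarrow> x \<noteq> 0 \<Longrightarrow> v = (\<lambda>y. v x * unit_at x y)"
  by (rule fibre_eqI[of _ 1 x]) (auto intro: fibre_cmult unit_at_fibre[unfolded One_nat_def] simp: unit_at_self)

lemma value_at_fibre: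
  assumes "\<And>c x. s (c *s x) = c * s x"
  shows "value_at s p \<in> fibre 1 p"
proof -
  obtain x where x: "x \<noteq> 0" "p = proj x" by (rule proj_surj)
  have "c *s x \<in> cone (proj x)" if "c \<noteq> 0" for c using x that by (auto simp: mem_cone_proj)
  then show ?thesis
    unfolding x(2) using x(1) self_in_cone[OF x(1)] by (intro fibreI) (auto simp: value_at_def assms)
qed

lemma value_at_unit_at:
  assumes "\<And>c x. s (c *s x) = c * s x" "x \<noteq> 0"
  shows "value_at s (proj x) = (\<lambda>y. s x * unit_at x y)"
  using fibre_unit_at[OF value_at_fibre[of s "proj x"] assms(2)] assms self_in_cone[OF assms(2)]
  by (simp add: value_at_def)

text \<open>If \<open>y\<close> lies over the image point, linearity gives
  \<open>lift f x = a *s y\<close>, where \<open>a\<close> is the value at \<open>x\<close> of the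
  preimage of \<open>unit_at y\<close>. The power of \<open>unit_at x\<close> is
  \<open>1 / a\<close> times this preimage, and \<open>unit_at (lift f x)\<close> is
  \<open>1 / a\<close> times \<open>unit_at y\<close>.\<close>

lemma lift_unit_at:
  fixes f :: "'n::finite pol_morphism"
  assumes f: "f \<in> Hbar" and x: "x \<noteq> 0"
  shows "lift f x \<noteq> 0" "proj (lift f x) = mor f (proj x)"
    "iso f (proj x) (\<lambda>y. unit_at x y ^ deg f) = unit_at (lift f x)"
proof -
  let ?d = "deg f" and ?\<phi> = "iso f (proj x)"
  have d: "?d > 0" using f by (simp add: Hbar_def)
  obtain y where y: "y \<noteq> 0" "mor f (proj x) = proj y" by (rule proj_surj)
  have b: "bij_betw ?\<phi> (fibre ?d (proj x)) (fibre 1 (proj y))"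
    and lin: "\<And>v w a. v \<in> fibre ?d (proj x) \<Longrightarrow> w \<in> fibre ?d (proj x) \<Longrightarrow>
      ?\<phi> (\<lambda>x. a * v x + w x) = (\<lambda>x. a * ?\<phi> v x + ?\<phi> w x)"
    using f by (auto simp: Hbar_def bundle_iso_def y(2)[symmetric])
  let ?J = "inv_into (fibre ?d (proj x)) ?\<phi>"
  have J: "?J w \<in> fibre ?d (proj x)" "?\<phi> (?J w) = w" if "w \<in> fibre 1 (proj y)" for w
    using that b by (auto simp: bij_betw_def inv_into_into f_inv_into_f)
  have \<phi>0: "?\<phi> (\<lambda>y. 0) = (\<lambda>y. 0)"
    using lin[OF fibre_zero fibre_zero, of 1] by (auto simp: fun_eq_iff)
  have \<phi>c: "?\<phi> (\<lambda>y. a * v y) = (\<lambda>y. a * ?\<phi> v y)" if "v \<in> fibre ?d (proj x)" for a v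
    using lin[OF that fibre_zero, of a] by (simp add: \<phi>0)
  have inj: "inj_on ?\<phi> (fibre ?d (proj x))" using b by (simp add: bij_betw_def)
  let ?u = "unit_at y"
  have u: "?u \<in> fibre 1 (proj y)" by (rule unit_at_fibre[OF y(1)])
  define a where "a = ?J ?u x"
  \<comment> \<open>An element of the fibre that vanishes at \<open>x\<close> is zero, and so would
    be its image \<open>unit_at y\<close>.\<close>
  have a: "a \<noteq> 0"
  proof
    assume "a = 0"
    then have "?J ?u = (\<lambda>y. 0)" using fibre_eqI[OF J(1)[OF u] fibre_zero x] by (simp add: a_def)
    then have "?u = (\<lambda>y. 0)" using J(2)[OF u] \<phi>0 by simp
    then show False using unit_at_self[OF y(1)] by (simp add: fun_eq_iff)
  qed
  have lift: "lift f x = a *s y"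
  proof -
    have "?J (value_at (\<lambda>z. z $ k) (proj y)) = (\<lambda>z. y $ k * ?J ?u z)" for k
    proof -
      have v: "value_at (\<lambda>z. z $ k) (proj y) = (\<lambda>z. y $ k * ?u z)"
        by (rule value_at_unit_at) (use y in simp_all)
      have "?\<phi> (\<lambda>z. y $ k * ?J ?u z) = value_at (\<lambda>z. z $ k) (proj y)"
        unfolding \<phi>c[OF J(1)[OF u]] J(2)[OF u] v ..
      then show ?thesis
        by (rule inv_into_f_eq[OF inj fibre_cmult[OF J(1)[OF u]]])
    qed
    then show ?thesis unfolding lift_def by (simp add: vec_eq_iff y(2) a_def mult.commute)
  qed
  show "lift f x \<noteq> 0" "proj (lift f x) = mor f (proj x)"
    using a y by (auto simp: lift proj_smult)
  have e: "(\<lambda>z. unit_at x z ^ ?d) = (\<lambda>z. (1 / a) * ?J ?u z)"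
    by (rule fibre_eqI[OF unit_at_power_fibre[OF x d] fibre_cmult[OF J(1)[OF u]] x])
       (use a x in \<open>simp add: unit_at_self a_def\<close>)
  have "unit_at (a *s y) = (\<lambda>z. (1 / a) * ?u z)"
  proof (rule fibre_eqI[of _ 1 "a *s y"])
    show "unit_at (a *s y) \<in> fibre 1 (proj (a *s y))" by (rule unit_at_fibre) (use a y in simp)
    show "(\<lambda>z. (1 / a) * ?u z) \<in> fibre 1 (proj (a *s y))"
      unfolding proj_smult[OF a] by (rule fibre_cmult[OF u])
    show "unit_at (a *s y) (a *s y) = 1 / a * ?u (a *s y)"
      using a y by (simp add: unit_at_self unit_at_smult)
  qed (use a y in simp)
  then show "?\<phi> (\<lambda>y. unit_at x y ^ ?d) = unit_at (lift f x)"
    unfolding lift e \<phi>c[OF J(1)[OF u]] J(2)[OF u] by simp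
qed

definition metric_potential :: "('n::finite) metric \<Rightarrow> complex^'n \<Rightarrow> real" where
  "metric_potential h x = - ln ((h (proj x) (unit_at x))\<^sup>2)"

lemma metric_unit_at_pos:
  assumes "is_metric h" "x \<noteq> 0"
  shows "h (proj x) (unit_at x) > 0"
proof -
  show ?thesis
    using unit_at_nonzero[OF assms(2)] assms(1) unit_at_fibre[OF assms(2)] unfolding is_metric_def by (metis less_eq_real_def)
qed

lemma metric_value_at:
  assumes "is_metric h" "\<And>c x. s (c *s x) = c * s x" "x \<noteq> 0"
  shows "h (proj x) (value_at s (proj x)) = norm (s x) * h (proj x) (unit_at x)"
  unfolding value_at_unit_at[OF assms(2,3)]
  using assms(1) unit_at_fibre[OF assms(3)] unfolding is_metric_def by blast

lemma metric_potential_section: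
  assumes h: "is_metric h" and s: "\<And>c x. s (c *s x) = c * s x" and x: "x \<noteq> 0" "s x \<noteq> 0"
  shows "- ln ((h (proj x) (value_at s (proj x)))\<^sup>2) = metric_potential h x - ln ((norm (s x))\<^sup>2)"
  unfolding metric_potential_def metric_value_at[OF h s x(1)]
  using metric_unit_at_pos[OF h x(1)] x(2) by (simp add: power_mult_distrib ln_mult)

text \<open>The fibre is a line, so the quotient does not depend on \<open>v\<close> and
  \<open>unit_at x\<close> computes it; the Fubini--Study norm of \<open>unit_at x\<close> is the
  reciprocal of \<open>norm x\<close>.\<close>

lemma metric_ratio_fubini_study:
  assumes h: "is_metric h" and x: "x \<noteq> 0"
  shows "metric_ratio h fubini_study (proj x) = h (proj x) (unit_at x) * norm x"
proof -
  obtain c where c: "c \<noteq> 0" "rep (proj x) = c *s x"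
    using rep_in_cone[of "proj x"] x by (auto simp: mem_cone_proj)
  have "norm (c *s x) = norm c * norm x" by (simp add: norm_vec_def norm_mult L2_set_left_distrib L2_set_right_distrib)
  then have fs: "fubini_study (proj x) v = norm (v x) / norm x" if "v \<in> fibre 1 (proj x)" for v
    using fibre_smult[OF that x c(1)] c by (simp add: fubini_study_def norm_mult)
  have ratio: "h (proj x) v / fubini_study (proj x) v = h (proj x) (unit_at x) * norm x"
    if v: "v \<in> fibre 1 (proj x)" "v \<noteq> (\<lambda>y. 0)" for v
  proof -
    have e: "v = (\<lambda>y. v x * unit_at x y)" by (rule fibre_unit_at[OF v(1) x])
    then have "v x \<noteq> 0" using v(2) by auto
    moreover have "h (proj x) v = norm (v x) * h (proj x) (unit_at x)"
      using h unit_at_fibre[OF x] e unfolding is_metric_def by metis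
    ultimately show ?thesis unfolding fs[OF v(1)] by simp
  qed
  note unit_at_nonzero[OF x]
  then show ?thesis
    unfolding metric_ratio_def
    by (intro the_equality) (use ratio unit_at_fibre[OF x] in \<open>auto simp: less_imp_neq\<close>)
qed

lemma continuous_on_proj: "continuous_on (- {0}) (proj :: complex^'n::finite \<Rightarrow> 'n proj)"
proof -
  have "open (proj -` B \<inter> - {0} :: (complex^'n) set)" if "open B" for B :: "'n proj set"
  proof -
    have "proj -` B \<inter> - {0} = {x. x \<noteq> 0 \<and> proj x \<in> B}" by auto
    then show ?thesis using that by (simp add: open_proj_def)
  qed
  then show ?thesis by (subst continuous_on_open_vimage) (auto simp: open_Compl)
qed

text \<open>\<open>continuous_metric\<close> speaks of sections over open sets of the projective
  space, and \<open>unit_at\<close> is not one, since it depends on \<open>x\<close>. Where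
  \<open>x $ k \<noteq> 0\<close> the coordinate section is used instead and its logarithm is added
  back.\<close>

lemma continuous_metric_potential:
  fixes h :: "'n::finite metric"
  assumes h: "continuous_metric h"
  shows "continuous_on (- {0}) (metric_potential h)"
proof (rule continuous_at_imp_continuous_on, rule ballI)
  fix x0 :: "complex^'n" assume "x0 \<in> - {0}"
  then obtain k where k: "x0 $ k \<noteq> 0" by (auto simp: vec_eq_iff)
  have m: "is_metric h" using h by (simp add: continuous_metric_def)
  define S where "S = {x :: complex^'n. x $ k \<noteq> 0}"
  define U where "U = {p :: 'n proj. \<forall>y\<in>cone p. y $ k \<noteq> 0}"
  have oS: "open S" unfolding S_def by (intro open_Collect_neq continuous_intros)
  have S0: "x \<noteq> 0" if "x \<in> S" for x using that by (auto simp: S_def)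
  have SU: "{x. x \<noteq> 0 \<and> proj x \<in> U} = S"
  proof (intro set_eqI iffI)
    fix x assume "x \<in> {x. x \<noteq> 0 \<and> proj x \<in> U}"
    then show "x \<in> S" using self_in_cone[of x] by (auto simp: U_def S_def)
  next
    fix x assume "x \<in> S"
    then show "x \<in> {x. x \<noteq> 0 \<and> proj x \<in> U}" using S0[of x] by (auto simp: U_def S_def mem_cone_proj)
  qed
  have oU: "open U" unfolding open_proj_def SU by (rule oS)
  have lin: "(c *s x) $ k = c * x $ k" for c and x :: "complex^'n" by simp
  let ?s = "\<lambda>p. value_at (\<lambda>z. z $ k) p"
  have "continuous_on {x. x \<noteq> 0 \<and> proj x \<in> U} (\<lambda>x. ?s (proj x) x)"
  proof (rule continuous_on_eq)
    show "continuous_on {x. x \<noteq> 0 \<and> proj x \<in> U} (\<lambda>x. x $ k)" by (intro continuous_intros)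
  qed (auto simp: value_at_def self_in_cone)
  then have c: "continuous_on U (\<lambda>p. h p (?s p))"
    using h oU value_at_fibre[of "\<lambda>z. z $ k", OF lin] unfolding continuous_metric_def by blast
  have "continuous_on S (\<lambda>x. h (proj x) (?s (proj x)))"
    by (rule continuous_on_compose2[OF c continuous_on_subset[OF continuous_on_proj]])
       (use SU in auto)
  then have "continuous_on S (\<lambda>x. - ln ((h (proj x) (?s (proj x)))\<^sup>2) + ln ((norm (x $ k))\<^sup>2))"
    using metric_value_at[OF m lin S0] metric_unit_at_pos[OF m S0]
    by (intro continuous_intros) (auto simp: S_def less_imp_neq[symmetric])
  then have "continuous_on S (metric_potential h)"
    by (rule continuous_on_eq) (use metric_potential_section[OF m lin S0] in \<open>auto simp: S_def\<close>)
  then show "isCont (metric_potential h) x0"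
    using k oS by (simp add: continuous_on_eq_continuous_at S_def)
qed

section \<open>Iterates of the lifts and the limit defining the Green function\<close>

lemma Bbar_drop:
  assumes "fs \<in> Bbar"
  shows "(\<lambda>j. fs (j + i)) \<in> Bbar" "cbar_seq (\<lambda>j. fs (j + i)) \<le> cbar_seq fs"
proof -
  show le: "cbar_seq (\<lambda>j. fs (j + i)) \<le> cbar_seq fs"
    unfolding cbar_seq_def by (rule SUP_mono) auto
  then show "(\<lambda>j. fs (j + i)) \<in> Bbar" using assms by (auto simp: Bbar_def intro: le_less_trans)
qed

context
  fixes fs :: "nat \<Rightarrow> 'n::finite pol_morphism" and h :: "(nat \<Rightarrow> 'n pol_morphism) \<Rightarrow> 'n metric"
  assumes fs: "fs \<in> Bbar" and h: "admissible_metrics h"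
begin

lemma admissible_is_metric: "gs \<in> Bbar \<Longrightarrow> is_metric (h gs)"
  using h by (simp add: admissible_metrics_def continuous_metric_def)

lemma admissible_potential_lift:
  assumes gs: "gs \<in> Bbar" and x: "x \<noteq> 0"
  shows "metric_potential (h (shift gs)) (lift (gs 0) x) = real (deg (gs 0)) * metric_potential (h gs) x"
proof -
  have f: "gs 0 \<in> Hbar" using gs by (simp add: Bbar_def)
  have "pullback_metric (gs 0) (h (shift gs)) (proj x) (\<lambda>y. unit_at x y ^ deg (gs 0)) =
      h gs (proj x) (unit_at x) ^ deg (gs 0)"
    using h gs unit_at_fibre[OF x] unfolding admissible_metrics_def by blast
  then have "h (shift gs) (proj (lift (gs 0) x)) (unit_at (lift (gs 0) x)) = h gs (proj x) (unit_at x) ^ deg (gs 0)"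
    unfolding pullback_metric_def lift_unit_at[OF f x] .
  then show ?thesis
    using metric_unit_at_pos[OF admissible_is_metric[OF gs] x]
    unfolding metric_potential_def by (simp add: ln_realpow flip: power_mult)
qed

lemma admissible_potential_bound:
  obtains C where "\<And>i x. x \<noteq> 0 \<Longrightarrow> \<bar>metric_potential (h (\<lambda>j. fs (j + i))) x - ln ((norm x)\<^sup>2)\<bar> \<le> C"
proof -
  have "cbar_seq fs < \<infinity>" using fs by (simp add: Bbar_def)
  then have "2 * cbar_seq fs \<noteq> \<infinity>" by (cases "cbar_seq fs") auto
  then obtain B where B: "2 * cbar_seq fs \<le> ereal B"
    by (cases "2 * cbar_seq fs") auto
  show ?thesis
  \<comment> \<open>The potential minus \<open>ln ((norm x)\<^sup>2)\<close> is \<open>- 2\<close>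
    times the logarithm of the metric ratio. Tails of \<open>fs\<close> have no larger
    \<open>cbar_seq\<close>, so one constant serves all \<open>i\<close>.\<close>
  proof (rule that[of "2 * B"])
    fix i and x :: "complex^'n" assume x: "x \<noteq> 0"
    let ?g = "\<lambda>j. fs (j + i)"
    have g: "?g \<in> Bbar" "cbar_seq ?g \<le> cbar_seq fs" by (rule Bbar_drop[OF fs])+
    have m: "is_metric (h ?g)" by (rule admissible_is_metric[OF g(1)])
    have "ereal \<bar>ln (metric_ratio (h ?g) fubini_study (proj x))\<bar> \<le>
        (SUP p. ereal \<bar>ln (metric_ratio (h ?g) fubini_study p)\<bar>)" by (rule SUP_upper) simp
    also have "\<dots> \<le> 2 * cbar_seq ?g" using h g(1) unfolding admissible_metrics_def by blast
    also have "\<dots> \<le> 2 * cbar_seq fs" by (rule ereal_mult_left_mono[OF g(2)]) simp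
    also note B
    finally have "\<bar>ln (h ?g (proj x) (unit_at x) * norm x)\<bar> \<le> B"
      by (simp add: metric_ratio_fubini_study[OF m x])
    moreover have "metric_potential (h ?g) x - ln ((norm x)\<^sup>2) = - 2 * ln (h ?g (proj x) (unit_at x) * norm x)"
      unfolding metric_potential_def using metric_unit_at_pos[OF m x] x
      by (simp add: ln_mult ln_realpow)
    ultimately show "\<bar>metric_potential (h ?g) x - ln ((norm x)\<^sup>2)\<bar> \<le> 2 * B" by simp
  qed
qed

lemma admissible_potential_iterate:
  assumes x: "x \<noteq> 0"
  shows "iterate fs i x \<noteq> 0 \<and>
    metric_potential (h (\<lambda>j. fs (j + i))) (iterate fs i x) = (\<Prod>\<alpha><i. real (deg (fs \<alpha>))) * metric_potential (h fs) x"
proof (induction i)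
  case (Suc i)
  let ?g = "\<lambda>j. fs (j + i)"
  have g: "?g \<in> Bbar" by (rule Bbar_drop[OF fs])
  have f: "fs i \<in> Hbar" using fs by (simp add: Bbar_def)
  have "shift ?g = (\<lambda>j. fs (j + Suc i))" by (simp add: shift_def)
  then show ?case
    using admissible_potential_lift[OF g, of "iterate fs i x"] lift_unit_at(1)[OF f, of "iterate fs i x"] Suc
    by simp
qed (use x in simp)

lemma green_function_eq_potential:
  assumes x: "x \<noteq> 0"
  shows "green_function fs x = metric_potential (h fs) x"
proof -
  obtain C where C: "\<And>i x. x \<noteq> 0 \<Longrightarrow> \<bar>metric_potential (h (\<lambda>j. fs (j + i))) x - ln ((norm x)\<^sup>2)\<bar> \<le> C"
    by (rule admissible_potential_bound) blast
  define P where "P i = (\<Prod>\<alpha><i. real (deg (fs \<alpha>)))" for i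
  \<comment> \<open>All degrees are at least \<open>2\<close>, so dividing the uniform bound by
    \<open>P i\<close> gives geometric decay.\<close>
  have P: "2 ^ i \<le> P i" for i
  proof (induction i)
    case (Suc i)
    have "2 \<le> deg (fs i)" using fs by (auto simp: Bbar_def Hbar_def)
    then show ?case using mult_mono[of "2 ^ i" "P i" 2 "real (deg (fs i))"] Suc by (simp add: P_def mult.commute prod_nonneg)
  qed (simp add: P_def)
  have bound: "norm (green_approx fs i x - metric_potential (h fs) x) \<le> C * (1 / 2) ^ i" for i
  proof -
    let ?y = "iterate fs i x"
    have y: "?y \<noteq> 0" "metric_potential (h (\<lambda>j. fs (j + i))) ?y = P i * metric_potential (h fs) x"
      using admissible_potential_iterate[OF x, of i] by (auto simp: P_def)
    have P0: "P i > 0" using P[of i] by (rule less_le_trans[rotated]) simp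
    have C0: "C \<ge> 0" using C[OF y(1)] by (meson abs_ge_zero order_trans)
    have "\<bar>P i * metric_potential (h fs) x - ln ((norm ?y)\<^sup>2)\<bar> \<le> C" using C[OF y(1), of i] y(2) by simp
    moreover have "green_approx fs i x - metric_potential (h fs) x =
        - (P i * metric_potential (h fs) x - ln ((norm ?y)\<^sup>2)) / P i"
      unfolding green_approx_def P_def[symmetric] using P0 by (simp add: field_simps)
    ultimately have "norm (green_approx fs i x - metric_potential (h fs) x) \<le> C / P i"
      using P0 by (simp add: abs_divide divide_right_mono)
    also have "\<dots> \<le> C / 2 ^ i" using P[of i] C0 P0 by (intro divide_left_mono) auto
    finally show ?thesis by (simp add: power_divide)
  qed
  have lim0: "(\<lambda>i. C * (1 / 2 :: real) ^ i) \<longlonglongrightarrow> C * 0"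
    by (rule tendsto_mult_left, rule LIMSEQ_power_zero) simp
  have "(\<lambda>i. green_approx fs i x - metric_potential (h fs) x) \<longlonglongrightarrow> 0"
    by (rule Lim_null_comparison[OF always_eventually]) (use bound lim0 in auto)
  then have "(\<lambda>i. green_approx fs i x) \<longlonglongrightarrow> metric_potential (h fs) x" by (rule LIM_zero_cancel)
  then show ?thesis unfolding green_function_def by (rule limI)
qed

end

text \<open>An exponent vector of total degree one is a unit vector, so every monomial is a
  coordinate.\<close>

lemma hom_poly_1_linear_form:
  fixes s :: "complex^'n::finite \<Rightarrow> complex"
  assumes "hom_poly 1 s"
  shows "linear_form s"
proof -
  obtain a :: "('n \<Rightarrow> nat) \<Rightarrow> complex" where
    a: "\<And>x. s x = (\<Sum>m | sum m UNIV = 1. a m * (\<Prod>i\<in>UNIV. (x $ i) ^ m i))"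
    using assms unfolding hom_poly_def by blast
  have "\<exists>k. \<forall>x::complex^'n. (\<Prod>i\<in>UNIV. (x $ i) ^ m i) = x $ k" if m: "sum m UNIV = 1" for m
  proof -
    have "\<exists>k\<in>UNIV. m k = 1 \<and> (\<forall>i\<in>UNIV. k \<noteq> i \<longrightarrow> m i = 0)"
      by (rule sum_eq_1_iff[THEN iffD1, OF finite m])
    then obtain k where "m k = 1 \<and> (\<forall>i\<in>UNIV. k \<noteq> i \<longrightarrow> m i = 0)" by (rule bexE)
    then have k: "m k = 1" "\<And>i. i \<noteq> k \<Longrightarrow> m i = 0" by auto
    have "(\<Prod>i\<in>UNIV. (x $ i) ^ m i) = x $ k" for x :: "complex^'n"
    proof -
      have "(\<Prod>i\<in>UNIV. (x $ i) ^ m i) = (x $ k) ^ m k * (\<Prod>i\<in>UNIV - {k}. (x $ i) ^ m i)"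
        by (rule prod.remove) auto
      also have "(\<Prod>i\<in>UNIV - {k}. (x $ i) ^ m i) = 1" by (rule prod.neutral) (use k in auto)
      finally show ?thesis using k by simp
    qed
    then show ?thesis by blast
  qed
  then obtain k where k: "\<And>m x. sum m UNIV = 1 \<Longrightarrow> (\<Prod>i\<in>UNIV. ((x::complex^'n) $ i) ^ m i) = x $ k m"
    by metis
  have s: "s x = (\<Sum>m | sum m UNIV = 1. a m * x $ k m)" for x
    unfolding a by (rule sum.cong) (use k in auto)
  show ?thesis
    unfolding linear_form_def s by (simp add: algebra_simps sum.distrib sum_distrib_left)
qed

section \<open>Lifting forms to affine space\<close>

text \<open>The wedge product of \<open>\<alpha>\<close> with \<open>\<i> / 2\<close> times the
  wedge of \<open>l\<close> and its conjugate. The factor is chosen so that this area form takes the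
  value \<open>(norm (l e))\<^sup>2\<close> on \<open>e\<close> and
  \<open>\<i> *s e\<close>.\<close>

definition wedge2 :: "(complex^'n \<Rightarrow> complex) \<Rightarrow> ((complex^'n) list \<Rightarrow> complex) \<Rightarrow> (complex^'n) list \<Rightarrow> complex" where
  "wedge2 l \<alpha> vs = \<i> / 2 * alt_sum (\<lambda>v us. l v * alt_sum (\<lambda>w ws. cnj (l w) * \<alpha> ws) us) vs"

lemma alternating_cmult: "alternating k \<alpha> \<Longrightarrow> alternating k (\<lambda>vs. c * \<alpha> vs)"
  using alternating_sum[of k \<alpha> "\<lambda>vs. 0" c] by (simp add: alternating_null)

lemma alternating_wedge2:
  fixes l :: "complex^'n::finite \<Rightarrow> complex"
  assumes l: "linear_form l" and \<alpha>: "alternating k \<alpha>"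
  shows "alternating (Suc (Suc k)) (wedge2 l \<alpha>)"
proof -
  have 1: "alternating (Suc k) (alt_sum (\<lambda>w ws. cnj (l w) * \<alpha> ws))"
    by (rule alternating_alt_sum, simp add: linear_formD[OF l] algebra_simps, rule alternating_cmult[OF \<alpha>])
  have "alternating (Suc (Suc k)) (alt_sum (\<lambda>v us. l v * alt_sum (\<lambda>w ws. cnj (l w) * \<alpha> ws) us))"
    by (rule alternating_alt_sum, simp add: linear_formD[OF l] algebra_simps, rule alternating_cmult[OF 1])
  from alternating_cmult[OF this, of "\<i> / 2"] show ?thesis unfolding wedge2_def[abs_def] .
qed

lemma wedge2_scale:
  fixes l :: "complex^'n::finite \<Rightarrow> complex"
  assumes l: "linear_form l" and \<alpha>: "\<And>ws. \<alpha> (map ((*s) c) ws) = f * \<alpha> ws"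
  shows "wedge2 l \<alpha> (map ((*s) c) vs) = c * cnj c * f * wedge2 l \<alpha> vs"
proof -
  define A where "A = alt_sum (\<lambda>w ws. cnj (l w) * \<alpha> ws)"
  have 1: "A (map ((*s) c) us) = cnj c * f * A us" for us
    unfolding A_def alt_sum_def sum_distrib_left
    by (simp add: remove_nth_map \<alpha> linear_formD[OF l] mult_ac)
  show ?thesis
    unfolding wedge2_def A_def[symmetric] alt_sum_def sum_distrib_left
    by (simp add: remove_nth_map 1 linear_formD[OF l] mult_ac)
qed

context
  fixes l :: "complex^'n::finite \<Rightarrow> complex" and ws :: "(complex^'n) list"
  assumes l: "linear_form l" and ws: "\<And>w. w \<in> set ws \<Longrightarrow> l w = 0"
begin

lemma wedge2_inner_kernel: "alt_sum (\<lambda>w us. cnj (l w) * \<alpha> us) ws = 0"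
  by (rule alt_sum_eq_0) (simp add: ws)

lemma wedge2_inner_Cons: "alt_sum (\<lambda>w us. cnj (l w) * \<alpha> us) (v # ws) = cnj (l v) * \<alpha> ws"
  using wedge2_inner_kernel[of "\<lambda>us. \<alpha> (v # us)"] by (simp add: alt_sum_Cons)

lemma wedge2_outer_kernel: "alt_sum (\<lambda>w us. l w * \<beta> us) ws = 0"
  by (rule alt_sum_eq_0) (simp add: ws)

lemma wedge2_kernel: "wedge2 l \<alpha> ws = 0"
  by (simp add: wedge2_def wedge2_outer_kernel)

lemma wedge2_Cons: "wedge2 l \<alpha> (v # ws) = 0"
  using wedge2_outer_kernel[of "\<lambda>us. alt_sum (\<lambda>w ws. cnj (l w) * \<alpha> ws) (v # us)"]
  by (simp add: wedge2_def alt_sum_Cons[of _ v ws] wedge2_inner_kernel)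

lemma wedge2_frame: "wedge2 l \<alpha> (e # (\<i> *s e) # ws) = of_real ((norm (l e))\<^sup>2) * \<alpha> ws"
proof -
  have "alt_sum (\<lambda>v us. l v * alt_sum (\<lambda>w ws. cnj (l w) * \<alpha> ws) us) (e # (\<i> *s e) # ws) =
      l e * (cnj (l (\<i> *s e)) * \<alpha> ws) - l (\<i> *s e) * (cnj (l e) * \<alpha> ws)"
    using wedge2_outer_kernel[of "\<lambda>us. alt_sum (\<lambda>w ws. cnj (l w) * \<alpha> ws) (e # (\<i> *s e) # us)"]
    unfolding alt_sum_Cons[of _ e "(\<i> *s e) # ws"] alt_sum_Cons[of _ "\<i> *s e" ws] wedge2_inner_Cons by simp
  also have "\<dots> = - 2 * \<i> * (l e * cnj (l e)) * \<alpha> ws"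
    by (simp add: linear_formD[OF l])
  also have "l e * cnj (l e) = of_real ((norm (l e))\<^sup>2)" by (rule complex_norm_square[symmetric])
  finally show ?thesis by (simp add: wedge2_def)
qed

end

section \<open>A bump function on the fibres\<close>

lemma smooth_on_norm_square:
  fixes q :: "'a::real_normed_vector \<Rightarrow> complex"
  assumes "open S" "smooth_on S q"
  shows "smooth_on S (\<lambda>x. (norm (q x))\<^sup>2)"
proof -
  have "smooth_on S (\<lambda>x. Re (q x) * Re (q x) + Im (q x) * Im (q x))"
    by (intro smooth_on_add smooth_on_mult smooth_on_linear[OF _ bounded_linear_Re]
        smooth_on_linear[OF _ bounded_linear_Im] assms)
  then show ?thesis unfolding cmod_power2 unfolding power2_eq_square .
qed

text \<open>As a function of the squared modulus it is supported on the annulus between the radii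
  \<open>1\<close> and \<open>2\<close>. A bump away from the origin keeps the lifted form away from
  the hyperplane \<open>l = 0\<close>.\<close>

definition ring_bump :: "real \<Rightarrow> real" where
  "ring_bump t = flat_exp 0 (t - 1) * flat_exp 0 (4 - t)"

lemma ring_bump_pos: "ring_bump t \<ge> 0" "ring_bump t \<noteq> 0 \<longleftrightarrow> 1 < t \<and> t < 4"
  by (auto simp: ring_bump_def flat_exp_pos)

lemma smooth_on_ring_bump:
  fixes q :: "'a::real_normed_vector \<Rightarrow> complex"
  assumes "open S" "smooth_on S q"
  shows "smooth_on S (\<lambda>x. complex_of_real (c * ring_bump ((norm (q x))\<^sup>2)))"
proof -
  have "smooth_on S (\<lambda>x. flat_exp 0 ((norm (q x))\<^sup>2 - 1))" "smooth_on S (\<lambda>x. flat_exp 0 (4 - (norm (q x))\<^sup>2))"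
    by (rule smooth_on_compose_real[OF assms(1) smooth_on_flat_exp],
        intro smooth_on_diff smooth_on_norm_square smooth_on_const assms)+
  then have "smooth_on S (\<lambda>x. c * (flat_exp 0 ((norm (q x))\<^sup>2 - 1) * flat_exp 0 (4 - (norm (q x))\<^sup>2)))"
    by (intro smooth_on_mult smooth_on_const assms)
  from smooth_on_linear[OF assms(1) bounded_linear_of_real this] show ?thesis by (simp add: ring_bump_def)
qed

definition fibre_bump :: "complex \<Rightarrow> complex" where
  "fibre_bump z = complex_of_real (1 / (LINT z|lborel. ring_bump ((norm (z::complex))\<^sup>2)) * ring_bump ((norm z)\<^sup>2))"

lemma integral_ring_bump:
  "integrable lborel (\<lambda>z::complex. ring_bump ((norm z)\<^sup>2))" "(LINT z|lborel. ring_bump ((norm (z::complex))\<^sup>2)) > 0"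
proof -
  let ?f = "\<lambda>z::complex. ring_bump ((norm z)\<^sup>2)"
  have "smooth_on UNIV (\<lambda>z::complex. complex_of_real (1 * ring_bump ((norm z)\<^sup>2)))"
    using smooth_on_ring_bump[OF open_UNIV smooth_on_bounded_linear[OF open_UNIV bounded_linear_ident], of 1] .
  then have c: "continuous_on UNIV (\<lambda>z::complex. complex_of_real (ring_bump ((norm z)\<^sup>2)))"
    using smooth_on_continuous_on by fastforce
  have "integrable lborel (\<lambda>z. complex_of_real (?f z))"
  proof (rule integrable_compact_support[OF c compact_cball[of 0 2]])
    fix z :: complex assume "z \<notin> cball 0 2"
    then have "2\<^sup>2 \<le> (norm z)\<^sup>2" by (intro power_mono) auto
    then show "complex_of_real (?f z) = 0" using ring_bump_pos(2)[of "(norm z)\<^sup>2"] by auto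
  qed
  then show I: "integrable lborel ?f" by (simp only: complex_of_real_integrable_eq)
  \<comment> \<open>A vanishing integral would make the open annulus, on which the function is
    positive, negligible.\<close>
  have "(LINT z|lborel. ?f z) \<noteq> 0"
  proof
    assume "(LINT z|lborel. ?f z) = 0"
    then have ae: "AE z in lborel. ?f z = 0"
      using integral_nonneg_eq_0_iff_AE[OF I] ring_bump_pos(1) by auto
    define U where "U = {z::complex. 1 < (norm z)\<^sup>2 \<and> (norm z)\<^sup>2 < 4}"
    have o: "open U" unfolding U_def
      by (intro open_Collect_conj open_Collect_less continuous_intros)
    have "AE z in lborel. z \<notin> U"
      using ae by eventually_elim (use ring_bump_pos(2) in \<open>auto simp: U_def\<close>)
    then have "AE z in lebesgue. z \<notin> U" by (rule AE_completion)
    then have "negligible U"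
      unfolding negligible_iff_null_sets using o
      by (subst (asm) AE_iff_null_sets[symmetric]) auto
    moreover have "complex_of_real (3/2) \<in> U" by (simp add: U_def norm_mult power2_eq_square)
    ultimately show False using open_not_negligible[OF o] by blast
  qed
  moreover have "(LINT z|lborel. ?f z) \<ge> 0" using ring_bump_pos(1) by (intro integral_nonneg_AE) auto
  ultimately show "(LINT z|lborel. ?f z) > 0" by simp
qed

lemma integral_fibre_bump: "(LINT z|lborel. fibre_bump z) = 1"
proof -
  have "(LINT z|lborel. fibre_bump z) =
      of_real (LINT z|lborel. 1 / (LINT z|lborel. ring_bump ((norm (z::complex))\<^sup>2)) * ring_bump ((norm (z::complex))\<^sup>2))"
    unfolding fibre_bump_def by (rule integral_complex_of_real)
  also have "\<dots> = 1" using integral_ring_bump(2) by simp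
  finally show ?thesis .
qed

lemma smooth_on_fibre_bump:
  "open S \<Longrightarrow> smooth_on S q \<Longrightarrow> smooth_on S (\<lambda>x. fibre_bump (q x))"
  unfolding fibre_bump_def by (rule smooth_on_ring_bump)

lemma fibre_bump_nonzero: "fibre_bump z \<noteq> 0 \<Longrightarrow> 1 \<le> norm z \<and> norm z \<le> 2"
proof -
  assume "fibre_bump z \<noteq> 0"
  then have "1 < (norm z)\<^sup>2" "(norm z)\<^sup>2 < 4"
    using ring_bump_pos(2)[of "(norm z)\<^sup>2"] by (auto simp: fibre_bump_def)
  moreover have "(2::real)\<^sup>2 = 4" "(1::real)\<^sup>2 = 1" by simp_all
  ultimately show ?thesis
    by (metis less_eq_real_def norm_ge_zero not_less power2_less_imp_less power_mono zero_le_numeral zero_le_one not_le)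
qed

lemma fibre_bump_0: "fibre_bump 0 = 0"
  using fibre_bump_nonzero[of 0] by force

lemma measurable_fibre_bump [measurable]: "fibre_bump \<in> borel_measurable borel"
  by (rule borel_measurable_continuous_onI[OF smooth_on_continuous_on[OF
        smooth_on_fibre_bump[OF open_UNIV smooth_on_bounded_linear[OF open_UNIV bounded_linear_ident]]]])

lemma wirtinger_fibre_bump:
  fixes l :: "complex^'n::finite \<Rightarrow> complex"
  assumes l: "linear_form l" and w: "l w = 0"
  shows "wirtinger \<sigma> (\<lambda>y. fibre_bump (l y)) x w = 0" "(\<lambda>y. fibre_bump (l y)) differentiable (at x)"
proof -
  have "fibre_bump differentiable (at (l x))"
    using smooth_on_differentiable[OF smooth_on_fibre_bump[OF open_UNIV smooth_on_bounded_linear[OF open_UNIV bounded_linear_ident]]]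
    by simp
  then obtain D where D: "(fibre_bump has_derivative D) (at (l x))" by (auto simp: differentiable_def)
  have d: "((\<lambda>y. fibre_bump (l y)) has_derivative (\<lambda>v. D (l v))) (at x)"
    by (rule has_derivative_compose[OF bounded_linear_imp_has_derivative[OF linear_form_bounded_linear[OF l]] D])
  then show "(\<lambda>y. fibre_bump (l y)) differentiable (at x)" by (auto simp: differentiable_def)
  have "D 0 = 0" by (rule linear_0[OF has_derivative_linear[OF D]])
  then show "wirtinger \<sigma> (\<lambda>y. fibre_bump (l y)) x w = 0"
    unfolding wirtinger_has_derivative[OF d] by (simp add: linear_formD[OF l] w)
qed

text \<open>\<open>vertical l \<Theta> \<Omega>\<close> says that \<open>\<Theta> = \<rho>(l) (i/2 dl \<and> d\<bar>l) \<and> \<Omega>\<close> modulo \<open>dl\<close> and its conjugate,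
  where \<open>\<rho>\<close> is the bump function. As \<open>\<rho>(l)\<close> is constant along the kernel of \<open>l\<close>, this property is
  preserved by \<open>\<partial>\<close> and its conjugate.\<close>

definition vertical :: "(complex^'n \<Rightarrow> complex) \<Rightarrow> ('n::finite) form \<Rightarrow> 'n form \<Rightarrow> bool" where
  "vertical l \<Theta> \<Omega> \<longleftrightarrow> (\<forall>y ws. (\<forall>w\<in>set ws. l w = 0) \<longrightarrow>
     \<Theta> y ws = 0 \<and> (\<forall>v. \<Theta> y (v # ws) = 0) \<and>
     (\<forall>e. \<Theta> y (e # (\<i> *s e) # ws) = fibre_bump (l y) * of_real ((norm (l e))\<^sup>2) * \<Omega> y ws))"

lemma verticalD:
  assumes "vertical l \<Theta> \<Omega>" "\<And>w. w \<in> set ws \<Longrightarrow> l w = 0"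
  shows "\<Theta> y ws = 0" "\<Theta> y (v # ws) = 0"
    "\<Theta> y (e # (\<i> *s e) # ws) = fibre_bump (l y) * of_real ((norm (l e))\<^sup>2) * \<Omega> y ws"
  using assms unfolding vertical_def by blast+

lemma vertical_dolbeault:
  assumes l: "linear_form l" and \<Omega>: "smooth_form k \<Omega>" and v: "vertical l \<Theta> \<Omega>"
  shows "vertical l (dolbeault \<sigma> \<Theta>) (dolbeault \<sigma> \<Omega>)"
  unfolding vertical_def
proof (intro allI impI)
  fix y :: "complex^'a" and ws :: "(complex^'a) list"
  assume ws: "\<forall>w\<in>set ws. l w = 0"
  have r: "w \<in> set (remove_nth i ws) \<Longrightarrow> l w = 0" for i w using ws set_remove_nth by fast
  show "dolbeault \<sigma> \<Theta> y ws = 0 \<and> (\<forall>v. dolbeault \<sigma> \<Theta> y (v # ws) = 0) \<and>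
     (\<forall>e. dolbeault \<sigma> \<Theta> y (e # (\<i> *s e) # ws) = fibre_bump (l y) * of_real ((norm (l e))\<^sup>2) * dolbeault \<sigma> \<Omega> y ws)"
  proof (cases "y = 0")
    case True
    then show ?thesis by (simp add: dolbeault_def)
  next
    case y: False
    define B where "B v ws = wirtinger \<sigma> (\<lambda>y. \<Theta> y ws) y v" for v ws
    have dolbeault: "dolbeault \<sigma> \<Theta> y vs = alt_sum B vs" for vs using y by (simp add: dolbeault_def B_def[abs_def])
    have 1: "B w (remove_nth i ws) = 0" for w i
      unfolding B_def using verticalD(1)[OF v r] by simp
    have 2: "B w (u # remove_nth i ws) = 0" for w u i
      unfolding B_def using verticalD(2)[OF v r] by simp
    have one: "B w ws = 0" for w unfolding B_def using verticalD(1)[OF v, of ws] ws by simp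
    have two: "B w (u # ws) = 0" for w u unfolding B_def using verticalD(2)[OF v, of ws] ws by simp
    have "alt_sum B ws = 0" by (rule alt_sum_eq_0) (rule 1)
    moreover have "alt_sum B (u # ws) = 0" for u
    proof -
      have "alt_sum (\<lambda>w us. B w (u # us)) ws = 0" by (rule alt_sum_eq_0) (rule 2)
      then show ?thesis by (simp add: alt_sum_Cons one)
    qed
    moreover have "alt_sum B (e # (\<i> *s e) # ws) = fibre_bump (l y) * of_real ((norm (l e))\<^sup>2) * dolbeault \<sigma> \<Omega> y ws" for e
    proof -
      \<comment> \<open>Differentiating along \<open>e\<close> or \<open>\<i> *s e\<close> leaves a
        list with at most one vector outside the kernel of \<open>l\<close>, on which
        \<open>\<Theta>\<close> is identically zero.\<close>
      have "alt_sum B (e # (\<i> *s e) # ws) = alt_sum (\<lambda>w us. B w (e # (\<i> *s e) # us)) ws"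
        by (simp add: alt_sum_Cons two)
      also have "\<dots> = alt_sum (\<lambda>w us. (fibre_bump (l y) * of_real ((norm (l e))\<^sup>2)) * wirtinger \<sigma> (\<lambda>y. \<Omega> y us) y w) ws"
      proof (rule alt_sum_cong)
        fix i assume i: "i < length ws"
        let ?us = "remove_nth i ws" and ?w = "ws ! i"
        have w: "l ?w = 0" using ws i by simp
        note d = wirtinger_fibre_bump[OF l w]
        have c: "(\<lambda>y. of_real ((norm (l e))\<^sup>2) * \<Omega> y ?us + 0) differentiable (at y)"
          using smooth_formD(4)[OF \<Omega> y] by (intro derivative_intros) auto
        have "B ?w (e # (\<i> *s e) # ?us) = wirtinger \<sigma> (\<lambda>y. fibre_bump (l y) * (of_real ((norm (l e))\<^sup>2) * \<Omega> y ?us + 0)) y ?w"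
          unfolding B_def using verticalD(3)[OF v r] by (simp add: mult.assoc)
        also have "\<dots> = fibre_bump (l y) * wirtinger \<sigma> (\<lambda>y. of_real ((norm (l e))\<^sup>2) * \<Omega> y ?us + 0) y ?w"
          unfolding wirtinger_mult[OF d(2) c] d(1) by simp
        also have "\<dots> = fibre_bump (l y) * (of_real ((norm (l e))\<^sup>2) * wirtinger \<sigma> (\<lambda>y. \<Omega> y ?us) y ?w)"
          by (subst wirtinger_lincomb) (use smooth_formD(4)[OF \<Omega> y] in auto)
        finally show "B ?w (e # (\<i> *s e) # ?us) =
            (fibre_bump (l y) * of_real ((norm (l e))\<^sup>2)) * wirtinger \<sigma> (\<lambda>y. \<Omega> y ?us) y ?w" by simp
      qed
      also have "\<dots> = fibre_bump (l y) * of_real ((norm (l e))\<^sup>2) * dolbeault \<sigma> \<Omega> y ws"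
        unfolding alt_sum_cmult using y by (simp add: dolbeault_def)
      finally show ?thesis .
    qed
    ultimately show ?thesis unfolding dolbeault by blast
  qed
qed

text \<open>Tangent vectors are moved into the kernel of \<open>l\<close> along the fibre direction
  \<open>x\<close>: \<open>\<Theta>\<close> does not change because \<open>x\<close> and
  \<open>\<i> *s x\<close> are among its arguments, and \<open>\<Omega>\<close> does not because it
  is basic. What remains is the integral of the bump function over the fibre, rescaled by
  \<open>l x\<close>.\<close>

lemma fibre_integral_vertical:
  assumes l: "linear_form l" and \<Omega>: "basic_form k \<Omega>" and alt: "\<And>y. alternating j (\<Theta> y)"
    and v: "vertical l \<Theta> \<Omega>" and 0: "\<And>x. l x = 0 \<Longrightarrow> \<Theta> x = (\<lambda>vs. 0) \<and> \<Omega> x = (\<lambda>vs. 0)"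
  shows "fibre_integral \<Theta> = \<Omega>"
proof (intro ext)
  fix x :: "complex^'a" and vs :: "(complex^'a) list"
  consider "x = 0" | "x \<noteq> 0" "l x = 0" | "x \<noteq> 0" "l x \<noteq> 0" by blast
  then show "fibre_integral \<Theta> x vs = \<Omega> x vs"
  proof cases
    case 1
    then show ?thesis using smooth_formD(3)[OF basic_formD(1)[OF \<Omega>]] by (simp add: fibre_integral_def)
  next
    case 2
    then have "\<Theta> (c *s x) us = 0" for c us using 0[of "c *s x"] by (simp add: linear_formD[OF l])
    then show ?thesis using 2 0[of x] by (simp add: fibre_integral_def)
  next
    case 3
    have pt: "\<Theta> (c *s x) (x # (\<i> *s x) # map ((*s) c) vs) =
        fibre_bump (l x * c) * (of_real ((norm (l x))\<^sup>2) * \<Omega> x vs)" if c: "c \<noteq> 0" for c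
    proof -
      let ?vs = "map ((*s) c) vs"
      let ?z = "\<lambda>v. - (l v / l x) *s x"
      let ?ws = "map (\<lambda>v. v + ?z v) ?vs"
      let ?Z = "range (\<lambda>a. a *s x)"
      have ker: "w \<in> set ?ws \<Longrightarrow> l w = 0" for w
        using 3 by (auto simp: linear_formD[OF l])
      have "\<Theta> (c *s x) ([x, \<i> *s x] @ ?ws) = \<Theta> (c *s x) ([x, \<i> *s x] @ ?vs)"
      proof (rule alternating_shift[OF alt])
        fix us assume "set us \<inter> ?Z \<noteq> {}"
        then obtain a where "a *s x \<in> set us" by auto
        then obtain u1 u2 where us: "us = u1 @ a *s x # u2" by (meson split_list)
        show "\<Theta> (c *s x) ([x, \<i> *s x] @ us) = 0"
          using alternating_mem[OF alt, of x "[x, \<i> *s x] @ u1" u2 "c *s x" a] by (simp add: us)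
      next
        fix v show "?z v \<in> ?Z" by (rule rangeI)
      qed
      moreover have "\<Theta> (c *s x) (x # (\<i> *s x) # ?ws) = fibre_bump (l (c *s x)) * of_real ((norm (l x))\<^sup>2) * \<Omega> (c *s x) ?ws"
        by (rule verticalD(3)[OF v ker])
      moreover have "\<Omega> (c *s x) ([] @ ?ws) = \<Omega> (c *s x) ([] @ ?vs)"
      proof (rule alternating_shift[OF smooth_formD(1)[OF basic_formD(1)[OF \<Omega>]]])
        fix us assume "set us \<inter> ?Z \<noteq> {}"
        then obtain a where "a *s x \<in> set us" by auto
        moreover have "a *s x = (a / c) *s (c *s x)" using c by simp
        ultimately show "\<Omega> (c *s x) ([] @ us) = 0" using basic_formD(3)[OF \<Omega>, of "a / c" "c *s x" us] by simp
      next
        fix v show "?z v \<in> ?Z" by (rule rangeI)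
      qed
      ultimately show ?thesis
        using basic_formD(2)[OF \<Omega> c, of x vs] by (simp add: linear_formD[OF l] mult.commute)
    qed
    let ?f = "\<lambda>c. \<Theta> (c *s x) (x # (\<i> *s x) # map ((*s) c) vs)"
    let ?g = "\<lambda>c. fibre_bump (l x * c) * (of_real ((norm (l x))\<^sup>2) * \<Omega> x vs)"
    have "fibre_integral \<Theta> x vs = (LINT c|lborel. ?f c)" using 3 by (simp add: fibre_integral_def)
    also have "\<dots> = (LINT c|lborel. ?g c)"
    proof (rule integral_cong_AE)
      show g: "?g \<in> borel_measurable lborel" by measurable
      show "AE c in lborel. ?f c = ?g c"
        by (rule AE_mp[OF AE_lborel_singleton[of "0::complex"]], rule AE_I2) (simp add: pt)
      have e: "?f = (\<lambda>c. if c = 0 then ?f 0 else ?g c)"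
        using pt by (intro ext) (simp only: if_split, blast)
      show "?f \<in> borel_measurable lborel"
        by (subst e, rule measurable_If[OF _ g]) auto
    qed
    also have "\<dots> = (of_real ((norm (l x))\<^sup>2) * (LINT c|lborel. fibre_bump (l x * c))) * \<Omega> x vs"
      by simp
    also have "of_real ((norm (l x))\<^sup>2) * (LINT c|lborel. fibre_bump (l x * c)) = (LINT c|lborel. fibre_bump c)"
      by (rule integral_complex_mult(1)[OF measurable_fibre_bump 3(2)])
    finally show ?thesis by (simp add: integral_fibre_bump)
  qed
qed

definition lifted_form :: "(complex^'n \<Rightarrow> complex) \<Rightarrow> ('n::finite) form \<Rightarrow> 'n form" where
  "lifted_form l \<omega> x vs = fibre_bump (l x) * wedge2 l (\<omega> x) vs"

lemma fibre_integral_cmult: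
  "fibre_integral (\<lambda>x vs. c * \<Theta> x vs) = (\<lambda>x vs. c * fibre_integral \<Theta> x vs)"
  by (intro ext) (simp add: fibre_integral_def)

lemma ddc_dolbeault: "ddc \<eta> x vs = \<i> / (2 * of_real pi) * dolbeault 1 (dolbeault (- 1) \<eta>) x vs"
  by (simp add: ddc_def del_eq_dolbeault delbar_eq_dolbeault)

lemma open_Compl_0: "open (- {0 :: complex^'n::finite})"
  by (simp add: open_Compl)

context
  fixes l :: "complex^'n::finite \<Rightarrow> complex" and \<omega> :: "'n form" and \<delta> :: real and p :: nat
  assumes l: "linear_form l" and \<omega>: "\<omega> \<in> proj_forms p p" and \<delta>: "\<delta> > 0"
    and supp: "\<And>x. (norm (l x))\<^sup>2 \<le> \<delta> * (norm x)\<^sup>2 \<Longrightarrow> \<omega> x = (\<lambda>vs. 0)"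
begin

lemma basic_form_chart: "basic_form (p + p) \<omega>"
  by (rule proj_forms_basic_form[OF \<omega>])

lemma smooth_form_lifted: "smooth_form (Suc (Suc (p + p))) (lifted_form l \<omega>)"
  unfolding smooth_form_def
proof (intro conjI allI)
  fix x
  show "alternating (Suc (Suc (p + p))) (lifted_form l \<omega> x)"
    unfolding lifted_form_def[abs_def]
    by (rule alternating_cmult[OF alternating_wedge2[OF l smooth_formD(1)[OF basic_formD(1)[OF basic_form_chart]]]])
next
  fix vs
  have b: "smooth_on (- {0}) (\<lambda>x. fibre_bump (l x))"
    by (rule smooth_on_fibre_bump[OF open_Compl_0 smooth_on_bounded_linear[OF open_Compl_0 linear_form_bounded_linear[OF l]]])
  show "smooth_on (- {0}) (\<lambda>x. lifted_form l \<omega> x vs)"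
    unfolding lifted_form_def wedge2_def alt_sum_def
    by (intro smooth_on_mult smooth_on_sum smooth_on_const b open_Compl_0 smooth_formD(2)[OF basic_formD(1)[OF basic_form_chart]])
next
  show "lifted_form l \<omega> 0 = (\<lambda>vs. 0)"
    by (simp add: lifted_form_def[abs_def] linear_formD[OF l] fibre_bump_0)
qed

text \<open>Where the bump does not vanish, \<open>norm (l x)\<close> lies between \<open>1\<close>
  and \<open>2\<close>; where \<open>\<omega>\<close> does not vanish, it exceeds
  \<open>sqrt \<delta> * norm x\<close>. Together they bound \<open>norm x\<close> by
  \<open>sqrt (4 / \<delta>)\<close>.\<close>

lemma lifted_support:
  obtains K where "compact K" "0 \<notin> K" "\<And>x. x \<notin> K \<Longrightarrow> lifted_form l \<omega> x = (\<lambda>vs. 0)"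
    "\<And>x. x \<in> K \<Longrightarrow> l x \<noteq> 0"
proof -
  define K where "K = {x. 1 \<le> norm (l x)} \<inter> {x. norm (l x) \<le> 2} \<inter> cball 0 (sqrt (4 / \<delta>))"
  have c: "continuous_on UNIV l" by (rule linear_continuous_on[OF linear_form_bounded_linear[OF l]])
  have "closed ({x. 1 \<le> norm (l x)} \<inter> {x. norm (l x) \<le> 2})"
    by (intro closed_Int closed_Collect_le continuous_intros c)
  then have K: "compact K" unfolding K_def by (intro closed_Int_compact) auto
  show ?thesis
  proof (rule that[OF K])
    show "0 \<notin> K" "x \<in> K \<Longrightarrow> l x \<noteq> 0" for x by (auto simp: K_def linear_formD[OF l])
    fix x assume x: "x \<notin> K"
    show "lifted_form l \<omega> x = (\<lambda>vs. 0)"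
    proof (cases "fibre_bump (l x) = 0")
      case False
      then have n: "1 \<le> norm (l x)" "norm (l x) \<le> 2" using fibre_bump_nonzero by auto
      then have "sqrt (4 / \<delta>) < norm x" using x by (auto simp: K_def)
      then have "(sqrt (4 / \<delta>))\<^sup>2 \<le> (norm x)\<^sup>2" using \<delta> by (intro power_mono) auto
      then have "4 / \<delta> \<le> (norm x)\<^sup>2" using \<delta> by simp
      then have "4 \<le> \<delta> * (norm x)\<^sup>2" using \<delta> by (simp add: field_simps)
      moreover have "(norm (l x))\<^sup>2 \<le> 2\<^sup>2" using n by (intro power_mono) auto
      ultimately have "\<omega> x = (\<lambda>vs. 0)" by (intro supp) simp
      then show ?thesis by (simp add: lifted_form_def[abs_def] wedge2_def alt_sum_def)
    qed (simp add: lifted_form_def[abs_def])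
  qed
qed

lemma lifted_test_form: "lifted_form l \<omega> \<in> test_forms (Suc p) (Suc p)"
proof -
  obtain K where K: "compact K" "0 \<notin> K" "\<And>x. x \<notin> K \<Longrightarrow> lifted_form l \<omega> x = (\<lambda>vs. 0)"
    by (rule lifted_support) blast
  have type: "\<omega> x (map ((*s) c) ws) = (c ^ p * cnj c ^ p) * \<omega> x ws" for x c ws
    using \<omega> unfolding proj_forms_def forms_def by blast
  have "lifted_form l \<omega> x (map ((*s) c) vs) = c ^ Suc p * cnj c ^ Suc p * lifted_form l \<omega> x vs" for x c vs
    unfolding lifted_form_def wedge2_scale[of l "\<omega> x" c "c ^ p * cnj c ^ p" vs, OF l type]
    by (simp add: linear_formD[OF l] mult_ac)
  then have "lifted_form l \<omega> \<in> forms (Suc p) (Suc p)"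
    using smooth_form_lifted unfolding forms_def smooth_form_def by simp
  then show ?thesis unfolding test_forms_def using K by blast
qed

lemma vertical_lifted: "vertical l (lifted_form l \<omega>) \<omega>"
  unfolding vertical_def lifted_form_def
  by (auto simp: wedge2_kernel[OF l] wedge2_Cons[OF l] wedge2_frame[OF l])

lemma fibre_integral_lifted: "fibre_integral (lifted_form l \<omega>) = \<omega>"
proof (rule fibre_integral_vertical[OF l basic_form_chart smooth_formD(1)[OF smooth_form_lifted] vertical_lifted])
  fix x assume "l x = 0"
  then show "lifted_form l \<omega> x = (\<lambda>vs. 0) \<and> \<omega> x = (\<lambda>vs. 0)"
    using supp[of x] \<delta> by (simp add: lifted_form_def[abs_def] fibre_bump_0)
qed

text \<open>No differentiation under the integral sign is involved: the pointwise relation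
  \<open>vertical\<close> survives both operators, and \<open>fibre_integral_vertical\<close> then
  applies to the derivatives.\<close>

lemma fibre_integral_ddc_lifted: "fibre_integral (ddc (lifted_form l \<omega>)) = ddc \<omega>"
proof -
  obtain K where K: "compact K" "0 \<notin> K" "\<And>x. x \<notin> K \<Longrightarrow> lifted_form l \<omega> x = (\<lambda>vs. 0)"
    "\<And>x. x \<in> K \<Longrightarrow> l x \<noteq> 0"
    by (rule lifted_support) blast
  note sl = smooth_form_lifted and s\<omega> = basic_formD(1)[OF basic_form_chart]
  have "fibre_integral (dolbeault 1 (dolbeault (- 1) (lifted_form l \<omega>))) = dolbeault 1 (dolbeault (- 1) \<omega>)"
  proof (rule fibre_integral_vertical[OF l basic_form_dolbeault[OF basic_form_dolbeault[OF basic_form_chart]]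
        smooth_formD(1)[OF smooth_form_dolbeault[OF smooth_form_dolbeault[OF sl]]]
        vertical_dolbeault[OF l smooth_form_dolbeault[OF s\<omega>] vertical_dolbeault[OF l s\<omega> vertical_lifted]]])
    fix x assume x: "l x = 0"
    have "dolbeault 1 (dolbeault (- 1) (lifted_form l \<omega>)) x = (\<lambda>vs. 0)"
      by (intro dolbeault_eq_0[OF compact_imp_closed[OF K(1)]] K(3)) (use K(4) x in auto)
    moreover have "dolbeault 1 (dolbeault (- 1) \<omega>) x = (\<lambda>vs. 0)"
    proof (cases "x = 0")
      case False
      \<comment> \<open>Its complement is an open set that contains \<open>x\<close> and on which
        \<open>\<omega>\<close> vanishes by the support condition, so the derivatives vanish at
        \<open>x\<close>.\<close>
      define K' where "K' = {x. \<delta> * (norm x)\<^sup>2 \<le> (norm (l x))\<^sup>2}"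
      have c: "continuous_on UNIV l" by (rule linear_continuous_on[OF linear_form_bounded_linear[OF l]])
      have K': "closed K'" unfolding K'_def by (intro closed_Collect_le continuous_intros c)
      have "x \<notin> K'" using False x \<delta> by (simp add: K'_def not_le)
      then show ?thesis
        by (intro dolbeault_eq_0[OF K']) (auto simp: K'_def intro: supp)
    qed (simp add: dolbeault_def[abs_def])
    ultimately show "dolbeault 1 (dolbeault (- 1) (lifted_form l \<omega>)) x = (\<lambda>vs. 0) \<and> dolbeault 1 (dolbeault (- 1) \<omega>) x = (\<lambda>vs. 0)" ..
  qed
  then show ?thesis unfolding ddc_dolbeault[abs_def] fibre_integral_cmult by simp
qed

end

section \<open>Integrals over linear subspaces and their bases\<close>

lemma integrable_cvol_compact_support:
  fixes \<phi> :: "complex^'n::finite \<Rightarrow> complex"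
  assumes basis: "is_basis UNIV (cs @ [e])" and K: "compact K"
    and \<phi>: "continuous_on UNIV \<phi>" "\<And>y. y \<notin> K \<Longrightarrow> \<phi> y = 0" and m: "length cs = m"
  shows "integrable (cvol m) (\<lambda>x. \<phi> (lin_comb cs x))"
proof -
  obtain M where M: "M > 0" "\<And>y. norm (\<phi> y) \<le> M"
    using bounded_compact_support[OF \<phi>(1) K \<phi>(2)] by auto
  have [measurable]: "\<phi> \<in> borel_measurable borel" by (rule borel_measurable_continuous_onI[OF \<phi>(1)])
  have lm [measurable]: "lin_comb cs \<in> borel_measurable (cvol m)" by (rule measurable_lin_comb[OF m])
  obtain R where R: "R > 0" "\<And>z i. lin_comb (cs @ [e]) z \<in> K \<Longrightarrow> i < length (cs @ [e]) \<Longrightarrow> norm (z i) \<le> R"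
    by (rule is_basis_coordinate_bound_compact[OF basis K]) blast
  let ?B = "{x \<in> space (cvol m). \<forall>i<m. norm (x i) \<le> R}"
  have "integrable (cvol m) (\<lambda>x. M * indicator ?B x)"
    by (intro integrable_mult_right integrable_real_indicator measurable_cvol_box emeasure_cvol_box)
  then show ?thesis
  proof (rule Bochner_Integration.integrable_bound)
    show "(\<lambda>x. \<phi> (lin_comb cs x)) \<in> borel_measurable (cvol m)" by measurable
    show "AE x in cvol m. norm (\<phi> (lin_comb cs x)) \<le> norm (M * indicator ?B x)"
    proof (rule AE_I2)
      fix x assume x: "x \<in> space (cvol m)"
      show "norm (\<phi> (lin_comb cs x)) \<le> norm (M * indicator ?B x)"
      proof (cases "x \<in> ?B")
        case True
        then show ?thesis using M by simp
      next
        case False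
        have "lin_comb cs x \<notin> K"
        proof
          assume "lin_comb cs x \<in> K"
          then have k: "lin_comb (cs @ [e]) (x(m := 0)) \<in> K" using lin_comb_update_snoc[of cs e x 0] m by simp
          have "norm (x i) \<le> R" if "i < m" for i using R(2)[OF k, of i] that m by simp
          then show False using False x by simp
        qed
        then show ?thesis using \<phi>(2) by simp
      qed
    qed
  qed
qed

lemma is_basis_rotate: "is_basis W (b # cs) \<Longrightarrow> is_basis W (cs @ [b])"
  by (auto simp: is_basis_def)

lemma is_basis_affine_nonzero:
  assumes "is_basis W (cs @ [b])"
  shows "b + lin_comb cs z \<noteq> 0"
proof
  assume 0: "b + lin_comb cs z = 0"
  then have "lin_comb (cs @ [b]) (z(length cs := 1)) = 0"
    unfolding lin_comb_update_snoc by (simp add: add.commute)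
  from is_basis_lin_comb(1)[OF assms this, of "length cs"] show False by simp
qed

lemma is_basis_kernel_snoc:
  fixes s :: "complex^'n::finite \<Rightarrow> complex"
  assumes s: "linear_form s" and bs: "is_basis {x. s x = 0} bs" and e: "s e = 1"
  shows "is_basis UNIV (bs @ [e])"
proof -
  have d: "distinct bs" "vec.independent (set bs)" "vec.span (set bs) = {x. s x = 0}"
    using bs by (auto simp: is_basis_def)
  have ne: "e \<notin> vec.span (set bs)" unfolding d(3) using e by simp
  then have "e \<notin> set bs" using vec.span_base by blast
  moreover have "vec.independent (insert e (set bs))" by (rule vec.independent_insertI[OF ne d(2)])
  moreover have "x \<in> vec.span (insert e (set bs))" for x
  proof -
    have "x - s x *s e \<in> vec.span (set bs)" unfolding d(3) by (simp add: linear_formD[OF s] e)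
    then show ?thesis unfolding vec.span_breakdown_eq by blast
  qed
  ultimately show ?thesis using d(1) by (auto simp: is_basis_def)
qed

text \<open>\<open>integral_proj\<close> selects its basis by choice; existence guarantees that the
  selected list is one.\<close>

lemma is_basis_some:
  fixes W :: "(complex^'n::finite) set"
  assumes "vec.subspace W"
  shows "is_basis W (SOME bs. is_basis W bs)"
proof -
  obtain B where B: "B \<subseteq> W" "vec.independent B" "W \<subseteq> vec.span B"
    by (rule vec.basis_exists[of W])
  have "finite B" by (rule vec.finiteI_independent[OF B(2)])
  then obtain bs where bs: "set bs = B" "distinct bs" using finite_distinct_list by blast
  have "vec.span B = W" using vec.span_minimal[OF B(1) assms] B(3) by blast
  then have "is_basis W bs" using bs B by (simp add: is_basis_def)
  then show ?thesis by (rule someI)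
qed

lemma integral_proj_eq:
  assumes "(SOME bs. is_basis W bs) = b # cs"
  shows "integral_proj W \<omega> = (LINT z|cvol (length cs). \<omega> (b + lin_comb cs z) (frame cs))"
  unfolding integral_proj_def assms by (simp add: lin_comb_def)

section \<open>A partition of unity on projective space\<close>

text \<open>Homogeneous of degree zero, hence a function on the projective space. The squared
  coordinates sum to \<open>(norm x)\<^sup>2\<close>, so some quotient is at least
  \<open>1 / CARD('n)\<close>; with half of this as threshold, some weight is positive at every
  nonzero point.\<close>

definition chart_weight :: "'n::finite \<Rightarrow> complex^'n \<Rightarrow> real" where
  "chart_weight k x = flat_exp 0 ((norm (x $ k))\<^sup>2 / (norm x)\<^sup>2 - 1 / (2 * real CARD('n)))"

definition chart_partition :: "'n::finite \<Rightarrow> complex^'n \<Rightarrow> real" where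
  "chart_partition k x = chart_weight k x / (\<Sum>j\<in>UNIV. chart_weight j x)"

lemma norm_vec_square: "(norm (x :: complex^'n::finite))\<^sup>2 = (\<Sum>i\<in>UNIV. (norm (x $ i))\<^sup>2)"
  by (simp add: norm_vec_def L2_set_def sum_nonneg)

lemma norm_smult_vec: "norm (c *s (x :: complex^'n::finite)) = norm c * norm x"
  by (simp add: norm_vec_def norm_mult L2_set_right_distrib)

lemma sum_chart_weight_pos:
  fixes x :: "complex^'n::finite"
  assumes "x \<noteq> 0"
  shows "(\<Sum>j\<in>UNIV. chart_weight j x) > 0"
proof -
  have n: "(norm x)\<^sup>2 > 0" using assms by simp
  have c: "real CARD('n) > 0" by simp
  have "\<exists>j. (norm (x $ j))\<^sup>2 / (norm x)\<^sup>2 > 1 / (2 * real CARD('n))"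
  proof (rule ccontr)
    assume "\<not> ?thesis"
    then have "(norm (x $ j))\<^sup>2 \<le> (norm x)\<^sup>2 / (2 * real CARD('n))" for j
      using n by (auto simp: not_less field_simps)
    then have "(\<Sum>j\<in>UNIV. (norm (x $ j))\<^sup>2) \<le> (\<Sum>j\<in>(UNIV::'n set). (norm x)\<^sup>2 / (2 * real CARD('n)))"
      by (intro sum_mono) simp
    also have "\<dots> = (norm x)\<^sup>2 / 2" by simp
    finally show False using n by (simp add: norm_vec_square[symmetric])
  qed
  then obtain j where "chart_weight j x > 0" unfolding chart_weight_def flat_exp_pos by auto
  moreover have "chart_weight i x \<ge> 0" for i unfolding chart_weight_def by (rule flat_exp_pos)
  ultimately show ?thesis by (intro sum_pos2[of UNIV j]) auto
qed

lemma sum_chart_partition: "x \<noteq> 0 \<Longrightarrow> (\<Sum>k\<in>UNIV. chart_partition k x) = 1"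
  using sum_chart_weight_pos[of x] by (simp add: chart_partition_def flip: sum_divide_distrib)

lemma chart_partition_smult: "c \<noteq> 0 \<Longrightarrow> chart_partition k (c *s x) = chart_partition k x"
  by (simp add: chart_partition_def chart_weight_def norm_smult_vec norm_mult power_mult_distrib)

lemma chart_partition_support:
  fixes x :: "complex^'n::finite"
  assumes "(norm (x $ k))\<^sup>2 \<le> 1 / (2 * real CARD('n)) * (norm x)\<^sup>2"
  shows "chart_partition k x = 0"
proof -
  have "(norm (x $ k))\<^sup>2 / (norm x)\<^sup>2 - 1 / (2 * real CARD('n)) \<le> 0"
    using assms by (cases "x = 0") (auto simp: field_simps)
  then have "chart_weight k x = 0" unfolding chart_weight_def flat_exp_pos .
  then show ?thesis by (simp add: chart_partition_def)
qed

lemma smooth_on_chart_partition: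
  "smooth_on (- {0}) (chart_partition k :: complex^'n::finite \<Rightarrow> real)"
proof -
  have x: "smooth_on (- {0}) (\<lambda>x :: complex^'n. (norm (x $ i))\<^sup>2)" for i
    by (intro smooth_on_norm_square open_Compl_0 smooth_on_bounded_linear bounded_linear_vec_nth)
  have n: "smooth_on (- {0}) (\<lambda>x :: complex^'n. (norm x)\<^sup>2)"
    unfolding norm_vec_square by (intro smooth_on_sum open_Compl_0 x)
  have w: "smooth_on (- {0}) (\<lambda>x :: complex^'n. chart_weight i x)" for i
  proof -
    have "smooth_on (- {0}) (\<lambda>x :: complex^'n. (norm (x $ i))\<^sup>2 * inverse ((norm x)\<^sup>2) - 1 / (2 * real CARD('n)))"
      by (intro smooth_on_diff smooth_on_mult smooth_on_inverse smooth_on_const open_Compl_0 x n) auto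
    then have "smooth_on (- {0}) (\<lambda>x :: complex^'n. (norm (x $ i))\<^sup>2 / (norm x)\<^sup>2 - 1 / (2 * real CARD('n)))"
      by (simp only: divide_inverse[symmetric])
    then show ?thesis
      unfolding chart_weight_def by (rule smooth_on_compose_real[OF open_Compl_0 smooth_on_flat_exp])
  qed
  have "smooth_on (- {0}) (\<lambda>x :: complex^'n. \<Sum>j\<in>UNIV. chart_weight j x)"
    by (rule smooth_on_sum[OF open_Compl_0 w])
  moreover have "(\<Sum>j\<in>UNIV. chart_weight j x) \<noteq> 0" if "x \<in> - {0}" for x :: "complex^'n"
    using sum_chart_weight_pos[of x] that by simp
  ultimately have "smooth_on (- {0}) (\<lambda>x :: complex^'n. chart_weight k x * inverse (\<Sum>j\<in>UNIV. chart_weight j x))"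
    by (intro smooth_on_mult[OF open_Compl_0 w] smooth_on_inverse[OF open_Compl_0])
  then show ?thesis by (simp only: chart_partition_def[abs_def] divide_inverse)
qed

lemma chart_partition_proj_form:
  fixes \<omega> :: "('n::finite) form"
  assumes \<omega>: "\<omega> \<in> proj_forms p q"
  shows "(\<lambda>x vs. of_real (chart_partition k x) * \<omega> x vs) \<in> proj_forms p q"
proof -
  have f: "\<omega> \<in> forms p q" using \<omega> by (simp add: proj_forms_def)
  have s: "smooth_on (- {0}) (\<lambda>x. of_real (chart_partition k x) * \<omega> x vs)" for vs
    by (intro smooth_on_mult smooth_on_linear[OF _ bounded_linear_of_real] smooth_on_chart_partition
        open_Compl_0 smooth_formD(2)[OF forms_smooth_form[OF f]])
  have "\<omega> x (map ((*s) c) vs) = c ^ p * cnj c ^ q * \<omega> x vs" for x c vs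
    using f unfolding forms_def by blast
  then have "(\<lambda>x vs. of_real (chart_partition k x) * \<omega> x vs) \<in> forms p q"
    unfolding forms_def
    using s smooth_formD(1)[OF forms_smooth_form[OF f]] smooth_formD(3)[OF forms_smooth_form[OF f]]
    by (simp add: alternating_cmult mult.left_commute)
  moreover note pf = basic_formD[OF proj_forms_basic_form[OF \<omega>]]
  ultimately show ?thesis
    unfolding proj_forms_def by (simp add: chart_partition_smult pf(2)) (use pf(3) in blast)
qed

section \<open>The first Chern current\<close>

context
  fixes fs :: "nat \<Rightarrow> 'n::finite pol_morphism" and h :: "(nat \<Rightarrow> 'n pol_morphism) \<Rightarrow> 'n metric"
    and T :: "'n form \<Rightarrow> complex" and s :: "complex^'n \<Rightarrow> complex" and p :: nat
    and b b' e :: "complex^'n" and cs cs' :: "(complex^'n) list"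
  assumes fs: "fs \<in> Bbar" and h: "admissible_metrics h" and T: "is_green_current fs T"
    and s: "linear_form s" and card: "CARD('n) = Suc (Suc p)"
    and basis: "is_basis UNIV (b # cs)" and kernel: "is_basis {x. s x = 0} (b' # cs')" and e: "s e = 1"
begin

abbreviation (input) potential :: "'n proj \<Rightarrow> complex" where
  "potential q \<equiv> of_real (- ln ((h fs q (value_at s q))\<^sup>2))"

text \<open>The bases are arbitrary, so that those selected inside \<open>integral_proj\<close> can
  be inserted. Integrability is carried along because the chart contributions are added
  afterwards.\<close>

lemma chern_current_chart:
  assumes l: "linear_form l" and \<omega>: "\<omega> \<in> proj_forms p p" and \<delta>: "\<delta> > 0"
    and supp: "\<And>x. (norm (l x))\<^sup>2 \<le> \<delta> * (norm x)\<^sup>2 \<Longrightarrow> \<omega> x = (\<lambda>vs. 0)"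
  shows "integrable (cvol (length cs)) (\<lambda>z. potential (proj (b + lin_comb cs z)) * ddc \<omega> (b + lin_comb cs z) (frame cs))"
    and "integrable (cvol (length cs')) (\<lambda>z. \<omega> (b' + lin_comb cs' z) (frame cs'))"
    and "T \<omega> = (LINT z|cvol (length cs). potential (proj (b + lin_comb cs z)) * ddc \<omega> (b + lin_comb cs z) (frame cs)) +
      (LINT z|cvol (length cs'). \<omega> (b' + lin_comb cs' z) (frame cs'))"
proof -
  define \<eta> where "\<eta> = lifted_form l \<omega>"
  note s\<eta> = smooth_form_lifted[OF l \<omega> \<delta> supp, folded \<eta>_def]
  obtain K where "compact K" "0 \<notin> K" "\<And>x. x \<notin> K \<Longrightarrow> lifted_form l \<omega> x = (\<lambda>vs. 0)"
    using lifted_support[OF l \<omega> \<delta> supp] by metis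
  note K = this[folded \<eta>_def]
  have sD: "smooth_form (2 * CARD('n)) (dolbeault 1 (dolbeault (- 1) \<eta>))"
    using smooth_form_dolbeault[OF smooth_form_dolbeault[OF s\<eta>]] card by (simp add: mult_2)
  have D0: "x \<notin> K \<Longrightarrow> dolbeault 1 (dolbeault (- 1) \<eta>) x = (\<lambda>vs. 0)" for x
    by (intro dolbeault_eq_0[OF compact_imp_closed[OF K(1)]] K(3))
  have alt: "alternating (2 * CARD('n)) (ddc \<eta> y)" for y
    unfolding ddc_dolbeault[abs_def] by (rule alternating_cmult[OF smooth_formD(1)[OF sD]])
  have ddc0: "x \<notin> K \<Longrightarrow> ddc \<eta> x vs = 0" for x vs by (simp add: ddc_dolbeault D0)
  have ddcc: "continuous_on UNIV (\<lambda>y. ddc \<eta> y vs)" for vs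
    unfolding ddc_dolbeault
    by (intro continuous_intros smooth_on_continuous_on[OF smooth_form_smooth_UNIV[OF sD K(1,2) D0]])
  have \<eta>c: "continuous_on UNIV (\<lambda>y. \<eta> y vs)" for vs
    by (rule smooth_on_continuous_on[OF smooth_form_smooth_UNIV[OF s\<eta> K]])
  define G where "G = metric_potential (h fs)"
  let ?std = "frame (standard_basis :: (complex^'n) list)"
  let ?D = "\<lambda>y. ddc \<eta> y ?std"
  have im: "is_metric (h fs)" by (rule admissible_is_metric[OF fs h fs])
  have Gc: "continuous_on (- {0}) G"
    unfolding G_def using h fs by (intro continuous_metric_potential) (simp add: admissible_metrics_def)
  \<comment> \<open>\<open>G\<close> is continuous only away from the origin, near which
    \<open>ddc \<eta>\<close> vanishes.\<close>
  have GDc: "continuous_on UNIV (\<lambda>y. of_real (G y) * ?D y)"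
  proof -
    have "continuous_on (- {0}) (\<lambda>y. of_real (G y) * ?D y)"
      by (intro continuous_intros Gc continuous_on_subset[OF ddcc]) simp
    moreover have "continuous_on (- K) (\<lambda>y. of_real (G y) * ?D y)"
      by (rule continuous_on_eq[OF continuous_on_const[of _ 0]]) (simp add: ddc0)
    ultimately have "continuous_on (- {0} \<union> - K) (\<lambda>y. of_real (G y) * ?D y)"
      by (intro continuous_on_open_Un) (auto simp: open_Compl compact_imp_closed[OF K(1)])
    moreover have "- {0} \<union> - K = UNIV" using K(2) by auto
    ultimately show ?thesis by simp
  qed
  have GDi: "integrable lborel (\<lambda>y. of_real (G y) * ?D y)"
    by (rule integrable_compact_support[OF GDc K(1)]) (simp add: ddc0)

  \<comment> \<open>The vector \<open>e\<close> completes the basis of the kernel of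
    \<open>s\<close> to the adapted basis that \<open>poincare_lelong\<close> requires.\<close>
  have kb: "is_basis UNIV ((cs' @ [b']) @ [e])"
    by (rule is_basis_kernel_snoc[OF s is_basis_rotate[OF kernel] e])
  have lcs': "length cs' = p" using is_basis_length[OF kb] card by simp
  have ker: "s c = 0" if "c \<in> set (cs' @ [b'])" for c
  proof -
    have "c \<in> vec.span (set (b' # cs'))" by (rule vec.span_base) (use that in auto)
    then show ?thesis using kernel by (simp add: is_basis_def)
  qed
  have lk: "length (cs' @ [b']) = Suc p" using lcs' by simp
  have s\<eta>': "smooth_form (2 * Suc p) \<eta>" using s\<eta> by (simp add: mult_2)
  let ?L = "\<lambda>y. of_real (ln ((norm (s y))\<^sup>2)) * ?D y"
  have nz: "AE y in lborel. s y \<noteq> 0"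
    by (rule AE_linear_form_nonzero[OF s kb lk e ker])
  have PL1: "integrable lborel ?L"
    by (rule poincare_lelong(1)[OF s kb lk e ker s\<eta>' K])
  have PL2: "(LINT y|lborel. ?L y) = (LINT x|cvol (Suc p). \<eta> (lin_comb (cs' @ [b']) x) (frame (cs' @ [b'])))"
    by (rule poincare_lelong(2)[OF s kb lk e ker s\<eta>' K])

  define F where "F y = potential (proj y)" for y :: "complex^'n"
  have F_smult: "c \<noteq> 0 \<Longrightarrow> F (c *s y) = F y" for c y by (simp add: F_def proj_smult)
  \<comment> \<open>On the hyperplane \<open>F\<close> is zero by the convention
    \<open>ln 0 = 0\<close>. The formula makes the product measurable, and the exceptional set is
    null.\<close>
  have FD: "F y * ?D y = (if s y = 0 then 0 else of_real (G y) * ?D y - ?L y)" for y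
  proof (cases "y = 0")
    case True
    then show ?thesis using ddc0[OF K(2)] by simp
  next
    case False
    show ?thesis
    proof (cases "s y = 0")
      case True
      then show ?thesis
        using metric_value_at[OF im linear_formD(2)[OF s] False] by (simp add: F_def)
    next
      case sy: False
      have "F y = of_real (G y) - of_real (ln ((norm (s y))\<^sup>2))"
        unfolding F_def metric_potential_section[OF im linear_formD(2)[OF s] False sy] G_def by simp
      then show ?thesis using sy by (simp only: left_diff_distrib if_False)
    qed
  qed
  have sm [measurable]: "s \<in> borel_measurable borel"
    by (rule borel_measurable_continuous_onI[OF linear_continuous_on[OF linear_form_bounded_linear[OF s]]])
  have Dm [measurable]: "?D \<in> borel_measurable borel" by (rule borel_measurable_continuous_onI[OF ddcc])
  have GDm [measurable]: "(\<lambda>y. of_real (G y) * ?D y) \<in> borel_measurable borel"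
    by (rule borel_measurable_continuous_onI[OF GDc])
  have FDm [measurable]: "(\<lambda>y. F y * ?D y) \<in> borel_measurable borel"
    unfolding FD by measurable
  have ae: "AE y in lborel. F y * ?D y = of_real (G y) * ?D y - ?L y"
    using nz by eventually_elim (simp add: FD)
  have FDi: "integrable lborel (\<lambda>y. F y * ?D y)"
  proof (rule integrable_cong_AE_imp[OF Bochner_Integration.integrable_diff[OF GDi PL1]])
    show "(\<lambda>y. F y * ?D y) \<in> borel_measurable lborel" using FDm by simp
    show "AE y in lborel. of_real (G y) * ?D y - ?L y = F y * ?D y" using ae by eventually_elim simp
  qed
  have split: "(LINT y|lborel. of_real (G y) * ?D y) = (LINT y|lborel. F y * ?D y) + (LINT y|lborel. ?L y)"
  proof -
    have "(LINT y|lborel. F y * ?D y) = (LINT y|lborel. of_real (G y) * ?D y - ?L y)"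
      by (rule integral_cong_AE[OF borel_measurable_integrable[OF FDi]
            borel_measurable_integrable[OF Bochner_Integration.integrable_diff[OF GDi PL1]] ae])
    also have "\<dots> = (LINT y|lborel. of_real (G y) * ?D y) - (LINT y|lborel. ?L y)"
      by (rule Bochner_Integration.integral_diff[OF GDi PL1])
    finally show ?thesis by simp
  qed

  have bs: "is_basis UNIV (cs @ [b])" by (rule is_basis_rotate[OF basis])
  have cardc: "CARD('n) = Suc (length cs)" using is_basis_length[OF bs] by simp
  obtain \<kappa> :: real where \<kappa>: "\<kappa> > 0"
    and jac: "\<And>D. alternating (2 * CARD('n)) D \<Longrightarrow> D (frame (cs @ [b])) = of_real \<kappa> * D ?std"
    and int: "\<And>g::complex^'n \<Rightarrow> complex. g \<in> borel_measurable borel \<Longrightarrow>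
      integrable (cvol CARD('n)) (\<lambda>z. g (lin_comb (cs @ [b]) z)) \<longleftrightarrow> integrable lborel g"
      "\<And>g::complex^'n \<Rightarrow> complex. g \<in> borel_measurable borel \<Longrightarrow>
      of_real \<kappa> * (LINT z|cvol CARD('n). g (lin_comb (cs @ [b]) z)) = (LINT y|lborel. g y)"
    by (rule integral_basis[OF bs]) blast
  \<comment> \<open>The constant \<open>\<kappa>\<close> enters here through the frame and in
    \<open>int\<close> through the measure; the two cancel in \<open>first\<close>.\<close>
  have fr: "F y * ddc \<eta> y (frame (cs @ [b])) = of_real \<kappa> * (F y * ?D y)" for y
    unfolding jac[OF alt] by (rule mult.left_commute)
  have FBm: "(\<lambda>y. F y * ddc \<eta> y (frame (cs @ [b]))) \<in> borel_measurable borel"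
    unfolding fr by measurable
  have FBi: "integrable (cvol (Suc (length cs)))
      (\<lambda>z. F (lin_comb (cs @ [b]) z) * ddc \<eta> (lin_comb (cs @ [b]) z) (frame (cs @ [b])))"
    using int(1)[OF FBm] FDi unfolding cardc fr by simp
  have cone1: "integrable (cvol (length cs)) (\<lambda>z. F (b + lin_comb cs z) * fibre_integral (ddc \<eta>) (b + lin_comb cs z) (frame cs))"
    by (rule integral_over_cone(1)[where F = F, OF alt[unfolded cardc] refl F_smult FBm FBi is_basis_affine_nonzero[OF bs]])
  have cone2: "(LINT z|cvol (Suc (length cs)). F (lin_comb (cs @ [b]) z) * ddc \<eta> (lin_comb (cs @ [b]) z) (frame (cs @ [b]))) =
      (LINT z|cvol (length cs). F (b + lin_comb cs z) * fibre_integral (ddc \<eta>) (b + lin_comb cs z) (frame cs))"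
    by (rule integral_over_cone(2)[where F = F, OF alt[unfolded cardc] refl F_smult FBm FBi is_basis_affine_nonzero[OF bs]])
  have fib: "fibre_integral (ddc \<eta>) = ddc \<omega>"
    unfolding \<eta>_def by (rule fibre_integral_ddc_lifted[OF l \<omega> \<delta> supp])
  show "integrable (cvol (length cs)) (\<lambda>z. potential (proj (b + lin_comb cs z)) * ddc \<omega> (b + lin_comb cs z) (frame cs))"
    using cone1 unfolding fib F_def .
  have first: "(LINT y|lborel. F y * ?D y) =
      (LINT z|cvol (length cs). potential (proj (b + lin_comb cs z)) * ddc \<omega> (b + lin_comb cs z) (frame cs))"
  proof -
    have "of_real \<kappa> * (LINT z|cvol (Suc (length cs)).
        F (lin_comb (cs @ [b]) z) * ddc \<eta> (lin_comb (cs @ [b]) z) (frame (cs @ [b]))) =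
        (LINT y|lborel. of_real \<kappa> * (F y * ?D y))"
      using int(2)[OF FBm] unfolding cardc fr .
    then have "of_real \<kappa> * (LINT z|cvol (Suc (length cs)).
        F (lin_comb (cs @ [b]) z) * ddc \<eta> (lin_comb (cs @ [b]) z) (frame (cs @ [b]))) =
        of_real \<kappa> * (LINT y|lborel. F y * ?D y)" by simp
    note eq = this
    have "complex_of_real \<kappa> \<noteq> 0" using \<kappa> by simp
    from mult_left_cancel[OF this, THEN iffD1, OF eq]
    show ?thesis unfolding cone2 fib unfolding F_def by (rule sym)
  qed

  have alt': "alternating (2 * Suc (length cs')) (\<eta> y)" for y
    using smooth_formD(1)[OF s\<eta>'] lcs' by simp
  have \<eta>m: "(\<lambda>y. 1 * \<eta> y (frame (cs' @ [b']))) \<in> borel_measurable borel"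
    using borel_measurable_continuous_onI[OF \<eta>c] by simp
  have \<eta>i: "integrable (cvol (Suc (length cs')))
      (\<lambda>z. 1 * \<eta> (lin_comb (cs' @ [b']) z) (frame (cs' @ [b'])))"
    using integrable_cvol_compact_support[OF kb K(1) \<eta>c _ lk, of "frame (cs' @ [b'])"] K(3) lcs' by simp
  \<comment> \<open>Fibre integration inside the linear hyperplane, with constant weight
    \<open>1\<close>.\<close>
  have cone3: "integrable (cvol (length cs')) (\<lambda>z. 1 * fibre_integral \<eta> (b' + lin_comb cs' z) (frame cs'))"
    by (rule integral_over_cone(1)[where F = "\<lambda>_. 1", OF alt' refl refl \<eta>m \<eta>i
          is_basis_affine_nonzero[OF is_basis_rotate[OF kernel]]])
  have cone4: "(LINT z|cvol (Suc (length cs')). 1 * \<eta> (lin_comb (cs' @ [b']) z) (frame (cs' @ [b']))) =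
      (LINT z|cvol (length cs'). 1 * fibre_integral \<eta> (b' + lin_comb cs' z) (frame cs'))"
    by (rule integral_over_cone(2)[where F = "\<lambda>_. 1", OF alt' refl refl \<eta>m \<eta>i
          is_basis_affine_nonzero[OF is_basis_rotate[OF kernel]]])
  have fib': "fibre_integral \<eta> = \<omega>"
    unfolding \<eta>_def by (rule fibre_integral_lifted[OF l \<omega> \<delta> supp])
  show "integrable (cvol (length cs')) (\<lambda>z. \<omega> (b' + lin_comb cs' z) (frame cs'))"
    using cone3 unfolding fib' by simp
  have second: "(LINT y|lborel. ?L y) = (LINT z|cvol (length cs'). \<omega> (b' + lin_comb cs' z) (frame cs'))"
    using PL2 cone4 unfolding fib' lcs' by simp

  have \<eta>t: "\<eta> \<in> test_forms (CARD('n) - 1) (CARD('n) - 1)"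
    using lifted_test_form[OF l \<omega> \<delta> supp] card by (simp add: \<eta>_def)
  have "T \<omega> = T (fibre_integral \<eta>)" by (simp add: fib')
  also have "\<dots> = pullback_current T \<eta>" using \<eta>t by (simp add: pullback_current_def)
  also have "\<dots> = ddc_affine (green_function fs) \<eta>" using T by (simp add: is_green_current_def)
  also have "\<dots> = (LINT y|lborel. of_real (green_function fs y) * ?D y)"
    using \<eta>t by (simp add: ddc_affine_def integral_affine_def)
  also have "\<dots> = (LINT y|lborel. of_real (G y) * ?D y)"
  proof (rule Bochner_Integration.integral_cong[OF refl])
    fix y
    \<comment> \<open>The Green function is compared with the potential only off the origin; at the
      origin the other factor is zero.\<close>
    show "of_real (green_function fs y) * ?D y = of_real (G y) * ?D y"
      using green_function_eq_potential[OF fs h, of y] ddc0[OF K(2)] by (cases "y = 0") (simp_all add: G_def)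
  qed
  finally show "T \<omega> = (LINT z|cvol (length cs). potential (proj (b + lin_comb cs z)) * ddc \<omega> (b + lin_comb cs z) (frame cs)) +
      (LINT z|cvol (length cs'). \<omega> (b' + lin_comb cs' z) (frame cs'))"
    unfolding split first second .
qed

end

lemma proj_forms_zero: "(\<lambda>x vs. 0) \<in> proj_forms p q"
  by (simp add: proj_forms_def forms_def alternating_null smooth_on_const open_Compl_0)

lemma proj_forms_add:
  assumes "\<omega> \<in> proj_forms p q" "\<eta> \<in> proj_forms p q"
  shows "(\<lambda>x vs. 1 * \<omega> x vs + \<eta> x vs) \<in> proj_forms p q"
proof -
  have f: "\<omega> \<in> forms p q" "\<eta> \<in> forms p q" using assms by (simp_all add: proj_forms_def)
  have "basic_form (p + q) (\<lambda>x vs. 1 * \<omega> x vs + \<eta> x vs)"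
    by (rule basic_form_lincomb[OF proj_forms_basic_form[OF assms(1)] proj_forms_basic_form[OF assms(2)]])
  note pf = basic_formD[OF this]
  have "\<omega> x (map ((*s) c) vs) = c ^ p * cnj c ^ q * \<omega> x vs" "\<eta> x (map ((*s) c) vs) = c ^ p * cnj c ^ q * \<eta> x vs" for x c vs
    using f unfolding forms_def by blast+
  then have "1 * \<omega> x (map ((*s) c) vs) + \<eta> x (map ((*s) c) vs) = c ^ p * cnj c ^ q * (1 * \<omega> x vs + \<eta> x vs)" for x c vs
    by (simp add: distrib_left)
  then show ?thesis
    unfolding proj_forms_def forms_def using pf(1)[unfolded smooth_form_def] pf(2,3) by blast
qed

lemma current_sum:
  fixes T :: "('n::finite) form \<Rightarrow> complex"
  assumes T: "T \<in> currents" and fin: "finite I"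
    and \<omega>: "\<And>i. \<omega> i \<in> proj_forms (CARD('n) - 2) (CARD('n) - 2)"
  shows "(\<lambda>x vs. \<Sum>i\<in>I. \<omega> i x vs) \<in> proj_forms (CARD('n) - 2) (CARD('n) - 2) \<and>
    T (\<lambda>x vs. \<Sum>i\<in>I. \<omega> i x vs) = (\<Sum>i\<in>I. T (\<omega> i))"
proof -
  let ?P = "proj_forms (CARD('n) - 2) (CARD('n) - 2) :: 'n form set"
  have lin: "T (\<lambda>x vs. a * \<alpha> x vs + \<beta> x vs) = a * T \<alpha> + T \<beta>" if "\<alpha> \<in> ?P" "\<beta> \<in> ?P" for \<alpha> \<beta> a
    using T that unfolding currents_def by blast
  show ?thesis
    using fin
  proof (induction I)
    case empty
    show ?case using lin[OF proj_forms_zero proj_forms_zero, of 1] by (simp add: proj_forms_zero)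
  next
    case (insert i I)
    then show ?case
      using lin[OF \<omega>[of i], of _ 1] proj_forms_add[OF \<omega>[of i]] by simp
  qed
qed

lemma ddc_sum:
  assumes fin: "finite I" and \<omega>: "\<And>i. smooth_form k (\<omega> i)"
  shows "ddc (\<lambda>x vs. \<Sum>i\<in>I. \<omega> i x vs) x vs = (\<Sum>i\<in>I. ddc (\<omega> i) x vs)"
proof -
  have "smooth_form k (\<lambda>x vs. \<Sum>i\<in>I. \<omega> i x vs) \<and>
      dolbeault 1 (dolbeault (- 1) (\<lambda>x vs. \<Sum>i\<in>I. \<omega> i x vs)) = (\<lambda>x vs. \<Sum>i\<in>I. dolbeault 1 (dolbeault (- 1) (\<omega> i)) x vs)"
    using fin
  proof (induction I)
    case empty
    have 0: "dolbeault \<sigma> (\<lambda>x vs. 0) = (\<lambda>x vs. 0)" for \<sigma>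
      by (intro ext) (simp add: dolbeault_def alt_sum_def)
    show ?case unfolding sum.empty 0 by (simp add: smooth_form_def alternating_null smooth_on_const open_Compl_0)
  next
    case (insert i I)
    note IH = insert.IH[THEN conjunct1] insert.IH[THEN conjunct2]
    show ?case
      using smooth_form_lincomb[OF \<omega>[of i] IH(1), of 1] dolbeault_lincomb[OF \<omega>[of i] IH(1), of "- 1" 1]
        dolbeault_lincomb[OF smooth_form_dolbeault[OF \<omega>[of i], of "- 1"] smooth_form_dolbeault[OF IH(1), of "- 1"], of 1 1] insert.hyps IH(2)
      by simp
  qed
  then show ?thesis by (simp add: ddc_dolbeault sum_distrib_left)
qed

theorem proposition6p4:
  fixes fs :: "nat \<Rightarrow> 'n::finite pol_morphism"
    and h :: "(nat \<Rightarrow> 'n pol_morphism) \<Rightarrow> 'n metric"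
    and T :: "'n form \<Rightarrow> complex"
    and s :: "complex^'n \<Rightarrow> complex"
  assumes "CARD('n) \<ge> 2"
    and "fs \<in> Bbar"
    and "admissible_metrics h"
    and "is_green_current fs T"
    and "hom_poly 1 s" and "s \<noteq> (\<lambda>x. 0)"
  shows "chern_current s (h fs) = T"
proof
  fix \<omega> :: "'n form"
  define p where "p = CARD('n) - 2"
  have card: "CARD('n) = Suc (Suc p)" using assms(1) by (simp add: p_def)
  have s: "linear_form s" by (rule hom_poly_1_linear_form[OF assms(5)])
  obtain x where "s x \<noteq> 0" using assms(6) by auto
  then have e: "s ((1 / s x) *s x) = 1" by (simp add: linear_formD[OF s])
  have T: "T \<in> currents" using assms(4) by (simp add: is_green_current_def)
  show "chern_current s (h fs) \<omega> = T \<omega>"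
  proof (cases "\<omega> \<in> proj_forms p p")
    \<comment> \<open>Both currents are extensional, so they agree outside the space of smooth
      forms.\<close>
    case False
    then show ?thesis
      using T by (simp add: chern_current_def currents_def extensional_def p_def)
  next
    case \<omega>: True
    have B1: "is_basis UNIV (SOME bs :: (complex^'n) list. is_basis UNIV bs)"
      by (rule is_basis_some[OF vec.subspace_UNIV])
    have "vec.subspace {x. s x = 0}"
      by (auto simp: vec.subspace_def linear_formD[OF s])
    then have B2: "is_basis {x. s x = 0} (SOME bs. is_basis {x. s x = 0} bs)"
      by (rule is_basis_some)
    obtain b cs where bs: "(SOME bs :: (complex^'n) list. is_basis UNIV bs) = b # cs"
      using is_basis_length[OF B1] card by (cases "SOME bs :: (complex^'n) list. is_basis UNIV bs") auto
    obtain b' cs' where bs': "(SOME bs. is_basis {x. s x = 0} bs) = b' # cs'"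
      using is_basis_length[OF is_basis_kernel_snoc[OF s B2 e]] card
      by (cases "SOME bs. is_basis {x. s x = 0} bs") auto
    let ?u = "\<lambda>q. complex_of_real (- ln ((h fs q (value_at s q))\<^sup>2))"
    define \<psi> where "\<psi> k = (\<lambda>x vs. of_real (chart_partition k x) * \<omega> x vs)" for k :: 'n
    have \<psi>: "\<psi> k \<in> proj_forms p p" for k
      unfolding \<psi>_def by (rule chart_partition_proj_form[OF \<omega>])
    have lin: "linear_form (\<lambda>x :: complex^'n. x $ k)" for k by (simp add: linear_form_def)
    have pos: "1 / (2 * real CARD('n)) > 0" by simp
    have supp: "(norm (x $ k))\<^sup>2 \<le> 1 / (2 * real CARD('n)) * (norm x)\<^sup>2 \<Longrightarrow> \<psi> k x = (\<lambda>vs. 0)" for k x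
      using chart_partition_support[of x k] by (simp add: \<psi>_def)
    \<comment> \<open>In the chart \<open>k\<close> the linear form \<open>l\<close> is the
      coordinate \<open>x $ k\<close>, and \<open>\<delta>\<close> is the threshold of
      \<open>chart_weight\<close>.\<close>
    note chart = chern_current_chart[OF assms(2-4) s card B1[unfolded bs] B2[unfolded bs'] e lin \<psi> pos supp]
    have sum: "\<omega> = (\<lambda>x vs. \<Sum>k\<in>UNIV. \<psi> k x vs)"
    proof (intro ext)
      fix x vs
      show "\<omega> x vs = (\<Sum>k\<in>UNIV. \<psi> k x vs)"
      proof (cases "x = 0")
        \<comment> \<open>At the origin the partition does not sum to one, but forms are zero there
          by convention.\<close>
        case True
        then show ?thesis
          using smooth_formD(3)[OF basic_formD(1)[OF proj_forms_basic_form[OF \<omega>]]] by (simp add: \<psi>_def)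
      next
        case False
        then have "(\<Sum>k\<in>UNIV. complex_of_real (chart_partition k x)) = 1"
          using sum_chart_partition[of x] by (metis of_real_1 of_real_sum)
        then show ?thesis by (simp add: \<psi>_def flip: sum_distrib_right)
      qed
    qed
    have ddc: "ddc \<omega> x vs = (\<Sum>k\<in>UNIV. ddc (\<psi> k) x vs)" for x vs
      by (subst sum) (rule ddc_sum[OF finite basic_formD(1)[OF proj_forms_basic_form[OF \<psi>]]])
    have "T \<omega> = (\<Sum>k\<in>UNIV. T (\<psi> k))"
      using current_sum[OF T finite[of UNIV], of \<psi>] \<psi> unfolding sum[symmetric] p_def by simp
    also have "\<dots> =
        (\<Sum>k\<in>UNIV. LINT z|cvol (length cs). ?u (proj (b + lin_comb cs z)) * ddc (\<psi> k) (b + lin_comb cs z) (frame cs)) +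
        (\<Sum>k\<in>UNIV. LINT z|cvol (length cs'). \<psi> k (b' + lin_comb cs' z) (frame cs'))"
      by (subst sum.distrib[symmetric]) (rule sum.cong[OF refl chart(3)])
    also have "(\<Sum>k\<in>UNIV. LINT z|cvol (length cs). ?u (proj (b + lin_comb cs z)) * ddc (\<psi> k) (b + lin_comb cs z) (frame cs)) =
        integral_proj UNIV (\<lambda>x vs. ?u (proj x) * ddc \<omega> x vs)"
      unfolding integral_proj_eq[OF bs] ddc sum_distrib_left
      by (rule Bochner_Integration.integral_sum[OF chart(1), symmetric])
    also have "(\<Sum>k\<in>UNIV. LINT z|cvol (length cs'). \<psi> k (b' + lin_comb cs' z) (frame cs')) =
        integral_proj {x. s x = 0} \<omega>"
      unfolding integral_proj_eq[OF bs']
      by (subst sum, rule Bochner_Integration.integral_sum[OF chart(2), symmetric])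
    also have "integral_proj UNIV (\<lambda>x vs. ?u (proj x) * ddc \<omega> x vs) + integral_proj {x. s x = 0} \<omega> =
        chern_current s (h fs) \<omega>"
      using \<omega> by (simp add: chern_current_def ddc_proj_def delta_div_def p_def)
    finally show ?thesis ..
  qed
qed

end
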